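(* Let $V$ be a finite-dimensional real vector space and $\mathbf X$ a $V$-valued $\rho$-branched rough path. (1) $\mathbf X$ is geometric (i.e. lies in the image of $\mathfrak a^*$) if and only if, for all $p_1,\ldots,p_n\in\mathcal P(V^* )$ (with $p_1\top\cdots\top p_n$ of weight at most $\lfloor\rho\rfloor$), $\langle p_1\top\cdots\top p_n,\mathbf X\rangle=0$ whenever some $p_k$ belongs to the direct complement, in $\mathcal P(V^* )$, of the space of single-vertex trees, given by the primitives generated by forests with more than one vertex. (2) $\mathbf X$ is quasi-geometric (i.e. lies in the image of $\widetilde{\mathfrak a}^*$) if and only if, for all $p_1,\ldots,p_n\in\mathcal P(V^* )$ (with $p_1\top\cdots\top p_n$ of weight at most $\lfloor\rho\rfloor$), $\langle p_1\top\cdots\top p_n,\mathbf X\rangle=0$ whenever some $p_k$ belongs to the direct complement of $\mathcal P_{\mathscr r}(V^* )$ in $\mathcal P(V^* )$ generated by forests that have an edge, i.e. the span of the $\pi(f)$ with $f$ a decorated forest having at least one edge.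
   Context: **Connes–Kreimer.** For a finite-dimensional real vector space $U$, $\mathcal H(U)$ is spanned by non-planar rooted forests (including the empty forest $\mathbf 1$) with vertices decorated by elements of $U$, modulo multilinearity; $|f|$ (weight) is the number of vertices, $\mathcal H^n$ the part of weight $\le n$, $\mathcal H_+$ the span of non-empty forests. $\mathcal H_{\mathrm{CK}}(U)$ has the disjoint union product and $\Delta_{\mathrm{CK}}f=\sum_Af|_A\otimes f|_{A^c}$, over vertex subsets $A$ closed under passing to descendants. $\mathcal P(U)\subset\mathcal H_+$ is the space of primitives. $[f]_\gamma$ is the tree obtained by joining the roots of $f$ to a new root decorated by $\gamma$. Natural growth: $f\top\mathbf 1=f=\mathbf 1\top f$, $f\top g=\frac1{|g|}\sum_v(\text{graft all roots of }f\text{ onto }v\in g)$ for non-empty forests, iterated from the left. $p_1\otimes\cdots\otimes p_n\mapsto p_1\top\cdots\top p_n$ is a coalgebra isomorphism $\bigotimes(\mathcal P)\to\mathcal H_{\mathrm{CK}}$ (deconcatenation on the left), and $\pi\colon\mathcal H_{\mathrm{CK}}\to\mathcal P$ is the corresponding projection onto words of length one. $\mathcal P_{\mathscr r}(U)$ is the span of the elements $\pi(\mathscr r(\gamma_1,\ldots,\gamma_n))$, $n\ge1$, where $\mathscr r(\gamma_1,\ldots,\gamma_n)$ is the forest of $n$ single vertices decorated by $\gamma_1,\ldots,\gamma_n\in U$. **Grossman–Larson and rough paths.** $\mathcal H_{\mathrm{GL}}(V)=(\mathcal H(V),\star,\Delta_{\mathrm{GL}})$: $f\star g$ sums over all ways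 of, for each tree of $f$, grafting it onto a vertex of $g$ or leaving it separate; $\Delta_{\mathrm{GL}}(t_1\cdots t_n)=\sum_{I\subset[n]}t_I\otimes t_{[n]\setminus I}$. It is the graded dual of $\mathcal H_{\mathrm{CK}}(V^* )$ through $\langle f,g\rangle=\sum_b\prod_v\langle\text{label}_f(v),\text{label}_g(b(v))\rangle$ over isomorphisms $b$ of undecorated forests. Given $\rho\ge1$ and a control $\omega$ (continuous, superadditive, zero on the diagonal), a $V$-valued $\rho$-branched rough path on $[0,T]$ is a map $(s,t)\mapsto\mathbf X_{s,t}\in\mathcal H_{\mathrm{GL}}^{\lfloor\rho\rfloor}(V)$ with (truncating) $\mathbf X_{s,t}=\mathbf X_{s,u}\star\mathbf X_{u,t}$; $\langle fg,\mathbf X_{s,t}\rangle=\langle f,\mathbf X_{s,t}\rangle\langle g,\mathbf X_{s,t}\rangle$, $\langle\mathbf 1,\mathbf X_{s,t}\rangle=1$; $|\langle f,\mathbf X_{s,t}\rangle|=O(\omega(s,t)^{|f|/\rho})$. **(Quasi-)shuffle algebras and arborification.** $\mathrm{Sh}(U)$ is the shuffle Hopf algebra on $\bigotimes(U)$ with deconcatenation. $\mathrm{QSh}(U)$ is the quasi-shuffle Hopf algebra on $\bigotimes(\bigodot(U))$, $\bigodot(U)=\bigoplus_{n\ge1}U^{\odot n}$, with deconcatenation and the product determined by $\mathbf 1$ being a unit and $(wa)\,\widetilde{\sqcup\!\sqcup}\,(vb)=(w\,\widetilde{\sqcup\!\sqcup}\,vb)a+(wa\,\widetilde{\sqcup\!\sqcup}\,v)b+(w\,\widetilde{\sqcup\!\sqcup}\,v)(a\odot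 b)$ for words $w,v$ and letters $a,b\in\bigodot(U)$ (here $\widetilde{\sqcup\!\sqcup}$ denotes the quasi-shuffle product). $\mathfrak a\colon\mathcal H_{\mathrm{CK}}(U)\to\mathrm{Sh}(U)$ and $\widetilde{\mathfrak a}\colon\mathcal H_{\mathrm{CK}}(U)\to\mathrm{QSh}(U)$ are the surjective Hopf algebra morphisms determined by $\mathfrak a([f]_\gamma)=\mathfrak a(f)\otimes\gamma$ and $\widetilde{\mathfrak a}([f]_\gamma)=\widetilde{\mathfrak a}(f)\otimes\gamma$. Taking $U=V^*$, $\mathfrak a^*$ and $\widetilde{\mathfrak a}^*$ are the dual maps into $\mathcal H_{\mathrm{GL}}(V)$ (from the graded duals of $\mathrm{Sh}(V^* )$, $\mathrm{QSh}(V^* )$). Geometric / quasi-geometric rough paths are defined as branched rough paths are, with $\mathcal H_{\mathrm{CK}}(V^* )$ replaced by $\mathrm{Sh}(V^* )$ / $\mathrm{QSh}(V^* )$ (graded by total degree in $V^*$); "$\mathbf X$ lies in the image" means $\mathbf X=\mathfrak a^*(\mathbf Z)$, resp. $\mathbf X=\widetilde{\mathfrak a}^*(\mathbf Z)$, for such a $\mathbf Z$. *)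

theory Defs
  imports Complex_Main "HOL-Library.Poly_Mapping" "HOL-Library.Multiset" "HOL-Library.FuncSet"
begin

section \<open>Vector spaces given by generators and relations\<close>

instantiation poly_mapping :: (type, real_vector) real_vector
begin

lift_definition scaleR_poly_mapping :: "real \<Rightarrow> ('a \<Rightarrow>\<^sub>0 'b) \<Rightarrow> ('a \<Rightarrow>\<^sub>0 'b)"
  is "\<lambda>c f a. c *\<^sub>R f a"
  by (rule finite_subset [rotated]) auto

instance
  by standard (transfer; simp add: scaleR_add_right scaleR_add_left)+

end

text \<open>
  A type \<open>'a\<close> of generators carries a set of linear relations between formal real linear
  combinations of its elements; \<open>'a pvec\<close> is the free vector space on \<open>'a\<close> modulo the span of
  these relations.
\<close>

class presented =
  fixes relations :: "('a \<Rightarrow>\<^sub>0 real) set"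

quotient_type (overloaded) 'a pvec =
  "'a::presented \<Rightarrow>\<^sub>0 real" / "\<lambda>x y. x - y \<in> span relations"
proof (rule equivpI)
  show "reflp (\<lambda>x y::'a \<Rightarrow>\<^sub>0 real. x - y \<in> span relations)"
    by (simp add: reflp_def span_zero)
  show "symp (\<lambda>x y::'a \<Rightarrow>\<^sub>0 real. x - y \<in> span relations)"
    by (metis (no_types, lifting) minus_diff_eq span_neg sympI)
  show "transp (\<lambda>x y::'a \<Rightarrow>\<^sub>0 real. x - y \<in> span relations)"
    by (rule transpI) (metis (no_types, lifting) diff_add_cancel add_diff_eq span_add)
qed

instantiation pvec :: (presented) real_vector
begin

lift_definition zero_pvec :: "'a pvec" is "0" .

lift_definition plus_pvec :: "'a pvec \<Rightarrow> 'a pvec \<Rightarrow> 'a pvec" is "(+)"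
  by (simp add: add_diff_add span_add)

lift_definition uminus_pvec :: "'a pvec \<Rightarrow> 'a pvec" is "uminus"
  by (metis minus_diff_minus span_neg)

lift_definition minus_pvec :: "'a pvec \<Rightarrow> 'a pvec \<Rightarrow> 'a pvec" is "(-)"
  by (metis diff_diff_add diff_diff_eq2 add_diff_eq diff_add_eq span_diff)

lift_definition scaleR_pvec :: "real \<Rightarrow> 'a pvec \<Rightarrow> 'a pvec" is "(*\<^sub>R)"
  by (metis scaleR_diff_right span_scale)

instance
  by standard (transfer; simp add: algebra_simps span_zero)+

end

lift_definition gen :: "'a::presented \<Rightarrow> 'a pvec" is "\<lambda>a. Poly_Mapping.single a 1" .

text \<open>
  The linear map with prescribed values \<open>\<phi>\<close> on the generators; it exists (and is unique)
  when \<open>\<phi>\<close> respects the relations, see \<open>linext\<close> below.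
\<close>

definition linext :: "('a::presented \<Rightarrow> 'w::real_vector) \<Rightarrow> 'a pvec \<Rightarrow> 'w" where
  "linext \<phi> = (THE g. linear g \<and> (\<forall>a. g (gen a) = \<phi> a))"

definition bilinext ::
  "('a::presented \<Rightarrow> 'b::presented \<Rightarrow> 'w::real_vector) \<Rightarrow> 'a pvec \<Rightarrow> 'b pvec \<Rightarrow> 'w" where
  "bilinext \<phi> x y = linext (\<lambda>a. linext (\<phi> a) y) x"

definition free_ext :: "('a \<Rightarrow> 'w::real_vector) \<Rightarrow> ('a \<Rightarrow>\<^sub>0 real) \<Rightarrow> 'w" where
  "free_ext \<phi> x = (\<Sum>a\<in>Poly_Mapping.keys x. Poly_Mapping.lookup x a *\<^sub>R \<phi> a)"

definition descends :: "('a::presented \<Rightarrow> 'w::real_vector) \<Rightarrow> bool" where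
  "descends \<phi> \<longleftrightarrow> (\<forall>r\<in>relations. free_ext \<phi> r = 0)"

lemma free_ext_superset:
  assumes "finite S" "Poly_Mapping.keys x \<subseteq> S"
  shows "free_ext \<phi> x = (\<Sum>a\<in>S. Poly_Mapping.lookup x a *\<^sub>R \<phi> a)"
  unfolding free_ext_def
  by (rule sum.mono_neutral_left) (use assms in \<open>auto simp: in_keys_iff\<close>)

lemma lookup_scaleR [simp]: "Poly_Mapping.lookup (c *\<^sub>R x) a = c *\<^sub>R Poly_Mapping.lookup x a"
  by transfer simp

lemma linear_free_ext: "linear (free_ext \<phi>)"
proof (rule linearI)
  fix x y :: "'a \<Rightarrow>\<^sub>0 real" and c :: real
  let ?S = "Poly_Mapping.keys x \<union> Poly_Mapping.keys y"
  have "free_ext \<phi> (x + y) = (\<Sum>a\<in>?S. Poly_Mapping.lookup (x + y) a *\<^sub>R \<phi> a)"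
    by (rule free_ext_superset) (use Poly_Mapping.keys_add [of x y] in auto)
  also have "\<dots> = free_ext \<phi> x + free_ext \<phi> y"
    by (simp add: free_ext_superset [of ?S x] free_ext_superset [of ?S y]
        lookup_add scaleR_add_left sum.distrib)
  finally show "free_ext \<phi> (x + y) = free_ext \<phi> x + free_ext \<phi> y" .
  have "free_ext \<phi> (c *\<^sub>R x) =
    (\<Sum>a\<in>Poly_Mapping.keys x. Poly_Mapping.lookup (c *\<^sub>R x) a *\<^sub>R \<phi> a)"
    by (rule free_ext_superset) (auto simp: in_keys_iff)
  then show "free_ext \<phi> (c *\<^sub>R x) = c *\<^sub>R free_ext \<phi> x"
    by (simp add: free_ext_def scaleR_sum_right)
qed

lemma free_ext_single [simp]: "free_ext \<phi> (Poly_Mapping.single a c) = c *\<^sub>R \<phi> a"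
  by (cases "c = 0") (simp_all add: free_ext_def)

lemma free_ext_diff: "free_ext \<phi> (x - y) = free_ext \<phi> x - free_ext \<phi> y"
  by (rule linear_diff [OF linear_free_ext])

lemma free_ext_scaleR: "free_ext \<phi> (c *\<^sub>R x) = c *\<^sub>R free_ext \<phi> x"
  by (rule linear_scale [OF linear_free_ext])

lemma free_decomposition: "x = free_ext (\<lambda>a. Poly_Mapping.single a (1::real)) x"
proof (rule poly_mapping_eqI)
  fix k
  have "Poly_Mapping.lookup (free_ext (\<lambda>a. Poly_Mapping.single a (1::real)) x) k =
    (\<Sum>a\<in>Poly_Mapping.keys x. Poly_Mapping.lookup x a * (1 when a = k))"
    by (simp add: free_ext_def lookup_sum lookup_single)
  also have "\<dots> = (\<Sum>a\<in>Poly_Mapping.keys x. if a = k then Poly_Mapping.lookup x a else 0)"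
    by (rule sum.cong) (auto simp: when_def)
  also have "\<dots> = Poly_Mapping.lookup x k"
    by (simp add: sum.delta in_keys_iff)
  finally show "Poly_Mapping.lookup x k =
    Poly_Mapping.lookup (free_ext (\<lambda>a. Poly_Mapping.single a (1::real)) x) k" ..
qed

lemma linear_abs_pvec: "linear abs_pvec"
  by (rule linearI) (simp_all add: plus_pvec.abs_eq scaleR_pvec.abs_eq)

lemma span_gen: "span (range gen) = (UNIV :: 'a::presented pvec set)"
proof -
  have "x \<in> span (range gen)" for x :: "'a pvec"
  proof -
    obtain y where x: "x = abs_pvec y"
      by (metis Quotient3_abs_rep Quotient3_pvec)
    have "x = (\<Sum>a\<in>Poly_Mapping.keys y. Poly_Mapping.lookup y a *\<^sub>R gen a)"
      unfolding x
      by (subst free_decomposition [of y])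
        (simp add: free_ext_def gen.abs_eq linear_sum [OF linear_abs_pvec]
          linear_scale [OF linear_abs_pvec])
    then show ?thesis
      by (simp add: span_sum span_scale span_base)
  qed
  then show ?thesis by auto
qed

lemma linext:
  fixes \<phi> :: "'a::presented \<Rightarrow> 'w::real_vector"
  assumes "descends \<phi>"
  shows "linear (linext \<phi>)" and "linext \<phi> (gen a) = \<phi> a"
proof -
  define g where "g x = free_ext \<phi> (rep_pvec x)" for x
  have 0: "free_ext \<phi> y = 0" if "y \<in> span relations" for y
    using that assms by (auto intro: linear_eq_0_on_span [OF linear_free_ext] simp: descends_def)
  have g: "g (abs_pvec y) = free_ext \<phi> y" for y
  proof -
    have "rep_pvec (abs_pvec y) - y \<in> span relations"
      by (rule Quotient3_rep_abs [OF Quotient3_pvec]) (simp add: span_zero)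
    from 0 [OF this] show ?thesis by (simp add: g_def free_ext_diff)
  qed
  have lin: "linear g"
  proof (rule linearI)
    fix x y :: "'a pvec" and c :: real
    obtain x' y' where "x = abs_pvec x'" "y = abs_pvec y'"
      by (metis Quotient3_abs_rep Quotient3_pvec)
    then show "g (x + y) = g x + g y" "g (c *\<^sub>R x) = c *\<^sub>R g x"
      by (simp_all add: plus_pvec.abs_eq scaleR_pvec.abs_eq g
          linear_add [OF linear_free_ext] free_ext_scaleR)
  qed
  have P: "linear g \<and> (\<forall>a. g (gen a) = \<phi> a)"
    by (simp add: lin gen.abs_eq g)
  have "h = g" if "linear h \<and> (\<forall>a. h (gen a) = \<phi> a)" for h
  proof
    fix x :: "'a pvec"
    have "x \<in> span (range gen)" by (simp add: span_gen)
    then show "h x = g x"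
      by (rule linear_eq_on_span [of h g "range gen", rotated 3]) (use that P in auto)
  qed
  with P have "linear (linext \<phi>) \<and> (\<forall>a. linext \<phi> (gen a) = \<phi> a)"
    unfolding linext_def by (rule theI [where P = "\<lambda>g. linear g \<and> (\<forall>a. g (gen a) = \<phi> a)"])
  then show "linear (linext \<phi>)" "linext \<phi> (gen a) = \<phi> a" by auto
qed

text \<open>
  The tensor product of \<open>'a pvec\<close> and \<open>'b pvec\<close> is \<open>('a \<times> 'b) pvec\<close>, the product of the free
  spaces divided by \<open>R \<otimes> F' + F \<otimes> R'\<close>.
\<close>

instantiation prod :: (presented, presented) presented
begin

definition relations_prod :: "(('a \<times> 'b) \<Rightarrow>\<^sub>0 real) set" where
  "relations_prod =
     {free_ext (\<lambda>a. Poly_Mapping.single (a, b) 1) r | r b. r \<in> relations} \<union>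
     {free_ext (\<lambda>b. Poly_Mapping.single (a, b) 1) r | r a. r \<in> relations}"

instance ..

end

definition tensor :: "'a::presented pvec \<Rightarrow> 'b::presented pvec \<Rightarrow> ('a \<times> 'b) pvec" where
  "tensor = bilinext (\<lambda>a b. gen (a, b))"

section \<open>The dual space\<close>

typedef (overloaded) 'v dual = "{\<phi> :: 'v::real_vector \<Rightarrow> real. linear \<phi>}"
  morphisms eval_dual Abs_dual
  by (rule exI [of _ "\<lambda>_. 0"]) (simp add: linear_zero)

setup_lifting type_definition_dual

instantiation dual :: (real_vector) real_vector
begin

lift_definition zero_dual :: "'a dual" is "\<lambda>_. 0" by (rule linear_zero)

lift_definition plus_dual :: "'a dual \<Rightarrow> 'a dual \<Rightarrow> 'a dual" is "\<lambda>f g x. f x + g x"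
  by (rule linear_compose_add)

lift_definition uminus_dual :: "'a dual \<Rightarrow> 'a dual" is "\<lambda>f x. - f x"
  by (rule linear_compose_neg)

lift_definition minus_dual :: "'a dual \<Rightarrow> 'a dual \<Rightarrow> 'a dual" is "\<lambda>f g x. f x - g x"
  by (rule linear_compose_sub)

lift_definition scaleR_dual :: "real \<Rightarrow> 'a dual \<Rightarrow> 'a dual" is "\<lambda>c f x. c *\<^sub>R f x"
  by (rule linear_compose_scale_right)

instance
  by standard (transfer; simp add: fun_eq_iff algebra_simps)+

end

section \<open>Decorated forests\<close>

lemma finite_acyclic_rank:
  assumes "finite r" "acyclic r"
  obtains h :: "'a \<Rightarrow> nat" where "\<And>v w. (v, w) \<in> r \<Longrightarrow> h w < h v"
proof
  fix v w assume vw: "(v, w) \<in> r"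
  have "finite (r\<^sup>+ `` {v})"
    by (rule finite_subset [of _ "Range r"]) (use assms(1) in \<open>auto simp: finite_Range dest: tranclD2\<close>)
  moreover have "r\<^sup>+ `` {w} \<subset> r\<^sup>+ `` {v}"
    using vw assms(2) by (auto simp: acyclic_def intro: trancl_into_trancl2)
  ultimately show "card (r\<^sup>+ `` {w}) < card (r\<^sup>+ `` {v})"
    by (rule psubset_card_mono)
qed

lemma acyclicI_rank:
  assumes "\<And>v w. (v, w) \<in> r \<Longrightarrow> h w < (h v :: nat)"
  shows "acyclic r"
proof -
  have "h w < h v" if "(v, w) \<in> r\<^sup>+" for v w
    using that by induction (auto dest: assms)
  then show ?thesis by (auto simp: acyclic_def)
qed

text \<open>
  A decorated rooted forest on a finite set of vertices (natural numbers), given by its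
  partial parent function and its labels. The passage to isomorphism classes (which makes
  the forests non-planar and the names of the vertices irrelevant) and the multilinearity in
  the labels are imposed by the relations below.
\<close>

definition is_forest :: "nat set \<times> (nat \<Rightarrow> nat option) \<times> (nat \<Rightarrow> 'u) \<Rightarrow> bool" where
  "is_forest = (\<lambda>(V, p, l). finite V \<and> (\<forall>v w. p v = Some w \<longrightarrow> v \<in> V \<and> w \<in> V) \<and>
     acyclic {(v, w). p v = Some w})"

lemma is_forest_iff_rank:
  "is_forest (V, p, l) \<longleftrightarrow> finite V \<and> (\<forall>v w. p v = Some w \<longrightarrow> v \<in> V \<and> w \<in> V) \<and>
     (\<exists>h :: nat \<Rightarrow> nat. \<forall>v w. p v = Some w \<longrightarrow> h w < h v)"
proof
  assume F: "is_forest (V, p, l)"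
  then have "{(v, w). p v = Some w} \<subseteq> V \<times> V" "finite V"
    by (auto simp: is_forest_def)
  then have "finite {(v, w). p v = Some w}"
    by (meson finite_SigmaI finite_subset)
  then obtain h :: "nat \<Rightarrow> nat" where "\<And>v w. (v, w) \<in> {(v, w). p v = Some w} \<Longrightarrow> h w < h v"
    using F by (metis (mono_tags, lifting) finite_acyclic_rank is_forest_def case_prod_conv)
  with F show "finite V \<and> (\<forall>v w. p v = Some w \<longrightarrow> v \<in> V \<and> w \<in> V) \<and>
     (\<exists>h :: nat \<Rightarrow> nat. \<forall>v w. p v = Some w \<longrightarrow> h w < h v)"
    by (auto simp: is_forest_def)
next
  assume F: "finite V \<and> (\<forall>v w. p v = Some w \<longrightarrow> v \<in> V \<and> w \<in> V) \<and>
     (\<exists>h :: nat \<Rightarrow> nat. \<forall>v w. p v = Some w \<longrightarrow> h w < h v)"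
  then obtain h :: "nat \<Rightarrow> nat" where "\<And>v w. p v = Some w \<Longrightarrow> h w < h v"
    by blast
  then have "acyclic {(v, w). p v = Some w}"
    by (intro acyclicI_rank [where h = h]) simp
  with F show "is_forest (V, p, l)"
    by (simp add: is_forest_def)
qed

typedef 'u forest = "{F :: nat set \<times> (nat \<Rightarrow> nat option) \<times> (nat \<Rightarrow> 'u). is_forest F}"
  by (rule exI [of _ "({}, \<lambda>_. None, \<lambda>_. undefined)"]) (simp add: is_forest_def acyclic_def)

setup_lifting type_definition_forest

lift_definition verts :: "'u forest \<Rightarrow> nat set" is fst .
lift_definition parent :: "'u forest \<Rightarrow> nat \<Rightarrow> nat option" is "fst \<circ> snd" .
lift_definition label :: "'u forest \<Rightarrow> nat \<Rightarrow> 'u" is "snd \<circ> snd" .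

definition weight :: "'u forest \<Rightarrow> nat" where
  "weight f = card (verts f)"

definition roots :: "'u forest \<Rightarrow> nat set" where
  "roots f = {v \<in> verts f. parent f v = None}"

lift_definition relabel :: "'u forest \<Rightarrow> nat \<Rightarrow> 'u \<Rightarrow> 'u forest"
  is "\<lambda>(V, p, l) v a. (V, p, l(v := a))"
  by (auto simp: is_forest_def)

definition shape_isos :: "'u forest \<Rightarrow> 'w forest \<Rightarrow> (nat \<Rightarrow> nat) set" where
  "shape_isos f g = {b \<in> verts f \<rightarrow>\<^sub>E verts g. bij_betw b (verts f) (verts g) \<and>
     (\<forall>v\<in>verts f. parent g (b v) = map_option b (parent f v))}"

definition forest_iso :: "'u forest \<Rightarrow> 'u forest \<Rightarrow> bool" where
  "forest_iso f g \<longleftrightarrow> (\<exists>b\<in>shape_isos f g. \<forall>v\<in>verts f. label g (b v) = label f v)"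

instantiation forest :: (real_vector) presented
begin

definition relations_forest :: "('a forest \<Rightarrow>\<^sub>0 real) set" where
  "relations_forest =
     {Poly_Mapping.single f 1 - Poly_Mapping.single g 1 | f g. forest_iso f g} \<union>
     {Poly_Mapping.single (relabel f v (a + b)) 1 - Poly_Mapping.single (relabel f v a) 1
        - Poly_Mapping.single (relabel f v b) 1 | f v a b. v \<in> verts f} \<union>
     {Poly_Mapping.single (relabel f v (c *\<^sub>R a)) 1 - c *\<^sub>R Poly_Mapping.single (relabel f v a) 1
        | f v a c. v \<in> verts f}"

instance ..

end

text \<open>\<open>'u hopf\<close> is the space \<open>\<H>(U)\<close> underlying both \<open>\<H>\<^sub>C\<^sub>K(U)\<close> and \<open>\<H>\<^sub>G\<^sub>L(U)\<close>.\<close>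

type_synonym 'u hopf = "'u forest pvec"

definition hopf_le :: "nat \<Rightarrow> 'u::real_vector hopf set" where
  "hopf_le n = span {gen f | f. weight f \<le> n}"

definition hopf_plus :: "'u::real_vector hopf set" where
  "hopf_plus = span {gen f | f. verts f \<noteq> {}}"

definition hopf_trunc :: "nat \<Rightarrow> 'u::real_vector hopf \<Rightarrow> 'u hopf" where
  "hopf_trunc n = linext (\<lambda>f. if weight f \<le> n then gen f else 0)"

subsection \<open>Operations on forests\<close>

lift_definition restrict_forest :: "'u forest \<Rightarrow> nat set \<Rightarrow> 'u forest" is
  "\<lambda>(V, p, l) A. (V \<inter> A,
     \<lambda>v. if v \<in> A then (case p v of None \<Rightarrow> None | Some w \<Rightarrow> if w \<in> A then Some w else None)
         else None, l)"
proof goal_cases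
  case F: (1 F A)
  obtain V p l where [simp]: "F = (V, p, l)" by (cases F)
  from F obtain h :: "nat \<Rightarrow> nat" where "\<And>v w. p v = Some w \<Longrightarrow> h w < h v"
    by (auto simp: is_forest_iff_rank)
  with F show ?case
    by (auto simp: is_forest_iff_rank split: option.splits if_splits intro!: exI [of _ h])
qed

text \<open>
  \<open>graft \<phi> f g\<close>: the disjoint union of \<open>f\<close> (on the even numbers) and \<open>g\<close> (on the odd
  numbers), each root \<open>r\<close> of \<open>f\<close> with \<open>\<phi> r = Some v\<close> being attached to the vertex \<open>v\<close> of \<open>g\<close>.
\<close>

lift_definition graft :: "(nat \<Rightarrow> nat option) \<Rightarrow> 'u forest \<Rightarrow> 'u forest \<Rightarrow> 'u forest" is
  "\<lambda>\<phi> (V, p, l) (V', p', l').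
     ((\<lambda>v. 2 * v) ` V \<union> (\<lambda>v. 2 * v + 1) ` V',
      \<lambda>x. if even x then
            (if x div 2 \<in> V then
               (case p (x div 2) of
                  Some w \<Rightarrow> Some (2 * w)
                | None \<Rightarrow>
                   (case \<phi> (x div 2) of
                      None \<Rightarrow> None
                    | Some w \<Rightarrow> if w \<in> V' then Some (2 * w + 1) else None))
             else None)
          else map_option (\<lambda>w. 2 * w + 1) (p' (x div 2)),
      \<lambda>x. if even x then l (x div 2) else l' (x div 2))"
proof goal_cases
  case (1 \<phi> F G)
  obtain V p l V' p' l' where [simp]: "F = (V, p, l)" "G = (V', p', l')" by (cases F, cases G)
  from 1 obtain h h' :: "nat \<Rightarrow> nat"
    where h: "\<And>v w. p v = Some w \<Longrightarrow> h w < h v" and h': "\<And>v w. p' v = Some w \<Longrightarrow> h' w < h' v"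
    and fin: "finite V" "finite V'" and p: "\<And>v w. p v = Some w \<Longrightarrow> v \<in> V \<and> w \<in> V"
    and p': "\<And>v w. p' v = Some w \<Longrightarrow> v \<in> V' \<and> w \<in> V'"
    by (auto simp: is_forest_iff_rank)
  from fin(2) obtain m where m: "\<And>v. v \<in> V' \<Longrightarrow> h' v < m"
    by (metis finite_imageI finite_nat_set_iff_bounded imageI)
  define k where "k x = (if even x then m + h (x div 2) else h' (x div 2))" for x
  have "x \<in> (\<lambda>v. 2 * v + 1) ` V'" if "odd x" "x div 2 \<in> V'" for x :: nat
    using that by (auto elim!: oddE)
  moreover have "h' v < m + h w" if "v \<in> V'" for v w
    using m [OF that] by simp
  moreover have "x \<in> (\<lambda>v. 2 * v) ` V" if "even x" "x div 2 \<in> V" for x :: nat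
    using that by (auto elim!: evenE)
  ultimately show ?case
    using fin p p' h h' m
    by (auto simp: is_forest_iff_rank k_def split: option.splits if_splits intro!: exI [of _ k])
qed

lift_definition add_root :: "'u \<Rightarrow> 'u forest \<Rightarrow> 'u forest" is
  "\<lambda>\<gamma> (V, p, l).
     (insert 0 (Suc ` V),
      case_nat None (\<lambda>v. if v \<in> V then Some (case p v of None \<Rightarrow> 0 | Some w \<Rightarrow> Suc w) else None),
      case_nat \<gamma> l)"
proof goal_cases
  case (1 \<gamma> F)
  obtain V p l where [simp]: "F = (V, p, l)" by (cases F)
  from 1 obtain h :: "nat \<Rightarrow> nat" where "\<And>v w. p v = Some w \<Longrightarrow> h w < h v"
    by (auto simp: is_forest_iff_rank)
  with 1 show ?case
    by (auto simp: is_forest_iff_rank split: option.splits if_splits nat.splits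
        intro!: exI [of _ "case_nat 0 (\<lambda>v. Suc (h v))"])
qed

lift_definition dots :: "'u list \<Rightarrow> 'u forest" is
  "\<lambda>\<gamma>s. ({..<length \<gamma>s}, \<lambda>_. None, \<lambda>v. \<gamma>s ! v)"
  by (simp add: is_forest_def acyclic_def)

section \<open>The Connes--Kreimer Hopf algebra\<close>

definition hone :: "'u::real_vector hopf" where
  "hone = gen (dots [])"

definition hmult :: "'u::real_vector hopf \<Rightarrow> 'u hopf \<Rightarrow> 'u hopf" where
  "hmult = bilinext (\<lambda>f g. gen (graft (\<lambda>_. None) f g))"

definition Bplus :: "'u::real_vector \<Rightarrow> 'u hopf \<Rightarrow> 'u hopf" where
  "Bplus \<gamma> = linext (\<lambda>f. gen (add_root \<gamma> f))"

definition down_sets :: "'u forest \<Rightarrow> nat set set" where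
  "down_sets f = {A. A \<subseteq> verts f \<and> (\<forall>v w. parent f v = Some w \<and> w \<in> A \<longrightarrow> v \<in> A)}"

definition cop :: "'u::real_vector hopf \<Rightarrow> ('u forest \<times> 'u forest) pvec" where
  "cop = linext (\<lambda>f. \<Sum>A\<in>down_sets f.
     gen (restrict_forest f A, restrict_forest f (verts f - A)))"

definition primitives :: "'u::real_vector hopf set" where
  "primitives = {x \<in> hopf_plus. cop x = tensor x hone + tensor hone x}"

definition natural_growth :: "'u::real_vector hopf \<Rightarrow> 'u hopf \<Rightarrow> 'u hopf" where
  "natural_growth = bilinext (\<lambda>f g.
     if verts f = {} then gen g
     else if verts g = {} then gen f
     else (1 / real (weight g)) *\<^sub>R (\<Sum>v\<in>verts g. gen (graft (\<lambda>_. Some v) f g)))"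

definition growth_word :: "'u::real_vector hopf list \<Rightarrow> 'u hopf" where
  "growth_word ps = foldl natural_growth hone ps"

text \<open>
  The linear map \<open>\<pi>\<close>: the projection onto words of length one, transported along the
  isomorphism \<open>p\<^sub>1 \<otimes> \<dots> \<otimes> p\<^sub>n \<mapsto> p\<^sub>1 \<top> \<dots> \<top> p\<^sub>n\<close> from the tensor algebra over the primitives.
\<close>

definition prim_proj :: "'u::real_vector hopf \<Rightarrow> 'u hopf" where
  "prim_proj = (THE g. linear g \<and> (\<forall>ps. set ps \<subseteq> primitives \<longrightarrow>
     g (growth_word ps) = (case ps of [p] \<Rightarrow> p | _ \<Rightarrow> 0)))"

definition primitives_r :: "'u::real_vector hopf set" where
  "primitives_r = span {prim_proj (gen (dots \<gamma>s)) | \<gamma>s. \<gamma>s \<noteq> []}"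

definition single_vertex_trees :: "'u::real_vector hopf set" where
  "single_vertex_trees = span (range (\<lambda>\<gamma>. gen (dots [\<gamma>])))"

definition has_edge :: "'u forest \<Rightarrow> bool" where
  "has_edge f \<longleftrightarrow> (\<exists>v\<in>verts f. parent f v \<noteq> None)"

definition primitives_generated_by :: "('u::real_vector forest \<Rightarrow> bool) \<Rightarrow> 'u hopf set" where
  "primitives_generated_by Q = span {prim_proj (gen f) | f. Q f}"

definition direct_complement :: "'w::real_vector set \<Rightarrow> 'w set \<Rightarrow> 'w set \<Rightarrow> bool" where
  "direct_complement P S D \<longleftrightarrow> subspace P \<and> subspace S \<and> subspace D \<and>
     S \<inter> D = {0} \<and> P = {s + d | s d. s \<in> S \<and> d \<in> D}"

section \<open>The Grossman--Larson product and the pairing\<close>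

definition gl_prod :: "'v::real_vector hopf \<Rightarrow> 'v hopf \<Rightarrow> 'v hopf" where
  "gl_prod = bilinext (\<lambda>f g.
     \<Sum>\<phi>\<in>roots f \<rightarrow>\<^sub>E insert None (Some ` verts g). gen (graft \<phi> f g))"

definition pairing :: "'v::real_vector dual hopf \<Rightarrow> 'v hopf \<Rightarrow> real" where
  "pairing = bilinext (\<lambda>f g.
     \<Sum>b\<in>shape_isos f g. \<Prod>v\<in>verts f. eval_dual (label f v) (label g (b v)))"

section \<open>Words, shuffles and quasi-shuffles\<close>

text \<open>\<open>'w list pvec\<close> is the tensor algebra over \<open>'w\<close>, spanned by words.\<close>

instantiation list :: (real_vector) presented
begin

definition relations_list :: "('a list \<Rightarrow>\<^sub>0 real) set" where
  "relations_list =
     {Poly_Mapping.single (u @ (a + b) # v) 1 - Poly_Mapping.single (u @ a # v) 1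
        - Poly_Mapping.single (u @ b # v) 1 | u v a b. True} \<union>
     {Poly_Mapping.single (u @ (c *\<^sub>R a) # v) 1 - c *\<^sub>R Poly_Mapping.single (u @ a # v) 1
        | u v a c. True}"

instance ..

end

text \<open>
  \<open>'u sym\<close> is \<open>\<Odot>(U)\<close>, the sum of the symmetric powers \<open>U\<^sup>\<odot>\<^sup>n\<close> for \<open>n \<ge> 1\<close>: the generator given by
  a non-empty multiset \<open>{#a\<^sub>1, \<dots>, a\<^sub>n#}\<close> is \<open>a\<^sub>1 \<odot> \<dots> \<odot> a\<^sub>n\<close>.
\<close>

typedef 'u monomial = "{M :: 'u multiset. M \<noteq> {#}}"
  morphisms factors Abs_monomial
  by (rule exI [of _ "{#undefined#}"]) simp

setup_lifting type_definition_monomial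

lift_definition insert_factor :: "'u \<Rightarrow> 'u multiset \<Rightarrow> 'u monomial" is add_mset by simp

lift_definition times_monomial :: "'u monomial \<Rightarrow> 'u monomial \<Rightarrow> 'u monomial" is "(+)" by simp

instantiation monomial :: (real_vector) presented
begin

definition relations_monomial :: "('a monomial \<Rightarrow>\<^sub>0 real) set" where
  "relations_monomial =
     {Poly_Mapping.single (insert_factor (a + b) M) 1 - Poly_Mapping.single (insert_factor a M) 1
        - Poly_Mapping.single (insert_factor b M) 1 | a b M. True} \<union>
     {Poly_Mapping.single (insert_factor (c *\<^sub>R a) M) 1
        - c *\<^sub>R Poly_Mapping.single (insert_factor a M) 1 | a c M. True}"

instance ..

end

type_synonym 'u sym = "'u monomial pvec"

definition sym_of :: "'u::real_vector \<Rightarrow> 'u sym" where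
  "sym_of a = gen (insert_factor a {#})"

definition sym_mult :: "'u::real_vector sym \<Rightarrow> 'u sym \<Rightarrow> 'u sym" where
  "sym_mult = bilinext (\<lambda>M M'. gen (times_monomial M M'))"

definition snoc :: "'w::real_vector list pvec \<Rightarrow> 'w \<Rightarrow> 'w list pvec" where
  "snoc x a = linext (\<lambda>w. gen (w @ [a])) x"

definition deconcat :: "'w::real_vector list pvec \<Rightarrow> ('w list \<times> 'w list) pvec" where
  "deconcat = linext (\<lambda>w. \<Sum>i\<le>length w. gen (take i w, drop i w))"

text \<open>The recursions below peel off last letters, hence take reversed words as arguments.\<close>

fun shuffle_rev :: "'u::real_vector list \<Rightarrow> 'u list \<Rightarrow> 'u list pvec" where
  "shuffle_rev [] v = gen (rev v)"
| "shuffle_rev w [] = gen (rev w)"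
| "shuffle_rev (a # w) (b # v) =
     snoc (shuffle_rev w (b # v)) a + snoc (shuffle_rev (a # w) v) b"

definition shuffle :: "'u::real_vector list pvec \<Rightarrow> 'u list pvec \<Rightarrow> 'u list pvec" where
  "shuffle = bilinext (\<lambda>w v. shuffle_rev (rev w) (rev v))"

fun qshuffle_rev :: "'u::real_vector sym list \<Rightarrow> 'u sym list \<Rightarrow> 'u sym list pvec" where
  "qshuffle_rev [] v = gen (rev v)"
| "qshuffle_rev w [] = gen (rev w)"
| "qshuffle_rev (a # w) (b # v) =
     snoc (qshuffle_rev w (b # v)) a + snoc (qshuffle_rev (a # w) v) b
       + snoc (qshuffle_rev w v) (sym_mult a b)"

definition qshuffle ::
  "'u::real_vector sym list pvec \<Rightarrow> 'u sym list pvec \<Rightarrow> 'u sym list pvec" where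
  "qshuffle = bilinext (\<lambda>w v. qshuffle_rev (rev w) (rev v))"

definition sh_deg :: "nat \<Rightarrow> 'u::real_vector list pvec set" where
  "sh_deg n = span {gen w | w. length w = n}"

definition qsh_deg :: "nat \<Rightarrow> 'u::real_vector sym list pvec set" where
  "qsh_deg n = span {gen (map gen Ms) | Ms. (\<Sum>M\<leftarrow>Ms. size (factors M)) = n}"

text \<open>
  The arborification maps: the algebra morphisms determined by
  \<open>[f]\<^sub>\<gamma> \<mapsto> (image of f) \<otimes> \<gamma>\<close> (they are then automatically Hopf algebra morphisms).
\<close>

definition arbor :: "'u::real_vector hopf \<Rightarrow> 'u list pvec" where
  "arbor = (THE g. linear g \<and> g hone = gen [] \<and>
     (\<forall>x y. g (hmult x y) = shuffle (g x) (g y)) \<and>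
     (\<forall>\<gamma> x. g (Bplus \<gamma> x) = snoc (g x) \<gamma>))"

definition qarbor :: "'u::real_vector hopf \<Rightarrow> 'u sym list pvec" where
  "qarbor = (THE g. linear g \<and> g hone = gen [] \<and>
     (\<forall>x y. g (hmult x y) = qshuffle (g x) (g y)) \<and>
     (\<forall>\<gamma> x. g (Bplus \<gamma> x) = snoc (g x) (sym_of \<gamma>)))"

section \<open>Rough paths\<close>

definition control :: "real \<Rightarrow> (real \<Rightarrow> real \<Rightarrow> real) \<Rightarrow> bool" where
  "control T \<omega> \<longleftrightarrow>
     continuous_on {(s, t). 0 \<le> s \<and> s \<le> t \<and> t \<le> T} (\<lambda>(s, t). \<omega> s t) \<and>
     (\<forall>s t. 0 \<le> s \<and> s \<le> t \<and> t \<le> T \<longrightarrow> 0 \<le> \<omega> s t) \<and>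
     (\<forall>s u t. 0 \<le> s \<and> s \<le> u \<and> u \<le> t \<and> t \<le> T \<longrightarrow> \<omega> s u + \<omega> u t \<le> \<omega> s t) \<and>
     (\<forall>t. 0 \<le> t \<and> t \<le> T \<longrightarrow> \<omega> t t = 0)"

text \<open>
  The growth bound is required of non-empty forests only: for the empty forest it is implied by
  \<open>\<langle>1, X s t\<rangle> = 1\<close> with the convention \<open>0\<^sup>0 = 1\<close>, whereas \<open>0 powr 0 = 0\<close>.
\<close>

definition branched_rough_path ::
  "real \<Rightarrow> (real \<Rightarrow> real \<Rightarrow> real) \<Rightarrow> real \<Rightarrow> (real \<Rightarrow> real \<Rightarrow> 'v::real_vector hopf) \<Rightarrow> bool" where
  "branched_rough_path \<rho> \<omega> T X \<longleftrightarrow> (let N = nat \<lfloor>\<rho>\<rfloor> in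
     (\<forall>s t. 0 \<le> s \<and> s \<le> t \<and> t \<le> T \<longrightarrow> X s t \<in> hopf_le N) \<and>
     (\<forall>s u t. 0 \<le> s \<and> s \<le> u \<and> u \<le> t \<and> t \<le> T \<longrightarrow>
        X s t = hopf_trunc N (gl_prod (X s u) (X u t))) \<and>
     (\<forall>s t. 0 \<le> s \<and> s \<le> t \<and> t \<le> T \<longrightarrow> pairing hone (X s t) = 1) \<and>
     (\<forall>f g. weight f + weight g \<le> N \<longrightarrow> (\<forall>s t. 0 \<le> s \<and> s \<le> t \<and> t \<le> T \<longrightarrow>
        pairing (hmult (gen f) (gen g)) (X s t) =
          pairing (gen f) (X s t) * pairing (gen g) (X s t))) \<and>
     (\<forall>f. 1 \<le> weight f \<and> weight f \<le> N \<longrightarrow>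
        (\<exists>C. \<forall>s t. 0 \<le> s \<and> s \<le> t \<and> t \<le> T \<longrightarrow>
           \<bar>pairing (gen f) (X s t)\<bar> \<le> C * \<omega> s t powr (real (weight f) / \<rho>))))"

text \<open>
  The same notion with \<open>\<H>\<^sub>C\<^sub>K(V\<^sup>*)\<close> replaced by another graded Hopf algebra with homogeneous
  components \<open>hom n\<close>. Elements of its graded dual of degree at most \<open>N\<close> are the linear
  functionals that vanish on \<open>hom n\<close> for \<open>n > N\<close>; the product of the dual is convolution.
\<close>

definition dual_rough_path ::
  "(nat \<Rightarrow> 'a::presented pvec set) \<Rightarrow> ('a pvec \<Rightarrow> 'a pvec \<Rightarrow> 'a pvec) \<Rightarrow> 'a pvec \<Rightarrow>
   ('a pvec \<Rightarrow> ('a \<times> 'a) pvec) \<Rightarrow>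
   real \<Rightarrow> (real \<Rightarrow> real \<Rightarrow> real) \<Rightarrow> real \<Rightarrow> (real \<Rightarrow> real \<Rightarrow> 'a pvec \<Rightarrow> real) \<Rightarrow> bool" where
  "dual_rough_path hom mul one \<Delta> \<rho> \<omega> T Z \<longleftrightarrow> (let N = nat \<lfloor>\<rho>\<rfloor> in
     (\<forall>s t. 0 \<le> s \<and> s \<le> t \<and> t \<le> T \<longrightarrow>
        linear (Z s t) \<and> (\<forall>n>N. \<forall>x\<in>hom n. Z s t x = 0)) \<and>
     (\<forall>s u t. 0 \<le> s \<and> s \<le> u \<and> u \<le> t \<and> t \<le> T \<longrightarrow>
        (\<forall>n\<le>N. \<forall>x\<in>hom n.
           Z s t x = linext (\<lambda>(a, b). Z s u (gen a) * Z u t (gen b)) (\<Delta> x))) \<and>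
     (\<forall>s t. 0 \<le> s \<and> s \<le> t \<and> t \<le> T \<longrightarrow> Z s t one = 1) \<and>
     (\<forall>m n. m + n \<le> N \<longrightarrow> (\<forall>x\<in>hom m. \<forall>y\<in>hom n. \<forall>s t. 0 \<le> s \<and> s \<le> t \<and> t \<le> T \<longrightarrow>
        Z s t (mul x y) = Z s t x * Z s t y)) \<and>
     (\<forall>n. 1 \<le> n \<and> n \<le> N \<longrightarrow> (\<forall>x\<in>hom n.
        \<exists>C. \<forall>s t. 0 \<le> s \<and> s \<le> t \<and> t \<le> T \<longrightarrow>
          \<bar>Z s t x\<bar> \<le> C * \<omega> s t powr (real n / \<rho>))))"

text \<open>
  \<open>X s t = \<aa>\<^sup>* (Z s t)\<close> is spelled out as \<open>\<langle>x, X s t\<rangle> = Z s t (\<aa> x)\<close> for all \<open>x\<close> in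
  \<open>\<H>\<^sub>C\<^sub>K(V\<^sup>*)\<close>.
\<close>

definition geometric ::
  "real \<Rightarrow> (real \<Rightarrow> real \<Rightarrow> real) \<Rightarrow> real \<Rightarrow> (real \<Rightarrow> real \<Rightarrow> 'v::real_vector hopf) \<Rightarrow> bool" where
  "geometric \<rho> \<omega> T X \<longleftrightarrow>
     (\<exists>Z. dual_rough_path sh_deg shuffle (gen []) deconcat \<rho> \<omega> T Z \<and>
        (\<forall>s t. 0 \<le> s \<and> s \<le> t \<and> t \<le> T \<longrightarrow> (\<forall>x. pairing x (X s t) = Z s t (arbor x))))"

definition quasi_geometric ::
  "real \<Rightarrow> (real \<Rightarrow> real \<Rightarrow> real) \<Rightarrow> real \<Rightarrow> (real \<Rightarrow> real \<Rightarrow> 'v::real_vector hopf) \<Rightarrow> bool" where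
  "quasi_geometric \<rho> \<omega> T X \<longleftrightarrow>
     (\<exists>Z. dual_rough_path qsh_deg qshuffle (gen []) deconcat \<rho> \<omega> T Z \<and>
        (\<forall>s t. 0 \<le> s \<and> s \<le> t \<and> t \<le> T \<longrightarrow> (\<forall>x. pairing x (X s t) = Z s t (qarbor x))))"

end

theory Submission
  imports Defs "HOL-Analysis.Linear_Algebra" "HOL-Combinatorics.List_Permutation"
begin

text \<open>
  Let \<open>\<Delta>\<close> denote the coproduct and \<open>\<top>\<close> natural growth. Two facts about them carry the proof.

  First, growing onto a primitive element \<open>p\<close> is a cocycle: \<open>\<Delta>(y \<top> p) = (y \<top> p) \<otimes> 1 + y' \<otimes> (y'' \<top> p)\<close>
  where \<open>\<Delta> y = y' \<otimes> y''\<close> (lemma \<open>split_sum_growth_primitive\<close>). Hence the map \<open>\<pi>\<close> defined by recursion on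
  the weight through \<open>x = \<pi>(x) + x' \<top> \<pi>(x'')\<close>, with the reduced coproduct of \<open>x\<close> (an element without
  constant term), has primitive values
  (\<open>prim_part_primitive\<close>), fixes the primitive elements and kills all longer growth words. The recursion
  also writes every element as a combination of growth words, so that \<open>\<pi>\<close> is the projection
  \<open>prim_proj\<close> (\<open>prim_proj_eq\<close>).

  Secondly, both arborification maps are coalgebra morphisms into a space of words, and such a
  morphism is determined by its composition \<open>\<lambda>\<close> with the projection onto words of length one. Here
  \<open>\<lambda>\<close> takes a forest without edges to the product of its labels (or, for shuffles, to its label if
  there is one vertex and to \<open>0\<close> otherwise), and a forest with an edge to \<open>0\<close>. Since the growth of
  a non-empty forest onto another one has edges, \<open>\<aa>(y \<top> p) = \<aa>(y) \<otimes> \<lambda>(p)\<close> for primitive \<open>p\<close>, and so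
  \<open>\<aa>(p\<^sub>1 \<top> \<dots> \<top> p\<^sub>n) = \<lambda>(p\<^sub>1) \<dots> \<lambda>(p\<^sub>n)\<close> (\<open>arb_growth_word\<close>). The two maps are treated at
  once in a locale: the shuffle product is the quasi-shuffle product for the zero product of letters.

  The direct complement \<open>D\<close> in the theorem is the kernel of \<open>\<lambda>\<close> on the primitive elements, because
  \<open>\<lambda> \<circ> \<pi> = \<lambda>\<close>, and \<open>w \<mapsto> \<pi>(\<sigma>(w))\<close>, with \<open>\<sigma>\<close> sending a product of labels to the forest of single
  vertices, is a section of \<open>\<lambda>\<close> with image the other summand (\<open>complement\<close>). Through this section words act
  as growth words, which gives a right inverse \<open>\<tau>\<close> of \<open>\<aa>\<close>. If \<open>\<X>\<close> factors through \<open>\<aa>\<close>, then it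
  vanishes on growth words with an entry in \<open>D\<close>, as \<open>\<aa>\<close> does. Conversely, if \<open>\<X>\<close> vanishes there,
  each entry of a growth word may be replaced by its component in the image of the section, so that
  \<open>\<X> = \<X> \<circ> \<tau> \<circ> \<aa>\<close> (\<open>functional_factors\<close>), and \<open>\<Z> = \<X> \<circ> \<tau>\<close> inherits all the properties of
  a rough path because \<open>\<aa>\<close> is a surjective graded morphism of Hopf algebras. For the multiplicativity
  in time this uses the duality between the Grossman--Larson product and \<open>\<Delta>\<close> (\<open>pairing_gl_prod\<close>).
\<close>

section \<open>Linear and bilinear maps on presented spaces\<close>

lemma linear_comp_left:
  assumes "bilinear \<beta>" "linear F" shows "linear (\<lambda>x. \<beta> (F x) y)"
  using linear_compose [OF assms(2), of "\<lambda>x. \<beta> x y"] assms(1) by (simp add: bilinear_def o_def)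

lemma linear_comp_right:
  assumes "bilinear \<beta>" "linear F" shows "linear (\<lambda>x. \<beta> y (F x))"
  using linear_compose [OF assms(2), of "\<beta> y"] assms(1) by (simp add: bilinear_def o_def)

lemma bilinear_comp:
  assumes "bilinear \<beta>" "linear F" "linear G" shows "bilinear (\<lambda>x y. \<beta> (F x) (G y))"
  using assms by (simp add: bilinear_def linear_comp_left linear_comp_right)

lemma bilinear_compose_linear:
  assumes "linear L" "bilinear \<beta>" shows "bilinear (\<lambda>x y. L (\<beta> x y))"
  using assms by (auto simp: bilinear_def linear_iff)

lemma bilinear_add:
  assumes "bilinear \<beta>" "bilinear \<gamma>" shows "bilinear (\<lambda>x y. \<beta> x y + \<gamma> x y)"
  using assms by (simp add: bilinear_def linear_compose_add)

lemma linear_id_fun: "linear (\<lambda>x. x)"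
  by (simp add: linear_iff)

lemma linear_lscale: "linear (F :: 'a::real_vector \<Rightarrow> real) \<Longrightarrow> linear (\<lambda>x. F x *\<^sub>R (c :: 'b::real_vector))"
  by (simp add: linear_iff scaleR_add_left)

lemma bilinear_mult_functionals:
  fixes F :: "'a::real_vector \<Rightarrow> real" and G :: "'b::real_vector \<Rightarrow> real"
  assumes "linear F" "linear G" shows "bilinear (\<lambda>x y. F x * G y)"
  using assms by (simp add: bilinear_def linear_iff algebra_simps)

lemma linear_eq_on_gen:
  assumes "linear F" "linear G" "\<And>a. F (gen a) = G (gen a)"
  shows "F x = G x"
proof -
  have "x \<in> span (range gen)" by (simp add: span_gen)
  then show ?thesis
    by (rule linear_eq_on_span [OF assms(1,2), rotated]) (use assms(3) in auto)
qed

lemma bilinear_eq_on_gen: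
  assumes "bilinear \<beta>" "bilinear \<gamma>" "\<And>a b. \<beta> (gen a) (gen b) = \<gamma> (gen a) (gen b)"
  shows "\<beta> x y = \<gamma> x y"
proof (rule linear_eq_on_gen [where F = "\<lambda>x. \<beta> x y"])
  show "linear (\<lambda>x. \<beta> x y)" "linear (\<lambda>x. \<gamma> x y)" using assms by (auto simp: bilinear_def)
  show "\<beta> (gen a) y = \<gamma> (gen a) y" for a
    by (rule linear_eq_on_gen) (use assms in \<open>auto simp: bilinear_def\<close>)
qed

lemma linear_preserves_span:
  assumes "linear F" "x \<in> span S" "\<And>y. y \<in> S \<Longrightarrow> F y \<in> span U" shows "F x \<in> span U"
proof -
  have "F ` span S = span (F ` S)" using assms(1) by (simp add: linear_span_image)
  also have "\<dots> \<subseteq> span U" using assms(3) by (intro span_minimal) auto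
  finally show ?thesis using assms(2) by auto
qed

lemma bilinear_preserves_span:
  assumes "bilinear \<beta>" "x \<in> span S" "y \<in> span R"
    and "\<And>a b. a \<in> S \<Longrightarrow> b \<in> R \<Longrightarrow> \<beta> a b \<in> span U"
  shows "\<beta> x y \<in> span U"
proof (rule linear_preserves_span [OF _ assms(2)])
  show "linear (\<lambda>x. \<beta> x y)" using assms(1) by (simp add: bilinear_def)
  show "\<beta> a y \<in> span U" if "a \<in> S" for a
    by (rule linear_preserves_span [OF _ assms(3)])
      (use assms that in \<open>auto simp: bilinear_def\<close>)
qed

lemma linear_free_ext_image: "linear L \<Longrightarrow> L (free_ext \<phi> r) = free_ext (\<lambda>a. L (\<phi> a)) r"
  by (simp add: free_ext_def linear_sum linear_scale)

lemma free_ext_gen: "free_ext gen r = abs_pvec r"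
  using linear_free_ext_image [OF linear_abs_pvec, of "\<lambda>a. Poly_Mapping.single a 1" r]
  by (simp add: free_decomposition [symmetric] gen.abs_eq [symmetric])

lemma abs_pvec_relation: "r \<in> relations \<Longrightarrow> abs_pvec r = 0"
  by (metis diff_zero pvec.abs_eq_iff span_base zero_pvec_def)

lemma descends_linear: "linear L \<Longrightarrow> descends (\<lambda>a. L (gen a))"
  by (simp add: descends_def linear_free_ext_image [symmetric] free_ext_gen abs_pvec_relation
      linear_0)

lemma bilinext:
  assumes "\<And>a. descends (\<phi> a)" "\<And>b. descends (\<lambda>a. \<phi> a b)"
  shows "bilinear (bilinext \<phi>)" and "bilinext \<phi> (gen a) (gen b) = \<phi> a b"
proof -
  have d: "descends (\<lambda>a. linext (\<phi> a) y)" for y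
    unfolding descends_def
  proof
    fix r assume r: "r \<in> (relations :: ('a \<Rightarrow>\<^sub>0 real) set)"
    have "free_ext (\<lambda>a. linext (\<phi> a) y) r = (\<lambda>y. 0) y"
    proof (rule linear_eq_on_gen)
      show "linear (\<lambda>y. free_ext (\<lambda>a. linext (\<phi> a) y) r)"
        unfolding free_ext_def
        by (intro linear_compose_sum ballI linear_compose_scale_right linext assms)
      show "free_ext (\<lambda>a. linext (\<phi> a) (gen b)) r = 0" for b
        using assms(2) r by (simp add: linext assms(1)) (simp add: descends_def)
    qed (simp add: linear_zero)
    then show "free_ext (\<lambda>a. linext (\<phi> a) y) r = 0" .
  qed
  have lx: "linear (\<lambda>x. bilinext \<phi> x y)" for y
    unfolding bilinext_def using linext(1) [OF d] .
  have "bilinext \<phi> x (y + z) = bilinext \<phi> x y + bilinext \<phi> x z" for x y z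
    by (rule linear_eq_on_gen [where F = "\<lambda>x. bilinext \<phi> x (y + z)"])
      ((rule lx linear_compose_add)+,
        simp only: bilinext_def linext [OF d], simp add: linear_add [OF linext(1)] assms)
  moreover have "bilinext \<phi> x (c *\<^sub>R y) = c *\<^sub>R bilinext \<phi> x y" for x y c
    by (rule linear_eq_on_gen [where F = "\<lambda>x. bilinext \<phi> x (c *\<^sub>R y)"])
      ((rule lx linear_compose_scale_right)+,
        simp only: bilinext_def linext [OF d], simp add: linear_scale [OF linext(1)] assms)
  ultimately show "bilinear (bilinext \<phi>)"
    by (auto simp: bilinear_def lx intro!: linearI)
  show "bilinext \<phi> (gen a) (gen b) = \<phi> a b"
    by (simp add: bilinext_def linext [OF d] linext assms)
qed

lemma free_ext_free_ext:
  "free_ext \<phi> (free_ext (\<lambda>a. Poly_Mapping.single (k a) 1) r) = free_ext (\<lambda>a. \<phi> (k a)) r"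
  by (simp add: linear_free_ext_image [OF linear_free_ext])

lemma descends_gen_pair_right: "descends (\<lambda>b::'b::presented. gen (a, b))"
  unfolding descends_def
proof
  fix r :: "'b \<Rightarrow>\<^sub>0 real" assume "r \<in> relations"
  then have "abs_pvec (free_ext (\<lambda>b. Poly_Mapping.single (a, b) (1::real)) r) = 0"
    by (intro abs_pvec_relation) (auto simp: relations_prod_def)
  then show "free_ext (\<lambda>b. gen (a, b)) r = 0"
    by (simp add: linear_free_ext_image [OF linear_abs_pvec] gen.abs_eq)
qed

lemma descends_gen_pair_left: "descends (\<lambda>a::'a::presented. gen (a, b))"
  unfolding descends_def
proof
  fix r :: "'a \<Rightarrow>\<^sub>0 real" assume "r \<in> relations"
  then have "abs_pvec (free_ext (\<lambda>a. Poly_Mapping.single (a, b) (1::real)) r) = 0"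
    by (intro abs_pvec_relation) (auto simp: relations_prod_def)
  then show "free_ext (\<lambda>a. gen (a, b)) r = 0"
    by (simp add: linear_free_ext_image [OF linear_abs_pvec] gen.abs_eq)
qed

lemma bilinear_tensor: "bilinear tensor"
  unfolding tensor_def by (rule bilinext [OF descends_gen_pair_right descends_gen_pair_left])

lemma tensor_gen: "tensor (gen a) (gen b) = gen (a, b)"
  unfolding tensor_def by (rule bilinext [OF descends_gen_pair_right descends_gen_pair_left])

lemma descends_bilinear:
  assumes "bilinear \<beta>" shows "descends (\<lambda>(a, b). \<beta> (gen a) (gen b))"
proof -
  have l: "linear (\<beta> x)" "linear (\<lambda>x. \<beta> x y)" for x y
    using assms by (auto simp: bilinear_def)
  have "free_ext (\<lambda>a. \<beta> (gen a) (gen b)) r = 0" if "r \<in> relations" for r b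
    using descends_linear [OF l(2)] that by (auto simp: descends_def)
  moreover have "free_ext (\<lambda>b. \<beta> (gen a) (gen b)) r = 0" if "r \<in> relations" for r a
    using descends_linear [OF l(1)] that by (auto simp: descends_def)
  ultimately show ?thesis
    by (auto simp: descends_def relations_prod_def free_ext_free_ext)
qed

text \<open>
  Through the universal property an identity in a tensor product, such as the one that defines
  primitive elements, is used and proved as a family of identities between values of bilinear maps.
\<close>

lemma tensor_universal:
  assumes "bilinear \<beta>"
  shows "linear (linext (\<lambda>(a, b). \<beta> (gen a) (gen b)))"
    and "linext (\<lambda>(a, b). \<beta> (gen a) (gen b)) (tensor x y) = \<beta> x y"
proof -
  show l: "linear (linext (\<lambda>(a, b). \<beta> (gen a) (gen b)))"
    by (rule linext [OF descends_bilinear [OF assms]])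
  show "linext (\<lambda>(a, b). \<beta> (gen a) (gen b)) (tensor x y) = \<beta> x y"
    by (rule bilinear_eq_on_gen [OF bilinear_compose_linear [OF l bilinear_tensor] assms])
      (simp add: tensor_gen linext [OF descends_bilinear [OF assms]])
qed

section \<open>Decorated forests up to isomorphism and multilinearity\<close>

lemmas forest_rep_eqs = verts.rep_eq parent.rep_eq label.rep_eq relabel.rep_eq
  restrict_forest.rep_eq graft.rep_eq add_root.rep_eq dots.rep_eq

lemma verts_simps [simp]:
  "verts (relabel f v a) = verts f"
  "verts (restrict_forest f A) = verts f \<inter> A"
  "verts (graft \<phi> f g) = (\<lambda>v. 2 * v) ` verts f \<union> (\<lambda>v. 2 * v + 1) ` verts g"
  "verts (add_root \<gamma> f) = insert 0 (Suc ` verts f)"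
  "verts (dots \<gamma>s) = {..<length \<gamma>s}"
  by (simp_all add: forest_rep_eqs split_beta cong: if_cong option.case_cong nat.case_cong)

lemma label_simps [simp]:
  "label (relabel f v a) = (label f)(v := a)"
  "label (restrict_forest f A) = label f"
  "label (graft \<phi> f g) = (\<lambda>x. if even x then label f (x div 2) else label g (x div 2))"
  "label (add_root \<gamma> f) = case_nat \<gamma> (label f)"
  "label (dots \<gamma>s) = (\<lambda>v. \<gamma>s ! v)"
  by (simp_all add: forest_rep_eqs split_beta cong: if_cong option.case_cong nat.case_cong)

lemma parent_simps [simp]:
  "parent (relabel f v a) = parent f"
  "parent (dots \<gamma>s) = (\<lambda>_. None)"
  by (simp_all add: forest_rep_eqs split_beta cong: if_cong option.case_cong nat.case_cong)

lemma parent_restrict: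
  "parent (restrict_forest f A) = (\<lambda>v. if v \<in> A then
     (case parent f v of None \<Rightarrow> None | Some w \<Rightarrow> if w \<in> A then Some w else None) else None)"
  by (simp add: forest_rep_eqs split_beta cong: if_cong option.case_cong nat.case_cong)

lemma parent_graft:
  "parent (graft \<phi> f g) = (\<lambda>x. if even x then
     (if x div 2 \<in> verts f then
       (case parent f (x div 2) of Some w \<Rightarrow> Some (2 * w)
        | None \<Rightarrow> (case \<phi> (x div 2) of None \<Rightarrow> None
                   | Some w \<Rightarrow> if w \<in> verts g then Some (2 * w + 1) else None))
      else None)
     else map_option (\<lambda>w. 2 * w + 1) (parent g (x div 2)))"
  by (simp add: forest_rep_eqs split_beta cong: if_cong option.case_cong nat.case_cong)

lemma parent_add_root:
  "parent (add_root \<gamma> f) = case_nat None (\<lambda>v. if v \<in> verts f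
     then Some (case parent f v of None \<Rightarrow> 0 | Some w \<Rightarrow> Suc w) else None)"
  by (simp add: forest_rep_eqs split_beta cong: if_cong option.case_cong nat.case_cong)

lemma forest_eqI: "verts f = verts g \<Longrightarrow> parent f = parent g \<Longrightarrow> label f = label g \<Longrightarrow> f = g"
  by transfer (auto simp: prod_eq_iff)

lemma finite_verts [simp, intro]: "finite (verts f)"
  by transfer (auto simp: is_forest_def)

lemma parent_in_verts: "parent f v = Some w \<Longrightarrow> v \<in> verts f" "parent f v = Some w \<Longrightarrow> w \<in> verts f"
  by (transfer; auto simp: is_forest_def)+

lemma forest_rank: obtains h :: "nat \<Rightarrow> nat" where "\<And>v w. parent f v = Some w \<Longrightarrow> h w < h v"
proof -
  have "\<exists>h :: nat \<Rightarrow> nat. \<forall>v w. parent f v = Some w \<longrightarrow> h w < h v"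
    by transfer (auto simp: is_forest_iff_rank)
  with that show ?thesis by blast
qed

lemma even_odd_disjoint: "(\<lambda>v. 2 * v) ` A \<inter> (\<lambda>v. 2 * v + 1) ` C = ({} :: nat set)"
proof -
  have "even x" if "x \<in> (\<lambda>v. 2 * v) ` A" for x using that by auto
  moreover have "odd x" if "x \<in> (\<lambda>v. 2 * v + 1) ` C" for x using that by auto
  ultimately show ?thesis by blast
qed

lemma weight_simps [simp]:
  "weight (relabel f v a) = weight f"
  "weight (graft \<phi> f g) = weight f + weight g"
  "weight (add_root \<gamma> f) = Suc (weight f)"
  "weight (dots \<gamma>s) = length \<gamma>s"
proof -
  have "card ((\<lambda>v. 2 * v) ` verts f \<union> (\<lambda>v. 2 * v + 1) ` verts g)
    = card ((\<lambda>v. 2 * v) ` verts f) + card ((\<lambda>v. 2 * v + 1) ` verts g)"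
    by (rule card_Un_disjoint) (simp_all only: even_odd_disjoint finite_imageI finite_verts)
  then show "weight (graft \<phi> f g) = weight f + weight g"
    by (simp add: weight_def card_image inj_on_def)
qed (auto simp: weight_def card_image)

lemma weight_0_iff: "weight f = 0 \<longleftrightarrow> verts f = {}"
  by (simp add: weight_def)

subsection \<open>Isomorphisms\<close>

text \<open>
  Maps as in \<open>shape_isos\<close>, but without prescribed values outside the vertex set, so that they compose
  and restrict freely.
\<close>

definition shape_map :: "(nat \<Rightarrow> nat) \<Rightarrow> 'u forest \<Rightarrow> 'w forest \<Rightarrow> bool" where
  "shape_map b f g \<longleftrightarrow> bij_betw b (verts f) (verts g) \<and>
     (\<forall>v\<in>verts f. parent g (b v) = map_option b (parent f v))"

definition iso_via :: "(nat \<Rightarrow> nat) \<Rightarrow> 'u forest \<Rightarrow> 'u forest \<Rightarrow> bool" where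
  "iso_via b f g \<longleftrightarrow> shape_map b f g \<and> (\<forall>v\<in>verts f. label g (b v) = label f v)"

lemma map_option_parent_cong:
  "(\<And>w. w \<in> verts f \<Longrightarrow> b w = c w) \<Longrightarrow> map_option b (parent f v) = map_option c (parent f v)"
  by (rule option.map_cong0) (metis elem_set parent_in_verts(2))

lemma shape_map_cong:
  assumes "shape_map b f g" "\<And>w. w \<in> verts f \<Longrightarrow> b w = c w" shows "shape_map c f g"
proof -
  have "bij_betw c (verts f) (verts g)"
    using assms bij_betw_cong [of "verts f" b c "verts g"] by (simp add: shape_map_def)
  moreover have "parent g (c v) = map_option c (parent f v)" if "v \<in> verts f" for v
    using assms that map_option_parent_cong [of f b c v] by (simp add: shape_map_def)
  ultimately show ?thesis by (simp add: shape_map_def)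
qed

lemma shape_isos_iff: "b \<in> shape_isos f g \<longleftrightarrow> b \<in> extensional (verts f) \<and> shape_map b f g"
  unfolding shape_isos_def shape_map_def PiE_def using bij_betw_apply [of b "verts f" "verts g"]
  by blast

lemma shape_map_restrict: "shape_map b f g \<Longrightarrow> restrict b (verts f) \<in> shape_isos f g"
  unfolding shape_isos_iff using shape_map_cong [of b f g "restrict b (verts f)"] by simp

lemma forest_iso_iff: "forest_iso f g \<longleftrightarrow> (\<exists>b. iso_via b f g)"
proof
  assume "\<exists>b. iso_via b f g"
  then obtain b where "iso_via b f g" ..
  then show "forest_iso f g"
    unfolding forest_iso_def iso_via_def
    by (intro bexI [of _ "restrict b (verts f)"]) (auto intro: shape_map_restrict)
qed (auto simp: forest_iso_def iso_via_def shape_isos_iff)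

lemma shape_map_comp: "shape_map b f g \<Longrightarrow> shape_map c g h \<Longrightarrow> shape_map (c \<circ> b) f h"
proof -
  assume b: "shape_map b f g" and c: "shape_map c g h"
  have "b v \<in> verts g" if "v \<in> verts f" for v
    using b that by (auto simp: shape_map_def bij_betw_apply)
  with b c show ?thesis
    using bij_betw_trans [of b "verts f" "verts g" c "verts h"]
    by (simp add: shape_map_def option.map_comp)
qed

lemma shape_map_inverse:
  assumes "shape_map b f g"
  shows "shape_map (inv_into (verts f) b) g f"
proof -
  let ?c = "inv_into (verts f) b"
  have bij: "bij_betw b (verts f) (verts g)" using assms by (simp add: shape_map_def)
  have "parent f (?c w) = map_option ?c (parent g w)" if w: "w \<in> verts g" for w
  proof -
    have v: "?c w \<in> verts f" "b (?c w) = w"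
      using bij w by (auto simp: bij_betw_def inv_into_into f_inv_into_f)
    have "map_option ?c (parent g w) = map_option ?c (map_option b (parent f (?c w)))"
      using assms v by (auto simp: shape_map_def)
    also have "\<dots> = map_option id (parent f (?c w))"
      unfolding option.map_comp
      by (rule map_option_parent_cong) (use bij in \<open>auto simp: bij_betw_def\<close>)
    finally show ?thesis by (simp add: option.map_id)
  qed
  then show ?thesis
    by (simp add: shape_map_def bij_betw_inv_into [OF bij])
qed

lemma iso_via_bij: "iso_via b f g \<Longrightarrow> bij_betw b (verts f) (verts g)"
  by (simp add: iso_via_def shape_map_def)

lemma iso_via_weight: "iso_via b f g \<Longrightarrow> weight f = weight g"
  unfolding weight_def by (rule bij_betw_same_card [OF iso_via_bij])

lemma iso_viaI:
  assumes "bij_betw b (verts f) (verts g)"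
    and "\<And>v. v \<in> verts f \<Longrightarrow> parent g (b v) = map_option b (parent f v)"
    and "\<And>v. v \<in> verts f \<Longrightarrow> label g (b v) = label f v"
  shows "iso_via b f g"
  using assms by (simp add: iso_via_def shape_map_def)

lemma iso_via_id: "iso_via (\<lambda>v. v) f f"
  by (auto intro!: iso_viaI simp: bij_betw_def option.map_ident)

lemma iso_via_restrict:
  assumes "iso_via b f g" "A \<subseteq> verts f"
  shows "iso_via b (restrict_forest f A) (restrict_forest g (b ` A))"
proof (rule iso_viaI)
  have inj: "inj_on b (verts f)" and im: "b ` verts f = verts g"
    using iso_via_bij [OF assms(1)] by (auto simp: bij_betw_def)
  show "bij_betw b (verts (restrict_forest f A)) (verts (restrict_forest g (b ` A)))"
    using assms(2) inj im by (auto simp: bij_betw_def inj_on_def)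
  fix v assume "v \<in> verts (restrict_forest f A)"
  then have v: "v \<in> verts f" "v \<in> A" by auto
  show "label (restrict_forest g (b ` A)) (b v) = label (restrict_forest f A) v"
    using assms(1) v by (simp add: iso_via_def)
  have p: "parent g (b v) = map_option b (parent f v)"
    using assms(1) v by (simp add: iso_via_def shape_map_def)
  show "parent (restrict_forest g (b ` A)) (b v) = map_option b (parent (restrict_forest f A) v)"
  proof (cases "parent f v")
    case None
    then show ?thesis using p by (simp add: parent_restrict)
  next
    case (Some w)
    then have "w \<in> verts f" by (rule parent_in_verts)
    then have "b w \<in> b ` A \<longleftrightarrow> w \<in> A" using inj assms(2) by (auto simp: inj_on_def)
    then show ?thesis using p Some v by (simp add: parent_restrict)
  qed
qed

lemma bij_betw_even_odd:
  fixes b c :: "nat \<Rightarrow> nat"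
  assumes "bij_betw b A A'" "bij_betw c C C'"
  shows "bij_betw (\<lambda>x. if even x then 2 * b (x div 2) else 2 * c (x div 2) + 1)
    ((\<lambda>v. 2 * v) ` A \<union> (\<lambda>v. 2 * v + 1) ` C) ((\<lambda>v. 2 * v) ` A' \<union> (\<lambda>v. 2 * v + 1) ` C')"
    (is "bij_betw ?d _ _")
proof -
  note A = bij_betw_imp_surj_on [OF assms(1), symmetric] bij_betw_imp_inj_on [OF assms(1)]
    and C = bij_betw_imp_surj_on [OF assms(2), symmetric] bij_betw_imp_inj_on [OF assms(2)]
  have d: "?d (2 * v) = 2 * b v" "?d (2 * v + 1) = 2 * c v + 1" for v
    by simp_all
  have 1: "bij_betw ?d ((\<lambda>v. 2 * v) ` A) ((\<lambda>v. 2 * v) ` A')"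
  proof (rule bij_betw_imageI)
    show "inj_on ?d ((\<lambda>v. 2 * v) ` A)"
      by (rule inj_onI, elim imageE, hypsubst) (use A(2) in \<open>simp only: d, simp add: inj_on_eq_iff\<close>)
    show "?d ` (\<lambda>v. 2 * v) ` A = (\<lambda>v. 2 * v) ` A'"
      unfolding A(1) image_image d ..
  qed
  have 2: "bij_betw ?d ((\<lambda>v. 2 * v + 1) ` C) ((\<lambda>v. 2 * v + 1) ` C')"
  proof (rule bij_betw_imageI)
    show "inj_on ?d ((\<lambda>v. 2 * v + 1) ` C)"
      by (rule inj_onI, elim imageE, hypsubst) (use C(2) in \<open>simp only: d, simp add: inj_on_eq_iff\<close>)
    show "?d ` (\<lambda>v. 2 * v + 1) ` C = (\<lambda>v. 2 * v + 1) ` C'"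
      unfolding C(1) image_image d ..
  qed
  show ?thesis
    by (rule bij_betw_combine [OF 1 2 even_odd_disjoint])
qed

lemma iso_via_graft:
  assumes f: "iso_via b f f'" and g: "iso_via c g g'"
    and \<phi>: "\<And>r. r \<in> roots f \<Longrightarrow> \<phi>' (b r) = map_option c (\<phi> r)"
      "\<And>r w. r \<in> roots f \<Longrightarrow> \<phi> r = Some w \<Longrightarrow> w \<in> verts g"
  shows "iso_via (\<lambda>x. if even x then 2 * b (x div 2) else 2 * c (x div 2) + 1)
    (graft \<phi> f g) (graft \<phi>' f' g')" (is "iso_via ?d _ _")
proof (rule iso_viaI)
  have bij: "bij_betw b (verts f) (verts f')" "bij_betw c (verts g) (verts g')"
    using f g by (auto dest: iso_via_bij)
  show "bij_betw ?d (verts (graft \<phi> f g)) (verts (graft \<phi>' f' g'))"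
    unfolding verts_simps by (rule bij_betw_even_odd [OF bij])
  fix x assume "x \<in> verts (graft \<phi> f g)"
  then consider v where "v \<in> verts f" "x = 2 * v" | v where "v \<in> verts g" "x = 2 * v + 1"
    by auto
  then have "label (graft \<phi>' f' g') (?d x) = label (graft \<phi> f g) x \<and>
    parent (graft \<phi>' f' g') (?d x) = map_option ?d (parent (graft \<phi> f g) x)"
  proof cases
    case 1
    then have v: "b v \<in> verts f'" using bij by (auto simp: bij_betw_apply)
    have p: "parent f' (b v) = map_option b (parent f v)" "label f' (b v) = label f v"
      using f 1 by (auto simp: iso_via_def shape_map_def)
    show ?thesis
    proof (cases "parent f v")
      case None
      then have "v \<in> roots f" using 1 by (simp add: roots_def)
      with \<phi> have "\<phi>' (b v) = map_option c (\<phi> v)" "\<And>w. \<phi> v = Some w \<Longrightarrow> w \<in> verts g" by auto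
      then show ?thesis using 1 p v None bij
        by (cases "\<phi> v") (auto simp: parent_graft bij_betw_apply)
    qed (use 1 p v in \<open>auto simp: parent_graft\<close>)
  next
    case 2
    have "parent g' (c v) = map_option c (parent g v)" "label g' (c v) = label g v"
      using g 2 by (auto simp: iso_via_def shape_map_def)
    then show ?thesis using 2 by (cases "parent g v") (auto simp: parent_graft)
  qed
  then show "label (graft \<phi>' f' g') (?d x) = label (graft \<phi> f g) x"
    "parent (graft \<phi>' f' g') (?d x) = map_option ?d (parent (graft \<phi> f g) x)" by auto
qed

lemma iso_via_roots: "iso_via b f g \<Longrightarrow> roots g = b ` roots f"
proof -
  assume b: "iso_via b f g"
  have p: "parent g (b v) = None \<longleftrightarrow> parent f v = None" if "v \<in> verts f" for v
    using b that by (simp add: iso_via_def shape_map_def)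
  have im: "verts g = b ` verts f"
    using bij_betw_imp_surj_on [OF iso_via_bij [OF b]] by simp
  show ?thesis unfolding roots_def im using p by (auto simp del: not_None_eq)
qed

subsection \<open>Maps on forests that extend linearly\<close>

text \<open>
  The relations of \<open>\<H>(U)\<close> in usable form. All operations are defined by formulas on forests,
  and this is the criterion by which they are seen to be well defined.
\<close>

lemma descends_forest_iff:
  fixes \<phi> :: "'u::real_vector forest \<Rightarrow> 'w::real_vector"
  shows
  "descends \<phi> \<longleftrightarrow> (\<forall>b f g. iso_via b f g \<longrightarrow> \<phi> f = \<phi> g) \<and>
     (\<forall>f v. v \<in> verts f \<longrightarrow> linear (\<lambda>a. \<phi> (relabel f v a)))"
  (is "_ \<longleftrightarrow> ?I \<and> ?L")
proof
  assume "descends \<phi>"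
  then have r: "\<And>r. r \<in> relations \<Longrightarrow> free_ext \<phi> r = 0"
    unfolding descends_def by (rule bspec)
  have ?I
  proof (intro allI impI)
    fix b f g assume "iso_via b f (g :: 'u forest)"
    then have fg: "forest_iso f g" unfolding forest_iso_iff by (rule exI [of _ b])
    have "free_ext \<phi> (Poly_Mapping.single f 1 - Poly_Mapping.single g 1) = 0"
      by (rule r) (unfold relations_forest_def, rule UnI1, rule UnI1,
          intro CollectI exI conjI, rule refl, rule fg)
    then show "\<phi> f = \<phi> g" by (simp add: free_ext_diff)
  qed
  moreover have ?L
  proof (intro allI impI linearI)
    fix f :: "'u forest" and v a b c assume v: "v \<in> verts f"
    have "free_ext \<phi> (Poly_Mapping.single (relabel f v (a + b)) 1 - Poly_Mapping.single (relabel f v a) 1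
        - Poly_Mapping.single (relabel f v b) 1) = 0"
      by (rule r) (unfold relations_forest_def, rule UnI1, rule UnI2,
          intro CollectI exI conjI, rule refl, rule v)
    then show "\<phi> (relabel f v (a + b)) = \<phi> (relabel f v a) + \<phi> (relabel f v b)"
      unfolding free_ext_diff free_ext_single by (simp add: diff_diff_eq)
    have "free_ext \<phi> (Poly_Mapping.single (relabel f v (c *\<^sub>R a)) 1
        - c *\<^sub>R Poly_Mapping.single (relabel f v a) 1) = 0"
      by (rule r) (unfold relations_forest_def, rule UnI2,
          intro CollectI exI conjI, rule refl, rule v)
    then show "\<phi> (relabel f v (c *\<^sub>R a)) = c *\<^sub>R \<phi> (relabel f v a)"
      by (simp add: free_ext_diff free_ext_scaleR)
  qed
  ultimately show "?I \<and> ?L" by (rule conjI)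
next
  assume IL: "?I \<and> ?L"
  note iso = conjunct1 [OF IL, rule_format] and lin = conjunct2 [OF IL, rule_format]
  have eq: "\<phi> f = \<phi> g" if "forest_iso f g" for f g
    using that unfolding forest_iso_iff by (elim exE) (rule iso)
  have 1: "free_ext \<phi> (Poly_Mapping.single f 1 - Poly_Mapping.single g 1) = 0"
    if "forest_iso f g" for f g
    unfolding free_ext_diff free_ext_single eq [OF that] by simp
  have 2: "free_ext \<phi> (Poly_Mapping.single (relabel f v (a + b)) 1
      - Poly_Mapping.single (relabel f v a) 1 - Poly_Mapping.single (relabel f v b) 1) = 0"
    if "v \<in> verts f" for f v a b
    using linear_add [OF lin [OF that]] unfolding free_ext_diff free_ext_single by simp
  have 3: "free_ext \<phi> (Poly_Mapping.single (relabel f v (c *\<^sub>R a)) 1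
      - c *\<^sub>R Poly_Mapping.single (relabel f v a) 1) = 0"
    if "v \<in> verts f" for f v a c
    using linear_scale [OF lin [OF that]]
    unfolding free_ext_diff free_ext_scaleR free_ext_single by simp
  show "descends \<phi>"
    unfolding descends_def relations_forest_def
    by (intro ballI, elim UnE CollectE exE conjE)
      (hypsubst, rule 1 2 3, assumption)+
qed

lemma descends_forestI:
  assumes "\<And>b f g. iso_via b f g \<Longrightarrow> \<phi> f = \<phi> g"
    and "\<And>f v. v \<in> verts f \<Longrightarrow> linear (\<lambda>a. \<phi> (relabel f v a))"
  shows "descends \<phi>"
  using assms unfolding descends_forest_iff by blast

lemma descends_gen: "descends (gen :: 'u::real_vector forest \<Rightarrow> _)"
  using descends_linear [OF linear_id_fun] .

lemma gen_iso: "iso_via b f g \<Longrightarrow> gen f = gen g"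
  using descends_gen unfolding descends_forest_iff by blast

lemma linear_gen_relabel: "v \<in> verts f \<Longrightarrow> linear (\<lambda>a. gen (relabel f v a))"
  using descends_gen unfolding descends_forest_iff by blast

text \<open>
  The label function of a forest is total, so operations on forests agree only up to labels outside
  the vertex set.
\<close>

lemma gen_eq_labels:
  assumes "verts f = verts g" "parent f = parent g" "\<And>v. v \<in> verts f \<Longrightarrow> label f v = label g v"
  shows "gen f = gen g"
  by (rule gen_iso [of "\<lambda>v. v"]) (use assms in \<open>auto intro!: iso_viaI simp: option.map_ident bij_betw_def\<close>)

text \<open>
  Each relation involves forests of one weight only, so a linear map may be defined by a different
  rule in each weight.
\<close>

lemma descends_cases_weight:
  fixes \<phi> :: "nat \<Rightarrow> 'u::real_vector forest \<Rightarrow> 'w::real_vector"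
  assumes "\<And>n. descends (\<phi> n)" shows "descends (\<lambda>f. \<phi> (weight f) f)"
proof (rule descends_forestI)
  fix b f g assume "iso_via b f (g :: 'u forest)"
  then show "\<phi> (weight f) f = \<phi> (weight g) g"
    using assms [of "weight f"] unfolding descends_forest_iff by (metis iso_via_weight)
next
  fix f :: "'u forest" and v assume "v \<in> verts f"
  then show "linear (\<lambda>a. \<phi> (weight (relabel f v a)) (relabel f v a))"
    using assms [of "weight f"] by (simp add: descends_forest_iff)
qed

lemma iso_via_inverse:
  assumes "iso_via b f g"
  shows "iso_via (inv_into (verts f) b) g f" (is "iso_via ?c g f")
proof -
  have bij: "bij_betw b (verts f) (verts g)" using assms by (rule iso_via_bij)
  have "label f (?c w) = label g w" if w: "w \<in> verts g" for w
  proof -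
    have "?c w \<in> verts f" "b (?c w) = w"
      using bij w by (auto simp: bij_betw_def inv_into_into f_inv_into_f)
    then show ?thesis using assms by (auto simp: iso_via_def)
  qed
  with assms show ?thesis
    by (simp add: iso_via_def shape_map_inverse)
qed

lemma iso_via_inverse_obtain:
  assumes "iso_via b f g"
  obtains c where "iso_via c g f" "\<And>v. v \<in> verts f \<Longrightarrow> c (b v) = v" "\<And>w. w \<in> verts g \<Longrightarrow> b (c w) = w"
    "\<And>v. v \<in> verts f \<Longrightarrow> b v \<in> verts g" "\<And>w. w \<in> verts g \<Longrightarrow> c w \<in> verts f"
proof
  let ?c = "inv_into (verts f) b"
  have bij: "bij_betw b (verts f) (verts g)" using assms by (rule iso_via_bij)
  show "iso_via ?c g f" using assms by (rule iso_via_inverse)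
  show "?c (b v) = v" if "v \<in> verts f" for v using bij that by (auto simp: bij_betw_def)
  show "b (?c w) = w" if "w \<in> verts g" for w
    using bij that by (auto simp: bij_betw_def f_inv_into_f)
  show "b v \<in> verts g" if "v \<in> verts f" for v using bij that by (rule bij_betw_apply)
  show "?c w \<in> verts f" if "w \<in> verts g" for w
    using bij_betw_inv_into [OF bij] that by (rule bij_betw_apply)
qed

lemma restrict_relabel: "restrict_forest (relabel f v a) A = relabel (restrict_forest f A) v a"
  by (rule forest_eqI) (simp_all add: parent_restrict cong: if_cong option.case_cong)

lemma restrict_restrict: "restrict_forest (restrict_forest f A) B = restrict_forest f (A \<inter> B)"
  by (rule forest_eqI) (auto simp: parent_restrict fun_eq_iff split: option.splits)

lemma restrict_verts: "verts f \<subseteq> A \<Longrightarrow> restrict_forest f A = f"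
  by (rule forest_eqI)
    (auto simp: parent_restrict fun_eq_iff split: option.splits dest: parent_in_verts)

lemma gen_empty: "verts f = {} \<Longrightarrow> gen f = hone"
  unfolding hone_def
  by (rule gen_eq_labels) (auto simp: fun_eq_iff, metis empty_iff option.exhaust parent_in_verts(1))

lemma gen_restrict_relabel_outside:
  "v \<notin> A \<Longrightarrow> gen (restrict_forest (relabel f v a) A) = gen (restrict_forest f A)"
  by (rule gen_eq_labels) (auto simp: parent_restrict cong: if_cong option.case_cong)

section \<open>Sums over admissible cuts\<close>

abbreviation pruned :: "'u::real_vector forest \<Rightarrow> nat set \<Rightarrow> 'u hopf" where
  "pruned f A \<equiv> gen (restrict_forest f A)"

abbreviation trunk :: "'u::real_vector forest \<Rightarrow> nat set \<Rightarrow> 'u hopf" where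
  "trunk f A \<equiv> gen (restrict_forest f (verts f - A))"

lemma finite_down_sets [simp]: "finite (down_sets f)"
  by (rule finite_subset [of _ "Pow (verts f)"]) (auto simp: down_sets_def)

lemma down_setD: "A \<in> down_sets f \<Longrightarrow> A \<subseteq> verts f"
  "A \<in> down_sets f \<Longrightarrow> parent f v = Some w \<Longrightarrow> w \<in> A \<Longrightarrow> v \<in> A"
  by (auto simp: down_sets_def)

lemma down_sets_relabel [simp]: "down_sets (relabel f v a) = down_sets f"
  by (simp add: down_sets_def)

lemma empty_down_set [simp]: "{} \<in> down_sets f" and verts_down_set [simp]: "verts f \<in> down_sets f"
  by (auto simp: down_sets_def dest: parent_in_verts)

lemma down_sets_restrict:
  assumes "A \<in> down_sets f"
  shows "down_sets (restrict_forest f A) = {B \<in> down_sets f. B \<subseteq> A}"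
proof (intro set_eqI iffI)
  fix B assume B: "B \<in> down_sets (restrict_forest f A)"
  then have BA: "B \<subseteq> A" "B \<subseteq> verts f" using down_setD(1) [OF B] by auto
  have "v \<in> B" if "parent f v = Some w" "w \<in> B" for v w
  proof -
    have "w \<in> A" "v \<in> A" using BA that assms down_setD(2) by blast+
    then have "parent (restrict_forest f A) v = Some w" using that by (simp add: parent_restrict)
    then show ?thesis using B that down_setD(2) by metis
  qed
  then show "B \<in> {B \<in> down_sets f. B \<subseteq> A}" using BA unfolding down_sets_def by blast
next
  fix B assume "B \<in> {B \<in> down_sets f. B \<subseteq> A}"
  then show "B \<in> down_sets (restrict_forest f A)"
    by (auto simp: down_sets_def parent_restrict split: option.splits if_splits)
qed

lemma down_sets_restrict_complement:
  assumes "B \<in> down_sets f"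
  shows "C \<in> down_sets (restrict_forest f (verts f - B)) \<longleftrightarrow> C \<inter> B = {} \<and> B \<union> C \<in> down_sets f"
proof
  assume C: "C \<in> down_sets (restrict_forest f (verts f - B))"
  then have CB: "C \<inter> B = {}" "C \<subseteq> verts f" using down_setD(1) [OF C] by auto
  have "v \<in> B \<union> C" if "parent f v = Some w" "w \<in> B \<union> C" for v w
  proof (rule ccontr)
    assume "v \<notin> B \<union> C"
    then have "v \<notin> B" "w \<in> C" "w \<notin> B" "v \<in> verts f" "w \<in> verts f"
      using that assms CB down_setD(2) [of B f v w] parent_in_verts by blast+
    then have "parent (restrict_forest f (verts f - B)) v = Some w"
      using that by (simp add: parent_restrict)
    then show False using \<open>w \<in> C\<close> \<open>v \<notin> B \<union> C\<close> C down_setD(2) by blast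
  qed
  then show "C \<inter> B = {} \<and> B \<union> C \<in> down_sets f"
    using CB assms by (simp add: down_sets_def) blast
next
  assume C: "C \<inter> B = {} \<and> B \<union> C \<in> down_sets f"
  have "v \<in> C" if p: "parent (restrict_forest f (verts f - B)) v = Some w" and "w \<in> C" for v w
  proof -
    have "parent f v = Some w" "v \<notin> B"
      using p by (auto simp: parent_restrict split: option.splits if_splits)
    then show ?thesis using C \<open>w \<in> C\<close> down_setD(2) [of "B \<union> C" f v w] by blast
  qed
  moreover have "C \<subseteq> verts f - B" using C down_setD(1) by blast
  ultimately show "C \<in> down_sets (restrict_forest f (verts f - B))"
    by (auto simp: down_sets_def)
qed

lemma down_set_image:
  assumes "iso_via b f g" "A \<in> down_sets f"
  shows "b ` A \<in> down_sets g"
proof -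
  obtain c where c: "iso_via c g f" "\<And>v. v \<in> verts f \<Longrightarrow> c (b v) = v" "\<And>w. w \<in> verts g \<Longrightarrow> b (c w) = w"
    "\<And>v. v \<in> verts f \<Longrightarrow> b v \<in> verts g" "\<And>w. w \<in> verts g \<Longrightarrow> c w \<in> verts f"
    using iso_via_inverse_obtain [OF assms(1)] by blast
  have A: "A \<subseteq> verts f" using assms(2) by (rule down_setD)
  have "v \<in> b ` A" if vw: "parent g v = Some w" "w \<in> b ` A" for v w
  proof -
    have v: "v \<in> verts g" using vw(1) by (rule parent_in_verts)
    have "parent f (c v) = Some (c w)"
      using c(1) v vw(1) by (simp add: iso_via_def shape_map_def)
    moreover have "c w \<in> A" using vw(2) A c(2) by auto
    ultimately have "c v \<in> A" by (rule down_setD(2) [OF assms(2)])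
    then have "b (c v) \<in> b ` A" by (rule imageI)
    then show ?thesis using c(3) [OF v] by simp
  qed
  moreover have "b ` A \<subseteq> verts g" using A c(4) by auto
  ultimately show ?thesis unfolding down_sets_def by blast
qed

lemma bij_betw_down_sets:
  assumes "iso_via b f g"
  shows "bij_betw ((`) b) (down_sets f) (down_sets g)"
proof -
  obtain c where c: "iso_via c g f" "\<And>v. v \<in> verts f \<Longrightarrow> c (b v) = v" "\<And>w. w \<in> verts g \<Longrightarrow> b (c w) = w"
    "\<And>v. v \<in> verts f \<Longrightarrow> b v \<in> verts g" "\<And>w. w \<in> verts g \<Longrightarrow> c w \<in> verts f"
    using iso_via_inverse_obtain [OF assms(1)] by blast
  show ?thesis
  proof (rule bij_betw_byWitness [where f' = "(`) c"])
    show "\<forall>A\<in>down_sets f. c ` b ` A = A"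
      using c(2) down_setD(1) by (force simp: image_image)
    show "\<forall>A\<in>down_sets g. b ` c ` A = A"
      using c(3) down_setD(1) by (force simp: image_image)
    show "(`) b ` down_sets f \<subseteq> down_sets g" "(`) c ` down_sets g \<subseteq> down_sets f"
      using down_set_image [OF assms] down_set_image [OF c(1)] by auto
  qed
qed

text \<open>
  In Sweedler notation this is \<open>\<beta>(x', x'')\<close> where \<open>\<Delta> x = x' \<otimes> x''\<close>, for bilinear \<open>\<beta>\<close>.
\<close>

definition split_sum ::
  "('u::real_vector hopf \<Rightarrow> 'u hopf \<Rightarrow> 'w::real_vector) \<Rightarrow> 'u hopf \<Rightarrow> 'w" where
  "split_sum \<beta> = linext (\<lambda>f. \<Sum>A\<in>down_sets f.
     \<beta> (pruned f A) (trunk f A))"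

lemma descends_split_sum:
  fixes \<beta> :: "'u::real_vector hopf \<Rightarrow> 'u hopf \<Rightarrow> 'w::real_vector"
  assumes "bilinear \<beta>"
  shows "descends (\<lambda>f. \<Sum>A\<in>down_sets f.
     \<beta> (pruned f A) (trunk f A))" (is "descends ?\<phi>")
proof (rule descends_forestI)
  fix b and f g :: "'u forest" assume iso: "iso_via b f g"
  have "?\<phi> g = (\<Sum>A\<in>down_sets f. \<beta> (gen (restrict_forest g (b ` A)))
     (gen (restrict_forest g (verts g - b ` A))))"
    by (rule sum.reindex_bij_betw [OF bij_betw_down_sets [OF iso], symmetric])
  also have "\<dots> = ?\<phi> f"
  proof (rule sum.cong)
    fix A assume A: "A \<in> down_sets f"
    have "verts g - b ` A = b ` (verts f - A)"
      using inj_on_image_set_diff [of b "verts f" "verts f" A] iso_via_bij [OF iso] down_setD(1) [OF A]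
      by (auto simp: bij_betw_def)
    then show "\<beta> (gen (restrict_forest g (b ` A))) (gen (restrict_forest g (verts g - b ` A))) =
      \<beta> (pruned f A) (trunk f A)"
      using gen_iso [OF iso_via_restrict [OF iso down_setD(1) [OF A]]]
        gen_iso [OF iso_via_restrict [OF iso Diff_subset [of "verts f" A]]] by simp
  qed simp
  finally show "?\<phi> f = ?\<phi> g" ..
next
  fix f :: "'u forest" and v assume v: "v \<in> verts f"
  have "linear (\<lambda>a. \<beta> (gen (restrict_forest (relabel f v a) A))
     (gen (restrict_forest (relabel f v a) (verts f - A))))" for A
  proof (cases "v \<in> A")
    case True
    then have "gen (restrict_forest (relabel f v a) (verts f - A)) = trunk f A" for a
      by (intro gen_restrict_relabel_outside) simp
    moreover have "v \<in> verts (restrict_forest f A)" using True v by simp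
    ultimately show ?thesis
      by (simp add: restrict_relabel [of _ _ _ A] linear_comp_left [OF assms linear_gen_relabel])
  next
    case False
    then have "gen (restrict_forest (relabel f v a) A) = pruned f A" for a
      by (intro gen_restrict_relabel_outside) simp
    moreover have "v \<in> verts (restrict_forest f (verts f - A))" using False v by simp
    ultimately show ?thesis
      by (simp add: restrict_relabel [of _ _ _ "verts f - A"]
          linear_comp_right [OF assms linear_gen_relabel])
  qed
  then show "linear (\<lambda>a. ?\<phi> (relabel f v a))"
    by (simp add: linear_compose_sum)
qed

lemma linear_split_sum: "bilinear \<beta> \<Longrightarrow> linear (split_sum \<beta>)"
  and split_sum_gen: "bilinear \<beta> \<Longrightarrow> split_sum \<beta> (gen f) = (\<Sum>A\<in>down_sets f.
     \<beta> (pruned f A) (trunk f A))"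
  unfolding split_sum_def by (rule linext [OF descends_split_sum], assumption)+

lemma cop_eq_split_sum: "cop = split_sum tensor"
  by (simp add: cop_def split_sum_def tensor_gen)

lemma linear_split_sum_image:
  assumes "linear L" "bilinear \<beta>"
  shows "L (split_sum \<beta> x) = split_sum (\<lambda>u v. L (\<beta> u v)) x"
proof (rule linear_eq_on_gen [where F = "\<lambda>x. L (split_sum \<beta> x)"])
  show "linear (\<lambda>x. L (split_sum \<beta> x))"
    using linear_compose [OF linear_split_sum [OF assms(2)] assms(1)] by (simp add: o_def)
qed (simp_all add: linear_split_sum bilinear_compose_linear assms split_sum_gen linear_sum)

lemma split_sum_add:
  assumes "bilinear \<beta>" "bilinear \<gamma>"
  shows "split_sum (\<lambda>u v. \<beta> u v + \<gamma> u v) x = split_sum \<beta> x + split_sum \<gamma> x"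
  by (rule linear_eq_on_gen [where F = "split_sum (\<lambda>u v. \<beta> u v + \<gamma> u v)"])
    (simp_all add: linear_split_sum bilinear_add assms split_sum_gen sum.distrib linear_compose_add)

lemma primitiveD:
  assumes "p \<in> primitives" "bilinear \<beta>"
  shows "split_sum \<beta> p = \<beta> p hone + \<beta> hone p"
proof -
  let ?L = "linext (\<lambda>(a, b). \<beta> (gen a) (gen b))"
  have "split_sum \<beta> p = ?L (cop p)"
    by (simp add: cop_eq_split_sum linear_split_sum_image tensor_universal bilinear_tensor assms)
  also have "\<dots> = \<beta> p hone + \<beta> hone p"
    using assms by (simp add: primitives_def linear_add [OF tensor_universal(1)] tensor_universal)
  finally show ?thesis .
qed

lemma linear_split_sum_param:
  assumes "\<And>w. bilinear (\<lambda>u v. t u v w)" "\<And>u v. linear (t u v)"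
  shows "linear (\<lambda>w. split_sum (\<lambda>u v. t u v w) x)"
proof (rule linearI)
  show "split_sum (\<lambda>u v. t u v (y + z)) x = split_sum (\<lambda>u v. t u v y) x + split_sum (\<lambda>u v. t u v z) x" for y z
    using assms by (simp add: linear_add [OF assms(2)] split_sum_add)
  show "split_sum (\<lambda>u v. t u v (c *\<^sub>R y)) x = c *\<^sub>R split_sum (\<lambda>u v. t u v y) x" for c y
    using linear_split_sum_image [OF linear_scale_self assms(1), of c y x]
    by (simp add: linear_scale [OF assms(2)])
qed

text \<open>
  Both sides run over the pairs of nested cuts \<open>B \<subseteq> A\<close>; the substitution is \<open>C = A - B\<close>.
\<close>

lemma sum_down_sets_coassoc:
  "(\<Sum>A\<in>down_sets f. \<Sum>B\<in>down_sets (restrict_forest f A). h B A) =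
   (\<Sum>B\<in>down_sets f. \<Sum>C\<in>down_sets (restrict_forest f (verts f - B)). h B (B \<union> C))"
proof -
  have "(\<Sum>(A, B)\<in>Sigma (down_sets f) (\<lambda>A. down_sets (restrict_forest f A)). h B A) =
    (\<Sum>(B, C)\<in>Sigma (down_sets f) (\<lambda>B. down_sets (restrict_forest f (verts f - B))). h B (B \<union> C))"
  proof (rule sum.reindex_bij_witness [where i = "\<lambda>(B, C). (B \<union> C, B)" and j = "\<lambda>(A, B). (B, A - B)"],
      goal_cases)
    case (1 a)
    then show ?case by (auto simp: down_sets_restrict)
  next
    case (2 a)
    then obtain A B where a: "a = (A, B)" "A \<in> down_sets f" "B \<in> down_sets f" "B \<subseteq> A"
      by (auto simp: down_sets_restrict)
    then have "B \<union> (A - B) = A" by auto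
    with a show ?case by (auto simp: down_sets_restrict_complement Int_commute)
  next
    case (3 b)
    then show ?case by (auto simp: down_sets_restrict_complement)
  next
    case (4 b)
    then show ?case by (auto simp: down_sets_restrict_complement down_sets_restrict)
  next
    case (5 a)
    then have "fst a = snd a \<union> (fst a - snd a)" by (auto simp: down_sets_restrict)
    then show ?case by (simp add: split_beta)
  qed
  then show ?thesis by (simp add: sum.Sigma)
qed

definition trilinear where
  "trilinear t \<longleftrightarrow> (\<forall>u. bilinear (t u)) \<and> (\<forall>w. bilinear (\<lambda>u v. t u v w))"

lemma split_sum_coassoc:
  assumes t: "trilinear t"
  shows "split_sum (\<lambda>x w. split_sum (\<lambda>u v. t u v w) x) y = split_sum (\<lambda>u x. split_sum (t u) x) y"
proof -
  have b: "bilinear (t u)" "bilinear (\<lambda>u v. t u v w)" for u w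
    using t by (auto simp: trilinear_def)
  then have l: "linear (\<lambda>w. t u v w)" "linear (\<lambda>u. t u v w)" for u v w
    by (auto simp: bilinear_def)
  have b1: "bilinear (\<lambda>x w. split_sum (\<lambda>u v. t u v w) x)"
    unfolding bilinear_def
    by (intro conjI allI linear_split_sum_param linear_split_sum b l)
  have "linear (\<lambda>u. split_sum (t u) x)" for x
    using linear_split_sum_param [where t = "\<lambda>v w u. t u v w", OF b(1) l(2)] .
  then have b2: "bilinear (\<lambda>u x. split_sum (t u) x)"
    unfolding bilinear_def by (intro conjI allI linear_split_sum b) auto
  show ?thesis
  proof (rule linear_eq_on_gen [OF linear_split_sum [OF b1] linear_split_sum [OF b2]])
    fix f
    define h where "h B A = t (pruned f B) (gen (restrict_forest f (A - B)))
      (trunk f A)" for B A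
    have "split_sum (\<lambda>x w. split_sum (\<lambda>u v. t u v w) x) (gen f) =
      (\<Sum>A\<in>down_sets f. \<Sum>B\<in>down_sets (restrict_forest f A). h B A)"
      unfolding split_sum_gen [OF b1] split_sum_gen [OF b(2)]
    proof (intro sum.cong refl)
      fix A B assume "A \<in> down_sets f" "B \<in> down_sets (restrict_forest f A)"
      then have "A \<subseteq> verts f" "B \<subseteq> A" by (auto simp: down_sets_restrict dest: down_setD)
      then have "A \<inter> B = B" "A \<inter> (verts f \<inter> A - B) = A - B" by auto
      then show "t (gen (restrict_forest (restrict_forest f A) B))
        (gen (restrict_forest (restrict_forest f A) (verts (restrict_forest f A) - B)))
        (trunk f A) = h B A"
        by (simp add: h_def restrict_restrict)
    qed
    also have "\<dots> = (\<Sum>B\<in>down_sets f. \<Sum>C\<in>down_sets (restrict_forest f (verts f - B)). h B (B \<union> C))"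
      by (rule sum_down_sets_coassoc)
    also have "\<dots> = split_sum (\<lambda>u x. split_sum (t u) x) (gen f)"
      unfolding split_sum_gen [OF b2] split_sum_gen [OF b(1)]
    proof (intro sum.cong refl)
      fix B C assume "B \<in> down_sets f" "C \<in> down_sets (restrict_forest f (verts f - B))"
      then have "C \<inter> B = {}" "C \<subseteq> verts f"
        by (auto simp: down_sets_restrict_complement dest: down_setD)
      then have "B \<union> C - B = C" "(verts f - B) \<inter> C = C"
        "(verts f - B) \<inter> (verts f \<inter> (verts f - B) - C) = verts f - (B \<union> C)" by auto
      then show "h B (B \<union> C) = t (pruned f B)
        (gen (restrict_forest (restrict_forest f (verts f - B)) C))
        (gen (restrict_forest (restrict_forest f (verts f - B))
          (verts (restrict_forest f (verts f - B)) - C)))"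
        by (simp add: h_def restrict_restrict)
    qed
    finally show "split_sum (\<lambda>x w. split_sum (\<lambda>u v. t u v w) x) (gen f) =
      split_sum (\<lambda>u x. split_sum (t u) x) (gen f)" .
  qed
qed

section \<open>Product, grafting and natural growth\<close>

lemma graft_relabel_left: "graft \<phi> (relabel f v a) g = relabel (graft \<phi> f g) (2 * v) a"
  by (rule forest_eqI) (auto simp: parent_graft fun_eq_iff elim!: evenE cong: if_cong option.case_cong)

lemma graft_relabel_right: "graft \<phi> f (relabel g v a) = relabel (graft \<phi> f g) (2 * v + 1) a"
  by (rule forest_eqI) (auto simp: parent_graft fun_eq_iff elim!: oddE cong: if_cong option.case_cong)

lemma gen_graft_iso:
  assumes "iso_via b f f'" "iso_via c g g'"
    and "\<And>r. r \<in> roots f \<Longrightarrow> \<phi>' (b r) = map_option c (\<phi> r)"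
    and "\<And>r w. r \<in> roots f \<Longrightarrow> \<phi> r = Some w \<Longrightarrow> w \<in> verts g"
  shows "gen (graft \<phi> f g) = gen (graft \<phi>' f' g')"
  by (rule gen_iso, rule iso_via_graft [of b f f' c g g' \<phi>' \<phi>]) (fact assms)+

lemma linear_gen_graft_relabel:
  "v \<in> verts f \<Longrightarrow> linear (\<lambda>a. gen (graft \<phi> (relabel f v a) g))"
  "w \<in> verts g \<Longrightarrow> linear (\<lambda>a. gen (graft \<phi> f (relabel g w a)))"
  unfolding graft_relabel_left graft_relabel_right
  by (rule linear_gen_relabel; simp)+

lemma descends_hmult_right: "descends (\<lambda>g. gen (graft (\<lambda>_. None) f g))"
  by (rule descends_forestI, rule gen_graft_iso [OF iso_via_id])
    (auto intro: linear_gen_graft_relabel)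

lemma descends_hmult_left: "descends (\<lambda>f. gen (graft (\<lambda>_. None) f g))"
  by (rule descends_forestI, rule gen_graft_iso [OF _ iso_via_id])
    (auto intro: linear_gen_graft_relabel)

lemma bilinear_hmult: "bilinear hmult"
  unfolding hmult_def by (rule bilinext [OF descends_hmult_right descends_hmult_left])

lemma hmult_gen: "hmult (gen f) (gen g) = gen (graft (\<lambda>_. None) f g)"
  unfolding hmult_def by (rule bilinext [OF descends_hmult_right descends_hmult_left])

text \<open>
  Natural growth without the normalising factor. Unlike natural growth it is given by one formula
  for all forests, which makes its coproduct computable.
\<close>

definition graft_sum :: "'u::real_vector hopf \<Rightarrow> 'u hopf \<Rightarrow> 'u hopf" where
  "graft_sum = bilinext (\<lambda>f g. \<Sum>v\<in>verts g. gen (graft (\<lambda>_. Some v) f g))"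

lemma descends_graft_sum_right:
  fixes f :: "'u::real_vector forest"
  shows "descends (\<lambda>g. \<Sum>v\<in>verts g. gen (graft (\<lambda>_. Some v) f g))" (is "descends ?\<phi>")
proof (rule descends_forestI)
  fix b and g g' :: "'u forest" assume iso: "iso_via b g g'"
  have "?\<phi> g' = (\<Sum>v\<in>verts g. gen (graft (\<lambda>_. Some (b v)) f g'))"
    by (rule sum.reindex_bij_betw [OF iso_via_bij [OF iso], symmetric])
  also have "\<dots> = ?\<phi> g"
    by (intro sum.cong refl gen_graft_iso [OF iso_via_id iso, symmetric]) auto
  finally show "?\<phi> g = ?\<phi> g'" ..
qed (auto intro: linear_compose_sum linear_gen_graft_relabel)

lemma descends_graft_sum_left:
  fixes g :: "'u::real_vector forest"
  shows "descends (\<lambda>f. \<Sum>v\<in>verts g. gen (graft (\<lambda>_. Some v) f g))" (is "descends ?\<phi>")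
proof (rule descends_forestI)
  fix b and f f' :: "'u forest" assume iso: "iso_via b f f'"
  show "?\<phi> f = ?\<phi> f'"
    by (intro sum.cong refl gen_graft_iso [OF iso iso_via_id]) auto
qed (auto intro: linear_compose_sum linear_gen_graft_relabel)

lemma bilinear_graft_sum: "bilinear graft_sum"
  unfolding graft_sum_def by (rule bilinext [OF descends_graft_sum_right descends_graft_sum_left])

lemma graft_sum_gen: "graft_sum (gen f) (gen g) = (\<Sum>v\<in>verts g. gen (graft (\<lambda>_. Some v) f g))"
  unfolding graft_sum_def by (rule bilinext [OF descends_graft_sum_right descends_graft_sum_left])

lemma gen_graft_empty_left: "verts f = {} \<Longrightarrow> gen (graft \<phi> f g) = gen g"
proof (rule gen_iso [symmetric, where b = "\<lambda>v. 2 * v + 1"], rule iso_viaI)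
  assume f: "verts f = {}"
  show "bij_betw (\<lambda>v. 2 * v + 1) (verts g) (verts (graft \<phi> f g))"
    using f by (auto simp: bij_betw_def inj_on_def)
  show "parent (graft \<phi> f g) (2 * v + 1) = map_option (\<lambda>v. 2 * v + 1) (parent g v)" for v
    by (simp add: parent_graft)
qed simp

lemma gen_graft_empty_right: "verts g = {} \<Longrightarrow> gen (graft \<phi> f g) = gen f"
proof (rule gen_iso [symmetric, where b = "\<lambda>v. 2 * v"], rule iso_viaI)
  assume g: "verts g = {}"
  show "bij_betw (\<lambda>v. 2 * v) (verts f) (verts (graft \<phi> f g))"
    using g by (auto simp: bij_betw_def inj_on_def)
  show "parent (graft \<phi> f g) (2 * v) = map_option (\<lambda>v. 2 * v) (parent f v)" if "v \<in> verts f" for v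
    using g that by (simp add: parent_graft split: option.splits)
qed simp

lemma hmult_hone_left: "hmult hone x = x"
  by (rule linear_eq_on_gen [where F = "hmult hone"])
    (use bilinear_hmult linear_id_fun in \<open>auto simp: bilinear_def hone_def hmult_gen gen_graft_empty_left\<close>)

lemma hmult_hone_right: "hmult x hone = x"
  by (rule linear_eq_on_gen [where F = "\<lambda>x. hmult x hone"])
    (use bilinear_hmult linear_id_fun in \<open>auto simp: bilinear_def hone_def hmult_gen gen_graft_empty_right\<close>)

lemma graft_sum_hone_right: "graft_sum x hone = 0"
  by (rule linear_eq_on_gen [where F = "\<lambda>x. graft_sum x hone"])
    (use bilinear_graft_sum linear_zero in \<open>auto simp: bilinear_def hone_def graft_sum_gen\<close>)

definition growth :: "'u::real_vector forest \<Rightarrow> 'u forest \<Rightarrow> 'u hopf" where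
  "growth f g = (if verts f = {} then gen g else if verts g = {} then gen f
    else (1 / real (weight g)) *\<^sub>R (\<Sum>v\<in>verts g. gen (graft (\<lambda>_. Some v) f g)))"

text \<open>
  Grafting the empty forest onto a vertex changes nothing, hence the average over the vertices
  of a non-empty \<open>g\<close> gives the right value \<open>g\<close> also when \<open>f\<close> is empty.
\<close>

lemma growth_eq_right:
  "growth f g = (if verts g = {} then gen f else (1 / real (weight g)) *\<^sub>R graft_sum (gen f) (gen g))"
proof (cases "verts f = {} \<and> verts g \<noteq> {}")
  case True
  then show ?thesis
    by (simp add: growth_def graft_sum_gen gen_graft_empty_left weight_def sum_constant_scaleR
        card_eq_0_iff)
next
  case False
  then consider "verts f = {}" "verts g = {}" | "verts f \<noteq> {}" by blast
  then show ?thesis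
    by cases (simp_all add: growth_def graft_sum_gen gen_empty)
qed

lemma descends_growth_left: "descends (\<lambda>f. growth f g)"
proof -
  have l: "linear (\<lambda>x. graft_sum x (gen g))"
    using bilinear_graft_sum by (auto simp: bilinear_def)
  show ?thesis
    unfolding growth_eq_right by (cases "verts g = {}")
      (simp_all add: descends_gen descends_linear [OF linear_compose_scale_right [OF l]])
qed

lemma descends_growth_right:
  fixes f :: "'u::real_vector forest"
  shows "descends (growth f)"
proof (cases "verts f = {}")
  case True
  then show ?thesis by (simp add: growth_def [abs_def] descends_gen cong: if_cong)
next
  case False
  show ?thesis
  proof (rule descends_forestI)
    fix b and g g' :: "'u forest" assume iso: "iso_via b g g'"
    then have "verts g = {} \<longleftrightarrow> verts g' = {}"
      using iso_via_weight [OF iso] by (simp flip: weight_0_iff)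
    then show "growth f g = growth f g'"
      by (simp add: growth_eq_right gen_iso [OF iso] iso_via_weight [OF iso])
  next
    fix g :: "'u forest" and v assume v: "v \<in> verts g"
    have "linear (graft_sum (gen f))"
      using bilinear_graft_sum by (auto simp: bilinear_def)
    then have "linear (\<lambda>a. graft_sum (gen f) (gen (relabel g v a)))"
      using linear_compose [OF linear_gen_relabel [OF v]] by (simp add: o_def)
    moreover have "verts g \<noteq> {}" using v by auto
    ultimately show "linear (\<lambda>a. growth f (relabel g v a))"
      by (simp add: growth_eq_right linear_compose_scale_right)
  qed
qed

lemma natural_growth_eq: "natural_growth = bilinext growth"
  by (simp add: natural_growth_def growth_def [abs_def])

lemma bilinear_natural_growth: "bilinear natural_growth"
  unfolding natural_growth_eq by (rule bilinext [OF descends_growth_right descends_growth_left])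

lemma natural_growth_gen_gen: "natural_growth (gen f) (gen g) = growth f g"
  unfolding natural_growth_eq by (rule bilinext [OF descends_growth_right descends_growth_left])

lemma natural_growth_gen:
  "verts g \<noteq> {} \<Longrightarrow> natural_growth (gen f) (gen g) = (1 / real (weight g)) *\<^sub>R graft_sum (gen f) (gen g)"
  by (simp add: natural_growth_gen_gen growth_eq_right)

lemma natural_growth_gen_empty: "verts g = {} \<Longrightarrow> natural_growth (gen f) (gen g) = gen f"
  by (simp add: natural_growth_gen_gen growth_eq_right)

lemma linear_natural_growth: "linear (natural_growth x)" "linear (\<lambda>x. natural_growth x y)"
  using bilinear_natural_growth by (auto simp: bilinear_def)

lemma natural_growth_hone_left: "natural_growth hone x = x"
  by (rule linear_eq_on_gen [OF linear_natural_growth(1) linear_id_fun])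
    (simp add: hone_def natural_growth_gen_gen growth_def)

section \<open>The grading and the counit\<close>

definition hopf_deg :: "nat \<Rightarrow> 'u::real_vector hopf set" where
  "hopf_deg n = span {gen f | f. weight f = n}"

lemma gen_in_hopf_deg: "gen f \<in> hopf_deg (weight f)"
  unfolding hopf_deg_def by (rule span_base) auto

lemma hopf_deg_le: "x \<in> hopf_deg n \<Longrightarrow> n \<le> N \<Longrightarrow> x \<in> hopf_le N"
  unfolding hopf_deg_def hopf_le_def by (rule subsetD [OF span_mono]) auto

definition counit :: "'u::real_vector hopf \<Rightarrow> real" where
  "counit = linext (\<lambda>f. if verts f = {} then 1 else 0)"

lemma descends_counit:
  "descends (\<lambda>f :: 'u::real_vector forest. if verts f = {} then 1 else 0 :: real)"
proof (rule descends_forestI)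
  fix b and f g :: "'u forest" assume "iso_via b f g"
  then show "(if verts f = {} then 1 else 0 :: real) = (if verts g = {} then 1 else 0)"
    using iso_via_weight [of b f g] by (simp flip: weight_0_iff)
next
  fix f :: "'u forest" and v assume "v \<in> verts f"
  then have "verts f \<noteq> {}" by auto
  then show "linear (\<lambda>a. if verts (relabel f v a) = {} then 1 else 0 :: real)"
    by (simp add: linear_zero)
qed

lemma linear_counit: "linear counit"
  unfolding counit_def by (rule linext [OF descends_counit])

lemma counit_gen: "counit (gen f) = (if verts f = {} then 1 else 0)"
  unfolding counit_def by (rule linext [OF descends_counit])

lemma counit_hone [simp]: "counit hone = 1"
  by (simp add: hone_def counit_gen)

definition plus_part :: "'u::real_vector hopf \<Rightarrow> 'u hopf" where
  "plus_part x = x - counit x *\<^sub>R hone"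

lemma linear_plus_part: "linear plus_part"
  unfolding plus_part_def [abs_def]
  by (intro linear_compose_sub linear_id_fun linear_lscale linear_counit)

lemma plus_part_gen: "plus_part (gen f) = (if verts f = {} then 0 else gen f)"
  by (simp add: plus_part_def counit_gen gen_empty)

lemma plus_part_hone [simp]: "plus_part hone = 0"
  by (simp add: plus_part_def)

lemma counit_hopf_plus:
  assumes "x \<in> hopf_plus" shows "counit x = 0"
proof (rule linear_eq_0_on_span [OF linear_counit])
  show "x \<in> span {gen f | f. verts f \<noteq> {}}" using assms by (simp add: hopf_plus_def)
  fix y :: "'a hopf" assume "y \<in> {gen f | f. verts f \<noteq> {}}"
  then obtain f where "y = gen f" "verts f \<noteq> {}" by blast
  then show "counit y = 0" by (simp add: counit_gen)
qed

lemma plus_part_in_hopf_plus: "plus_part x \<in> hopf_plus"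
  unfolding hopf_plus_def
proof (rule linear_preserves_span [OF linear_plus_part])
  show "x \<in> span (range gen)" by (simp add: span_gen)
  fix y :: "'a hopf" assume "y \<in> range gen"
  then obtain f where "y = gen f" by blast
  then show "plus_part y \<in> span {gen f | f. verts f \<noteq> {}}"
    by (cases "verts f = {}") (auto simp: plus_part_gen span_zero intro!: span_base)
qed

lemma hopf_plus_iff: "x \<in> hopf_plus \<longleftrightarrow> counit x = 0"
  using plus_part_in_hopf_plus [of x] counit_hopf_plus [of x] by (auto simp: plus_part_def)

lemma plus_part_id: "x \<in> hopf_plus \<Longrightarrow> plus_part x = x"
  by (simp add: hopf_plus_iff plus_part_def)

lemma subspace_hopf_plus: "subspace hopf_plus"
  by (simp add: hopf_plus_def)

lemma restrict_empty_iff: "A \<subseteq> verts f \<Longrightarrow> verts (restrict_forest f A) = {} \<longleftrightarrow> A = {}"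
  by auto

lemma split_sum_counit_left:
  assumes "linear F" shows "split_sum (\<lambda>u v. counit u *\<^sub>R F v) x = F x"
proof -
  have b: "bilinear (\<lambda>u v. counit u *\<^sub>R F v)"
    by (auto simp: bilinear_def linear_lscale linear_counit assms linear_compose_scale_right)
  show ?thesis
  proof (rule linear_eq_on_gen [OF linear_split_sum [OF b] assms])
    fix f :: "'a forest"
    have "split_sum (\<lambda>u v. counit u *\<^sub>R F v) (gen f) =
      (\<Sum>A\<in>down_sets f. if A = {} then F (gen f) else 0)"
      unfolding split_sum_gen [OF b]
    proof (intro sum.cong refl)
      fix A assume "A \<in> down_sets f"
      then have "verts (restrict_forest f A) = {} \<longleftrightarrow> A = {}"
        by (intro restrict_empty_iff down_setD)
      then show "counit (pruned f A) *\<^sub>R F (trunk f A) =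
        (if A = {} then F (gen f) else 0)"
        by (simp add: counit_gen restrict_verts)
    qed
    also have "\<dots> = F (gen f)" by (simp add: sum.delta)
    finally show "split_sum (\<lambda>u v. counit u *\<^sub>R F v) (gen f) = F (gen f)" .
  qed
qed

lemma split_sum_counit_right:
  assumes "linear F" shows "split_sum (\<lambda>u v. counit v *\<^sub>R F u) x = F x"
proof -
  have b: "bilinear (\<lambda>u v. counit v *\<^sub>R F u)"
    by (auto simp: bilinear_def linear_lscale linear_counit assms linear_compose_scale_right)
  show ?thesis
  proof (rule linear_eq_on_gen [OF linear_split_sum [OF b] assms])
    fix f :: "'a forest"
    have "split_sum (\<lambda>u v. counit v *\<^sub>R F u) (gen f) =
      (\<Sum>A\<in>down_sets f. if A = verts f then F (gen f) else 0)"
      unfolding split_sum_gen [OF b]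
    proof (intro sum.cong refl)
      fix A assume "A \<in> down_sets f"
      then have "verts (restrict_forest f (verts f - A)) = {} \<longleftrightarrow> A = verts f"
        using down_setD(1) by auto
      then show "counit (trunk f A) *\<^sub>R F (pruned f A) =
        (if A = verts f then F (gen f) else 0)"
        by (simp add: counit_gen restrict_verts)
    qed
    also have "\<dots> = F (gen f)" by (simp add: sum.delta)
    finally show "split_sum (\<lambda>u v. counit v *\<^sub>R F u) (gen f) = F (gen f)" .
  qed
qed

lemma split_sum_hone:
  fixes \<beta> :: "'a::real_vector hopf \<Rightarrow> 'a hopf \<Rightarrow> 'w::real_vector"
  shows "bilinear \<beta> \<Longrightarrow> split_sum \<beta> hone = \<beta> hone hone"
proof -
  assume b: "bilinear \<beta>"
  have "down_sets (dots [] :: 'a forest) = {{}}" by (auto simp: down_sets_def)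
  then show ?thesis
    unfolding hone_def split_sum_gen [OF b] by (simp add: restrict_verts)
qed

lemma graft_sum_deg:
  assumes "x \<in> hopf_deg m" "y \<in> hopf_deg n" shows "graft_sum x y \<in> hopf_deg (m + n)"
  using assms unfolding hopf_deg_def
proof (rule bilinear_preserves_span [OF bilinear_graft_sum])
  fix a b :: "'a hopf" assume "a \<in> {gen f | f. weight f = m}" "b \<in> {gen f | f. weight f = n}"
  then obtain f g where fg: "a = gen f" "b = gen g" "weight f = m" "weight g = n" by auto
  have "gen (graft (\<lambda>_. Some v) f g) \<in> span {gen f | f. weight f = m + n}" for v
    using fg by (intro span_base CollectI exI [of _ "graft (\<lambda>_. Some v) f g"]) simp
  then show "graft_sum a b \<in> span {gen f | f. weight f = m + n}"
    by (simp add: fg graft_sum_gen span_sum)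
qed

lemma natural_growth_deg:
  assumes "x \<in> hopf_deg m" "y \<in> hopf_deg n" shows "natural_growth x y \<in> hopf_deg (m + n)"
  unfolding hopf_deg_def
proof (rule bilinear_preserves_span [OF bilinear_natural_growth])
  show "x \<in> span {gen f | f. weight f = m}" "y \<in> span {gen f | f. weight f = n}"
    using assms by (auto simp: hopf_deg_def)
  fix a b :: "'a hopf" assume "a \<in> {gen f | f. weight f = m}" "b \<in> {gen f | f. weight f = n}"
  then obtain f g where fg: "a = gen f" "b = gen g" "weight f = m" "weight g = n" by auto
  show "natural_growth a b \<in> span {gen f | f. weight f = m + n}"
  proof (cases "verts g = {}")
    case True
    then show ?thesis using fg by (auto simp: natural_growth_gen_empty weight_def intro: span_base)
  next
    case False
    then show ?thesis
      using graft_sum_deg [OF gen_in_hopf_deg gen_in_hopf_deg, of f g] fg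
      by (simp add: natural_growth_gen hopf_deg_def span_scale)
  qed
qed

lemma natural_growth_hopf_plus:
  assumes "y \<in> hopf_plus" shows "natural_growth x y \<in> hopf_plus"
  unfolding hopf_plus_def
proof (rule bilinear_preserves_span [OF bilinear_natural_growth])
  show "x \<in> span (range gen)" by (simp add: span_gen)
  show "y \<in> span {gen f | f. verts f \<noteq> {}}" using assms by (simp add: hopf_plus_def)
  fix a b :: "'a hopf" assume "a \<in> range gen" "b \<in> {gen f | f. verts f \<noteq> {}}"
  then obtain f g where fg: "a = gen f" "b = gen g" "verts g \<noteq> {}" by auto
  have "gen (graft (\<lambda>_. Some v) f g) \<in> span {gen f | f. verts f \<noteq> {}}" for v
    using fg(3) by (intro span_base) (auto intro!: exI [of _ "graft (\<lambda>_. Some v) f g"])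
  then show "natural_growth a b \<in> span {gen f | f. verts f \<noteq> {}}"
    using fg by (simp add: natural_growth_gen graft_sum_gen span_scale span_sum)
qed

section \<open>Coproducts of graftings\<close>

definition join :: "nat set \<Rightarrow> nat set \<Rightarrow> nat set" where
  "join A C = (\<lambda>v. 2 * v) ` A \<union> (\<lambda>v. 2 * v + 1) ` C"

lemma mem_join: "x \<in> join A C \<longleftrightarrow> (if even x then x div 2 \<in> A else x div 2 \<in> C)"
  by (auto simp: join_def image_iff elim: evenE oddE)

lemma mem_join_simps [simp]: "2 * v \<in> join A C \<longleftrightarrow> v \<in> A" "Suc (2 * v) \<in> join A C \<longleftrightarrow> v \<in> C"
  by (simp_all add: mem_join)

lemma join_diff: "join A C - join A' C' = join (A - A') (C - C')"
  by (auto simp: mem_join split: if_splits)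

lemma verts_graft: "verts (graft \<phi> f g) = join (verts f) (verts g)"
  by (simp add: join_def)

text \<open>
  A root of the restriction of \<open>f\<close> is either a root of \<open>f\<close>, which remains attached to \<open>g\<close> if the vertex
  below it is kept, or has lost its parent in \<open>f\<close>, and is then not attached to \<open>g\<close>.
\<close>

lemma restrict_graft:
  assumes "A \<subseteq> verts f" "C \<subseteq> verts g"
    and "\<And>r. r \<in> A \<Longrightarrow> parent f r = None \<Longrightarrow> \<phi>' r = (case \<phi> r of None \<Rightarrow> None | Some w \<Rightarrow> if w \<in> C then Some w else None)"
    and "\<And>r w. r \<in> A \<Longrightarrow> parent f r = Some w \<Longrightarrow> w \<notin> A \<Longrightarrow> \<phi>' r = None"
  shows "restrict_forest (graft \<phi> f g) (join A C) = graft \<phi>' (restrict_forest f A) (restrict_forest g C)"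
proof (rule forest_eqI)
  show "verts (restrict_forest (graft \<phi> f g) (join A C)) =
    verts (graft \<phi>' (restrict_forest f A) (restrict_forest g C))"
    unfolding verts_graft verts_simps(2) using assms(1,2) by (auto simp: mem_join split: if_splits)
  show "parent (restrict_forest (graft \<phi> f g) (join A C)) =
    parent (graft \<phi>' (restrict_forest f A) (restrict_forest g C))"
  proof
    fix x
    consider v where "x = 2 * v" | v where "x = Suc (2 * v)" by (metis evenE oddE Suc_eq_plus1)
    then show "parent (restrict_forest (graft \<phi> f g) (join A C)) x =
      parent (graft \<phi>' (restrict_forest f A) (restrict_forest g C)) x"
    proof cases
      case 1
      show ?thesis
      proof (cases "v \<in> A")
        case True
        then have "v \<in> verts f" using assms(1) by auto
        with True 1 assms(2) assms(3,4) [of v] show ?thesis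
          by (auto simp: parent_restrict parent_graft split: option.splits)
      qed (simp add: 1 parent_restrict parent_graft)
    next
      case 2
      then show ?thesis
        by (auto simp: parent_restrict parent_graft split: option.splits)
    qed
  qed
qed (simp cong: if_cong)

text \<open>
  A cut that contains a vertex of \<open>g\<close> must contain the roots of \<open>f\<close> grafted onto it.
\<close>

definition compatible_cut :: "(nat \<Rightarrow> nat option) \<Rightarrow> 'u forest \<Rightarrow> nat set \<Rightarrow> nat set \<Rightarrow> bool" where
  "compatible_cut \<phi> f A C \<longleftrightarrow> (\<forall>r\<in>roots f. \<forall>w\<in>C. \<phi> r = Some w \<longrightarrow> r \<in> A)"

lemma join_down_set:
  assumes "A \<in> down_sets f" "C \<in> down_sets g" "compatible_cut \<phi> f A C"
  shows "join A C \<in> down_sets (graft \<phi> f g)"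
proof -
  have "x \<in> join A C" if p: "parent (graft \<phi> f g) x = Some y" and y: "y \<in> join A C" for x y
  proof -
    consider v where "x = 2 * v" | v where "x = Suc (2 * v)" by (metis evenE oddE Suc_eq_plus1)
    then show ?thesis
    proof cases
      case 1
      show ?thesis
      proof (cases "parent f v")
        case None
        then obtain w where "v \<in> verts f" "\<phi> v = Some w" "w \<in> C"
          using p y 1 by (auto simp: parent_graft split: if_splits option.splits)
        then have "v \<in> A" using assms(3) None by (auto simp: compatible_cut_def roots_def)
        then show ?thesis using 1 by simp
      next
        case (Some w)
        then have "w \<in> A" using p y 1 by (auto simp: parent_graft split: if_splits)
        then have "v \<in> A" using Some down_setD(2) [OF assms(1)] by blast
        then show ?thesis using 1 by simp
      qed
    next
      case 2
      then obtain w where "parent g v = Some w" "w \<in> C" using p y by (auto simp: parent_graft)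
      then have "v \<in> C" using down_setD(2) [OF assms(2)] by blast
      then show ?thesis using 2 by simp
    qed
  qed
  moreover have "join A C \<subseteq> verts (graft \<phi> f g)"
    unfolding verts_graft using down_setD(1) [OF assms(1)] down_setD(1) [OF assms(2)]
    by (auto simp: mem_join split: if_splits)
  ultimately show ?thesis unfolding down_sets_def by blast
qed

lemma down_set_graftD:
  assumes X: "X \<in> down_sets (graft \<phi> f g)"
  shows "{v. 2 * v \<in> X} \<in> down_sets f" "{v. Suc (2 * v) \<in> X} \<in> down_sets g"
    "compatible_cut \<phi> f {v. 2 * v \<in> X} {v. Suc (2 * v) \<in> X}"
proof -
  have sub: "X \<subseteq> join (verts f) (verts g)" using down_setD(1) [OF X] unfolding verts_graft .
  have f: "2 * v \<in> X \<Longrightarrow> v \<in> verts f" and g: "Suc (2 * v) \<in> X \<Longrightarrow> v \<in> verts g" for v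
    using sub by (metis mem_join_simps subsetD)+
  have "v \<in> {v. 2 * v \<in> X}" if "parent f v = Some w" "w \<in> {v. 2 * v \<in> X}" for v w
    using that down_setD(2) [OF X, of "2 * v" "2 * w"] parent_in_verts(1) [OF that(1)]
    by (simp add: parent_graft)
  then show "{v. 2 * v \<in> X} \<in> down_sets f" using f unfolding down_sets_def by blast
  have "v \<in> {v. Suc (2 * v) \<in> X}" if "parent g v = Some w" "w \<in> {v. Suc (2 * v) \<in> X}" for v w
    using that down_setD(2) [OF X, of "Suc (2 * v)" "Suc (2 * w)"] by (simp add: parent_graft)
  then show "{v. Suc (2 * v) \<in> X} \<in> down_sets g" using g unfolding down_sets_def by blast
  have "r \<in> {v. 2 * v \<in> X}" if "r \<in> roots f" "w \<in> {v. Suc (2 * v) \<in> X}" "\<phi> r = Some w" for r w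
    using that g [of w] down_setD(2) [OF X, of "2 * r" "Suc (2 * w)"]
    by (simp add: parent_graft roots_def)
  then show "compatible_cut \<phi> f {v. 2 * v \<in> X} {v. Suc (2 * v) \<in> X}"
    unfolding compatible_cut_def by blast
qed

lemma sum_down_sets_graft:
  "(\<Sum>X\<in>down_sets (graft \<phi> f g). F X) =
   (\<Sum>A\<in>down_sets f. \<Sum>C\<in>down_sets g. if compatible_cut \<phi> f A C then F (join A C) else 0)"
proof -
  let ?S = "{p \<in> down_sets f \<times> down_sets g. compatible_cut \<phi> f (fst p) (snd p)}"
  have "bij_betw (\<lambda>p. join (fst p) (snd p)) ?S (down_sets (graft \<phi> f g))"
  proof (rule bij_betw_byWitness [where f' = "\<lambda>X. ({v. 2 * v \<in> X}, {v. Suc (2 * v) \<in> X})"])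
    show "\<forall>X\<in>down_sets (graft \<phi> f g).
      join (fst ({v. 2 * v \<in> X}, {v. Suc (2 * v) \<in> X})) (snd ({v. 2 * v \<in> X}, {v. Suc (2 * v) \<in> X})) = X"
      by (auto simp: mem_join split: if_splits)
    show "(\<lambda>p. join (fst p) (snd p)) ` ?S \<subseteq> down_sets (graft \<phi> f g)"
      by (auto intro: join_down_set)
    show "(\<lambda>X. ({v. 2 * v \<in> X}, {v. Suc (2 * v) \<in> X})) ` down_sets (graft \<phi> f g) \<subseteq> ?S"
      by (auto intro: down_set_graftD)
  qed auto
  then have "(\<Sum>X\<in>down_sets (graft \<phi> f g). F X) = (\<Sum>p\<in>?S. F (join (fst p) (snd p)))"
    by (rule sum.reindex_bij_betw [symmetric])
  also have "\<dots> = (\<Sum>p\<in>down_sets f \<times> down_sets g.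
    if compatible_cut \<phi> f (fst p) (snd p) then F (join (fst p) (snd p)) else 0)"
    by (rule sum.inter_filter) simp
  also have "\<dots> = (\<Sum>A\<in>down_sets f. \<Sum>C\<in>down_sets g. if compatible_cut \<phi> f A C then F (join A C) else 0)"
    by (simp add: sum.cartesian_product split_beta)
  finally show ?thesis .
qed

lemma down_set_containing_roots:
  assumes "A \<in> down_sets f" "roots f \<subseteq> A" shows "A = verts f"
proof -
  obtain h :: "nat \<Rightarrow> nat" where h: "\<And>v w. parent f v = Some w \<Longrightarrow> h w < h v"
    using forest_rank by blast
  have "v \<in> A" if "v \<in> verts f" for v
    using that
  proof (induction "h v" arbitrary: v rule: less_induct)
    case less
    show ?case
    proof (cases "parent f v")
      case None
      then show ?thesis using less assms(2) by (auto simp: roots_def)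
    next
      case (Some w)
      then have "w \<in> A" using less h parent_in_verts by blast
      then show ?thesis using Some down_setD(2) [OF assms(1)] by blast
    qed
  qed
  then show ?thesis using down_setD(1) [OF assms(1)] by blast
qed

text \<open>
  If the vertex \<open>v\<close> onto which \<open>f\<close> is grafted lies in the pruned part \<open>C\<close> of \<open>g\<close>, then \<open>C\<close> takes the
  whole of \<open>f\<close> with it: this is the first summand. Otherwise \<open>f\<close> is cut independently of \<open>g\<close>, its pruned
  part being separated from \<open>g\<close> while its trunk remains grafted onto \<open>v\<close>: the second summand.
\<close>

lemma split_sum_graft_sum_gen:
  fixes f g :: "'u::real_vector forest"
  assumes \<beta>: "bilinear \<beta>"
  shows "split_sum \<beta> (graft_sum (gen f) (gen g)) =
    (\<Sum>C\<in>down_sets g.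
      \<beta> (graft_sum (gen f) (pruned g C)) (trunk g C) +
      (\<Sum>A\<in>down_sets f. \<beta> (hmult (pruned f A) (pruned g C))
        (graft_sum (trunk f A) (trunk g C))))"
proof -
  let ?G = "\<lambda>v. graft (\<lambda>_. Some v) f g"
  define F where "F v A C = \<beta> (gen (restrict_forest (?G v) (join A C)))
    (gen (restrict_forest (?G v) (join (verts f - A) (verts g - C))))" for v A C
  note l = linear_split_sum [OF \<beta>]
  have "split_sum \<beta> (graft_sum (gen f) (gen g)) = (\<Sum>v\<in>verts g. \<Sum>A\<in>down_sets f. \<Sum>C\<in>down_sets g.
    if compatible_cut (\<lambda>_. Some v) f A C then F v A C else 0)"
    unfolding graft_sum_gen linear_sum [OF l] split_sum_gen [OF \<beta>] sum_down_sets_graft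
    by (simp only: verts_graft join_diff F_def)
  also have "\<dots> = (\<Sum>v\<in>verts g. \<Sum>C\<in>down_sets g. \<Sum>A\<in>down_sets f.
    if compatible_cut (\<lambda>_. Some v) f A C then F v A C else 0)"
    by (intro sum.cong refl sum.swap)
  also have "\<dots> = (\<Sum>C\<in>down_sets g. \<Sum>v\<in>verts g. \<Sum>A\<in>down_sets f.
    if compatible_cut (\<lambda>_. Some v) f A C then F v A C else 0)" (is "_ = (\<Sum>C\<in>_. ?R C)")
    by (rule sum.swap)
  also have "\<dots> = (\<Sum>C\<in>down_sets g.
      \<beta> (graft_sum (gen f) (pruned g C)) (trunk g C) +
      (\<Sum>A\<in>down_sets f. \<beta> (hmult (pruned f A) (pruned g C))
        (graft_sum (trunk f A) (trunk g C))))"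
  proof (rule sum.cong)
    fix C assume C: "C \<in> down_sets g"
    then have Cg: "C \<subseteq> verts g" by (rule down_setD)
    let ?T = "\<lambda>v. \<Sum>A\<in>down_sets f. if compatible_cut (\<lambda>_. Some v) f A C then F v A C else 0"
    have "?T v = \<beta> (gen (graft (\<lambda>_. Some v) f (restrict_forest g C))) (trunk g C)"
      if v: "v \<in> C" for v
    proof -
      have "compatible_cut (\<lambda>_. Some v) f A C \<longleftrightarrow> A = verts f" if "A \<in> down_sets f" for A
        using v down_set_containing_roots [OF that] by (auto simp: compatible_cut_def roots_def)
      then have "?T v = (\<Sum>A\<in>down_sets f. if A = verts f then F v A C else 0)"
        by (intro sum.cong) auto
      also have "\<dots> = F v (verts f) C" by (simp add: sum.delta)
      also have "restrict_forest (?G v) (join (verts f) C) =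
        graft (\<lambda>_. Some v) (restrict_forest f (verts f)) (restrict_forest g C)"
        using v Cg by (intro restrict_graft) (auto dest: parent_in_verts)
      moreover have "restrict_forest (?G v) (join {} (verts g - C)) =
        graft (\<lambda>_. None) (restrict_forest f {}) (restrict_forest g (verts g - C))"
        by (intro restrict_graft) auto
      ultimately show ?thesis
        by (simp add: F_def restrict_verts gen_graft_empty_left)
    qed
    moreover have "?T v = (\<Sum>A\<in>down_sets f. \<beta> (gen (graft (\<lambda>_. None) (restrict_forest f A) (restrict_forest g C)))
        (gen (graft (\<lambda>_. Some v) (restrict_forest f (verts f - A)) (restrict_forest g (verts g - C)))))"
      if v: "v \<in> verts g - C" for v
    proof (rule sum.cong)
      fix A assume A: "A \<in> down_sets f"
      have "compatible_cut (\<lambda>_. Some v) f A C" using v by (auto simp: compatible_cut_def)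
      moreover have "restrict_forest (?G v) (join A C) =
        graft (\<lambda>_. None) (restrict_forest f A) (restrict_forest g C)"
        using v Cg down_setD(1) [OF A] by (intro restrict_graft) auto
      moreover have "restrict_forest (?G v) (join (verts f - A) (verts g - C)) =
        graft (\<lambda>_. Some v) (restrict_forest f (verts f - A)) (restrict_forest g (verts g - C))"
        using v down_setD [OF A] by (intro restrict_graft) (auto dest: parent_in_verts)
      ultimately show "(if compatible_cut (\<lambda>_. Some v) f A C then F v A C else 0) =
        \<beta> (gen (graft (\<lambda>_. None) (restrict_forest f A) (restrict_forest g C)))
        (gen (graft (\<lambda>_. Some v) (restrict_forest f (verts f - A)) (restrict_forest g (verts g - C))))"
        by (simp add: F_def)
    qed simp
    moreover have "?R C = (\<Sum>v\<in>verts g - C. ?T v) + (\<Sum>v\<in>C. ?T v)"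
      by (rule sum.subset_diff [OF Cg]) simp
    ultimately have "?R C =
      (\<Sum>v\<in>verts g - C. \<Sum>A\<in>down_sets f. \<beta> (gen (graft (\<lambda>_. None) (restrict_forest f A) (restrict_forest g C)))
        (gen (graft (\<lambda>_. Some v) (restrict_forest f (verts f - A)) (restrict_forest g (verts g - C))))) +
      (\<Sum>v\<in>C. \<beta> (gen (graft (\<lambda>_. Some v) f (restrict_forest g C))) (trunk g C))"
      by simp
    also have "(\<Sum>v\<in>C. \<beta> (gen (graft (\<lambda>_. Some v) f (restrict_forest g C))) (trunk g C)) =
      \<beta> (graft_sum (gen f) (pruned g C)) (trunk g C)"
    proof -
      have "verts g \<inter> C = C" using Cg by auto
      moreover have "linear (\<lambda>x. \<beta> x y)" for y using \<beta> by (simp add: bilinear_def)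
      ultimately show ?thesis by (simp add: graft_sum_gen linear_sum [where f = "\<lambda>x. \<beta> x y" for y])
    qed
    also have "(\<Sum>v\<in>verts g - C. \<Sum>A\<in>down_sets f. \<beta> (gen (graft (\<lambda>_. None) (restrict_forest f A) (restrict_forest g C)))
        (gen (graft (\<lambda>_. Some v) (restrict_forest f (verts f - A)) (restrict_forest g (verts g - C))))) =
      (\<Sum>A\<in>down_sets f. \<Sum>v\<in>verts g - C. \<beta> (gen (graft (\<lambda>_. None) (restrict_forest f A) (restrict_forest g C)))
        (gen (graft (\<lambda>_. Some v) (restrict_forest f (verts f - A)) (restrict_forest g (verts g - C)))))"
      by (rule sum.swap)
    also have "\<dots> = (\<Sum>A\<in>down_sets f. \<beta> (hmult (pruned f A) (pruned g C))
        (graft_sum (trunk f A) (trunk g C)))"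
    proof -
      have "verts g \<inter> (verts g - C) = verts g - C" by auto
      moreover have "linear (\<beta> x)" for x using \<beta> by (simp add: bilinear_def)
      ultimately show ?thesis by (simp add: graft_sum_gen hmult_gen linear_sum)
    qed
    finally show "?R C = \<beta> (graft_sum (gen f) (pruned g C)) (trunk g C) +
      (\<Sum>A\<in>down_sets f. \<beta> (hmult (pruned f A) (pruned g C))
        (graft_sum (trunk f A) (trunk g C)))"
      by (simp add: add.commute)
  qed simp
  finally show ?thesis .
qed

text \<open>
  As the weights of the two parts of a cut of \<open>g\<close> add up to the weight of \<open>g\<close>, the normalising factor
  \<open>1 / |g|\<close> of natural growth can be moved into the bilinear map that is summed over the cuts. This
  makes primitivity applicable to inhomogeneous elements as well.
\<close>

lemma bilinear_scaled_by_weight: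
  assumes "bilinear \<beta>"
  shows "bilinear (bilinext (\<lambda>u v. (1 / real (weight u + weight v)) *\<^sub>R \<beta> (gen u) (gen v)))"
    and "bilinext (\<lambda>u v. (1 / real (weight u + weight v)) *\<^sub>R \<beta> (gen u) (gen v)) (gen f) (gen g) =
      (1 / real (weight f + weight g)) *\<^sub>R \<beta> (gen f) (gen g)"
proof -
  have l: "linear (\<beta> x)" "linear (\<lambda>x. \<beta> x y)" for x y using assms by (auto simp: bilinear_def)
  have 1: "descends (\<lambda>v. (1 / real (weight u + weight v)) *\<^sub>R \<beta> (gen u) (gen v))" for u
    by (rule descends_cases_weight [where \<phi> = "\<lambda>n v. (1 / real (weight u + n)) *\<^sub>R \<beta> (gen u) (gen v)"])
      (rule descends_linear [OF linear_compose_scale_right [OF l(1)]])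
  have 2: "descends (\<lambda>u. (1 / real (weight u + weight v)) *\<^sub>R \<beta> (gen u) (gen v))" for v
    by (rule descends_cases_weight [where \<phi> = "\<lambda>n u. (1 / real (n + weight v)) *\<^sub>R \<beta> (gen u) (gen v)"])
      (rule descends_linear [OF linear_compose_scale_right [OF l(2)]])
  show "bilinear (bilinext (\<lambda>u v. (1 / real (weight u + weight v)) *\<^sub>R \<beta> (gen u) (gen v)))"
    and "bilinext (\<lambda>u v. (1 / real (weight u + weight v)) *\<^sub>R \<beta> (gen u) (gen v)) (gen f) (gen g) =
      (1 / real (weight f + weight g)) *\<^sub>R \<beta> (gen f) (gen g)"
    by (rule bilinext [OF 1 2])+
qed

lemma weight_restrict_complement:
  "A \<in> down_sets f \<Longrightarrow> weight (restrict_forest f A) + weight (restrict_forest f (verts f - A)) = weight f"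
proof -
  assume "A \<in> down_sets f"
  then have "A \<subseteq> verts f" by (rule down_setD)
  then have "verts f \<inter> A = A" "verts f \<inter> (verts f - A) = verts f - A" "finite A"
    by (auto intro: finite_subset)
  then show ?thesis using card_Diff_subset [of A "verts f"] card_mono [OF finite_verts \<open>A \<subseteq> verts f\<close>]
    by (simp add: weight_def \<open>A \<subseteq> verts f\<close>)
qed

lemma hopf_plus_induct [consumes 1]:
  assumes "x \<in> hopf_plus" "linear F" "linear G" "\<And>f. verts f \<noteq> {} \<Longrightarrow> F (gen f) = G (gen f)"
  shows "F x = G x"
  using assms(1) unfolding hopf_plus_def
  by (rule linear_eq_on_span [OF assms(2,3), rotated]) (use assms(4) in auto)

text \<open>
  Growing onto a primitive element is a cocycle. By the previous lemmas the left-hand side is the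
  sum over the cuts of \<open>p\<close> of a bilinear map \<open>H\<close>, so by primitivity it equals \<open>H(p, 1) + H(1, p)\<close>. Nothing can be
  grafted onto the empty forest, which leaves exactly one of the two summands of \<open>H\<close> in each term.
\<close>

theorem split_sum_growth_primitive:
  fixes p y :: "'u::real_vector hopf" and \<beta> :: "'u hopf \<Rightarrow> 'u hopf \<Rightarrow> 'w::real_vector"
  assumes p: "p \<in> primitives" and \<beta>: "bilinear \<beta>"
  shows "split_sum \<beta> (natural_growth y p) =
    \<beta> (natural_growth y p) hone + split_sum (\<lambda>u v. \<beta> u (natural_growth v p)) y"
proof -
  have pp: "p \<in> hopf_plus" using p by (simp add: primitives_def)
  have l: "linear (\<beta> x)" "linear (\<lambda>x. \<beta> x y)" for x y using \<beta> by (auto simp: bilinear_def)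
  have lg: "linear (graft_sum x)" "linear (\<lambda>x. graft_sum x y)" for x y :: "'u hopf"
    using bilinear_graft_sum by (auto simp: bilinear_def)
  have lm: "linear (hmult x)" "linear (\<lambda>x. hmult x y)" for x y :: "'u hopf"
    using bilinear_hmult by (auto simp: bilinear_def)
  have b: "bilinear (\<lambda>u v. \<beta> u (natural_growth v q))" for q
    by (rule bilinear_comp [OF \<beta> linear_id_fun linear_natural_growth(2)])
  have key: "split_sum \<beta> (natural_growth (gen f) p) =
    \<beta> (natural_growth (gen f) p) hone + split_sum (\<lambda>u v. \<beta> u (natural_growth v p)) (gen f)" for f
  proof -
    \<comment> \<open>The summand of \<open>split_sum_graft_sum_gen\<close> that belongs to the parts \<open>u\<close> and \<open>v\<close> of \<open>g\<close>.\<close>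
    define G where "G u v = \<beta> (graft_sum (gen f) u) v +
      (\<Sum>A\<in>down_sets f. \<beta> (hmult (pruned f A) u)
        (graft_sum (trunk f A) v))" for u v
    have bG: "bilinear G"
      unfolding G_def [abs_def] bilinear_def
      by (intro conjI allI linear_compose_add linear_compose_sum ballI
          linear_comp_left [OF \<beta>] linear_comp_right [OF \<beta>] lg lm l)
    define H where "H = bilinext (\<lambda>u v. (1 / real (weight u + weight v)) *\<^sub>R G (gen u) (gen v))"
    have bH: "bilinear H" and H: "H (gen u) (gen v) = (1 / real (weight u + weight v)) *\<^sub>R G (gen u) (gen v)" for u v
      unfolding H_def by (rule bilinear_scaled_by_weight [OF bG])+
    have "split_sum \<beta> (natural_growth (gen f) p) = split_sum H p"
      using pp
    proof (rule hopf_plus_induct)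
      show "linear (\<lambda>p. split_sum \<beta> (natural_growth (gen f) p))"
        using linear_compose [OF linear_natural_growth(1) linear_split_sum [OF \<beta>]] by (simp add: o_def)
      show "linear (split_sum H)" by (rule linear_split_sum [OF bH])
      fix g :: "'u forest" assume g: "verts g \<noteq> {}"
      have "split_sum \<beta> (natural_growth (gen f) (gen g)) =
        (1 / real (weight g)) *\<^sub>R split_sum \<beta> (graft_sum (gen f) (gen g))"
        using g by (simp add: natural_growth_gen linear_scale [OF linear_split_sum [OF \<beta>]])
      also have "\<dots> = (\<Sum>C\<in>down_sets g. (1 / real (weight g)) *\<^sub>R
          G (pruned g C) (trunk g C))"
        by (simp add: split_sum_graft_sum_gen [OF \<beta>] G_def scaleR_sum_right)
      also have "\<dots> = split_sum H (gen g)"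
        unfolding split_sum_gen [OF bH] by (intro sum.cong refl) (simp add: H weight_restrict_complement)
      finally show "split_sum \<beta> (natural_growth (gen f) (gen g)) = split_sum H (gen g)" .
    qed
    also have "\<dots> = H p hone + H hone p" by (rule primitiveD [OF p bH])
    also have "H p hone = \<beta> (natural_growth (gen f) p) hone"
      using pp
    proof (rule hopf_plus_induct)
      show "linear (\<lambda>p. H p hone)" using bH by (simp add: bilinear_def)
      show "linear (\<lambda>p. \<beta> (natural_growth (gen f) p) hone)"
        by (rule linear_comp_left [OF \<beta> linear_natural_growth(1)])
      fix g :: "'u forest" assume g: "verts g \<noteq> {}"
      have "G (gen g) hone = \<beta> (graft_sum (gen f) (gen g)) hone"
        by (simp add: G_def graft_sum_hone_right linear_0 [OF l(1)])
      then show "H (gen g) hone = \<beta> (natural_growth (gen f) (gen g)) hone"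
        using g H [of g "dots []"] by (simp flip: hone_def add: natural_growth_gen linear_scale [OF l(2)])
    qed
    also have "H hone p = split_sum (\<lambda>u v. \<beta> u (natural_growth v p)) (gen f)"
      using pp
    proof (rule hopf_plus_induct)
      show "linear (H hone)" using bH by (simp add: bilinear_def)
      show "linear (\<lambda>p. split_sum (\<lambda>u v. \<beta> u (natural_growth v p)) (gen f))"
        by (intro linear_split_sum_param b linear_comp_right [OF \<beta>] linear_natural_growth)
      fix g :: "'u forest" assume g: "verts g \<noteq> {}"
      have "G hone (gen g) = (\<Sum>A\<in>down_sets f. \<beta> (pruned f A)
        (graft_sum (trunk f A) (gen g)))"
        using graft_sum_hone_right [of "gen f"]
        by (simp add: G_def hmult_hone_right linear_0 [OF l(2)])
      then show "H hone (gen g) = split_sum (\<lambda>u v. \<beta> u (natural_growth v (gen g))) (gen f)"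
        using g H [of "dots []" g]
        by (simp flip: hone_def add: natural_growth_gen linear_scale [OF l(1)] split_sum_gen [OF b] scaleR_sum_right)
    qed
    finally show ?thesis .
  qed
  show ?thesis
  proof (rule linear_eq_on_gen [where F = "\<lambda>y. split_sum \<beta> (natural_growth y p)"])
    show "linear (\<lambda>y. split_sum \<beta> (natural_growth y p))"
      using linear_compose [OF linear_natural_growth(2) linear_split_sum [OF \<beta>]] by (simp add: o_def)
    show "linear (\<lambda>y. \<beta> (natural_growth y p) hone + split_sum (\<lambda>u v. \<beta> u (natural_growth v p)) y)"
      by (intro linear_compose_add linear_comp_left [OF \<beta> linear_natural_growth(2)] linear_split_sum b)
  qed (rule key)
qed

section \<open>The projection onto the primitive elements\<close>

text \<open>
  Solutions of equations in which the value at a forest depends on values at smaller forests.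
\<close>

lemma weight_recursion:
  fixes T :: "('u::real_vector hopf \<Rightarrow> 'w::real_vector) \<Rightarrow> 'u hopf \<Rightarrow> 'w"
  assumes lin: "\<And>F. linear F \<Longrightarrow> linear (T F)"
    and dep: "\<And>F G f. linear F \<Longrightarrow> linear G \<Longrightarrow>
      (\<And>g. weight g < weight f \<Longrightarrow> F (gen g) = G (gen g)) \<Longrightarrow> T F (gen f) = T G (gen f)"
  shows "\<exists>F. linear F \<and> (\<forall>x. F x = T F x)"
proof -
  \<comment> \<open>After \<open>n\<close> steps the values at the forests of weight less than \<open>n\<close> are final.\<close>
  define I where "I n = (T ^^ n) (\<lambda>_. 0)" for n
  have I_Suc: "I (Suc n) = T (I n)" for n by (simp add: I_def)
  have I: "linear (I n)" for n by (induction n) (simp_all add: I_Suc lin, simp add: I_def linear_zero)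
  have stable: "I m (gen f) = I n (gen f)" if "weight f < m" "weight f < n" for f m n
    using that
  proof (induction "weight f" arbitrary: f m n rule: less_induct)
    case less
    obtain m' n' where mn: "m = Suc m'" "n = Suc n'" using less.prems by (metis less_nat_zero_code not0_implies_Suc)
    show ?case
      unfolding mn I_Suc
    proof (rule dep [OF I I])
      fix g :: "'u forest" assume "weight g < weight f"
      then show "I m' (gen g) = I n' (gen g)"
        using less.prems mn by (intro less.hyps) auto
    qed
  qed
  define F where "F = linext (\<lambda>f. I (Suc (weight f)) (gen f))"
  have "descends (\<lambda>f. I (Suc (weight f)) (gen f))"
    by (rule descends_cases_weight [where \<phi> = "\<lambda>n f. I (Suc n) (gen f)"]) (rule descends_linear [OF I])
  note F = linext [OF this, folded F_def]
  have "F x = T F x" for x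
  proof (rule linear_eq_on_gen [OF F(1) lin [OF F(1)]])
    fix f
    have "T F (gen f) = T (I (weight f)) (gen f)"
      by (rule dep [OF F(1) I]) (auto simp: F(2) intro: stable)
    then show "F (gen f) = T F (gen f)" by (simp add: F(2) I_Suc)
  qed
  with F(1) show ?thesis by blast
qed

text \<open>
  The recursion for the projection onto the primitive elements; the argument \<open>plus_part u\<close> removes the
  term in which \<open>F\<close> would be applied to \<open>x\<close> itself.
\<close>

definition is_prim_part :: "('u::real_vector hopf \<Rightarrow> 'u hopf) \<Rightarrow> bool" where
  "is_prim_part F \<longleftrightarrow> linear F \<and>
     (\<forall>x. F x = plus_part x - split_sum (\<lambda>u v. natural_growth (plus_part u) (F v)) x)"

definition prim_part :: "'u::real_vector hopf \<Rightarrow> 'u hopf" where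
  "prim_part = (SOME F. is_prim_part F)"

lemma weight_restrict_less:
  "A \<in> down_sets f \<Longrightarrow> A \<noteq> {} \<Longrightarrow> weight (restrict_forest f (verts f - A)) < weight f"
  "A \<in> down_sets f \<Longrightarrow> A \<noteq> verts f \<Longrightarrow> weight (restrict_forest f A) < weight f"
  unfolding weight_def
  by (rule psubset_card_mono; use down_setD(1) [of A f] in \<open>auto\<close>)+

lemma bilinear_plus_growth: "linear F \<Longrightarrow> bilinear (\<lambda>u v. natural_growth (plus_part u) (F v))"
  by (rule bilinear_comp [OF bilinear_natural_growth linear_plus_part])

lemma is_prim_part_prim_part: "is_prim_part (prim_part :: 'u::real_vector hopf \<Rightarrow> 'u hopf)"
proof -
  have "\<exists>F :: 'u hopf \<Rightarrow> 'u hopf. linear F \<and>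
    (\<forall>x. F x = plus_part x - split_sum (\<lambda>u v. natural_growth (plus_part u) (F v)) x)"
  proof (rule weight_recursion)
    fix F :: "'u hopf \<Rightarrow> 'u hopf" assume F: "linear F"
    show "linear (\<lambda>x. plus_part x - split_sum (\<lambda>u v. natural_growth (plus_part u) (F v)) x)"
      by (intro linear_compose_sub linear_plus_part linear_split_sum bilinear_plus_growth F)
    fix G and f :: "'u forest" assume G: "linear G" and eq: "\<And>g. weight g < weight f \<Longrightarrow> F (gen g) = G (gen g)"
    have "natural_growth (plus_part (pruned f A)) (F (trunk f A)) =
      natural_growth (plus_part (pruned f A)) (G (trunk f A))"
      if "A \<in> down_sets f" for A
      using that eq weight_restrict_less(1) [OF that]
      by (cases "A = {}") (simp_all add: plus_part_gen linear_0 [OF linear_natural_growth(2)])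
    then show "plus_part (gen f) - split_sum (\<lambda>u v. natural_growth (plus_part u) (F v)) (gen f) =
      plus_part (gen f) - split_sum (\<lambda>u v. natural_growth (plus_part u) (G v)) (gen f)"
      by (simp add: split_sum_gen bilinear_plus_growth F G)
  qed
  then show ?thesis
    unfolding prim_part_def is_prim_part_def [symmetric] by (rule someI_ex)
qed

lemma linear_prim_part: "linear prim_part"
  by (rule conjunct1 [OF is_prim_part_prim_part [unfolded is_prim_part_def]])

lemma prim_part_eq: "prim_part x =
    plus_part x - split_sum (\<lambda>u v. natural_growth (plus_part u) (prim_part v)) x"
  by (rule is_prim_part_prim_part [unfolded is_prim_part_def, THEN conjunct2, rule_format])

lemma prim_part_hone [simp]: "prim_part hone = 0"
  by (subst prim_part_eq)
    (simp add: split_sum_hone bilinear_plus_growth linear_prim_part linear_0 [OF linear_natural_growth(2)])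

lemma bilinear_growth_prim: "bilinear (\<lambda>u v. natural_growth u (prim_part v))"
  by (rule bilinear_comp [OF bilinear_natural_growth linear_id_fun linear_prim_part])

lemma split_sum_plus_left:
  assumes "bilinear \<beta>"
  shows "split_sum (\<lambda>u v. \<beta> (plus_part u) v) x = split_sum \<beta> x - \<beta> hone x"
proof -
  have l: "linear (\<beta> x)" for x using assms by (auto simp: bilinear_def)
  have l2: "linear (\<lambda>x. \<beta> x y)" for y using assms by (auto simp: bilinear_def)
  have 1: "bilinear (\<lambda>u v. \<beta> (plus_part u) v)"
    by (rule bilinear_comp [OF assms linear_plus_part linear_id_fun])
  have 2: "bilinear (\<lambda>u v. counit u *\<^sub>R \<beta> hone v)"
    by (auto simp: bilinear_def linear_lscale linear_counit l linear_compose_scale_right)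
  have "\<beta> u v = \<beta> (plus_part u) v + counit u *\<^sub>R \<beta> hone v" for u v
    by (simp add: plus_part_def linear_diff [OF l2] linear_scale [OF l2])
  then have "split_sum \<beta> x = split_sum (\<lambda>u v. \<beta> (plus_part u) v + counit u *\<^sub>R \<beta> hone v) x"
    by metis
  also have "\<dots> = split_sum (\<lambda>u v. \<beta> (plus_part u) v) x + \<beta> hone x"
    by (simp add: split_sum_add [OF 1 2] split_sum_counit_left [OF l])
  finally show ?thesis by simp
qed

lemma split_sum_plus_right:
  assumes "bilinear \<beta>"
  shows "split_sum (\<lambda>u v. \<beta> u (plus_part v)) x = split_sum \<beta> x - \<beta> x hone"
proof -
  have l: "linear (\<lambda>x. \<beta> x y)" for y using assms by (auto simp: bilinear_def)
  have l2: "linear (\<beta> x)" for x using assms by (auto simp: bilinear_def)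
  have 1: "bilinear (\<lambda>u v. \<beta> u (plus_part v))"
    by (rule bilinear_comp [OF assms linear_id_fun linear_plus_part])
  have 2: "bilinear (\<lambda>u v. counit v *\<^sub>R \<beta> u hone)"
    by (auto simp: bilinear_def linear_lscale linear_counit l linear_compose_scale_right)
  have "\<beta> u v = \<beta> u (plus_part v) + counit v *\<^sub>R \<beta> u hone" for u v
    by (simp add: plus_part_def linear_diff [OF l2] linear_scale [OF l2])
  then have "split_sum \<beta> x = split_sum (\<lambda>u v. \<beta> u (plus_part v) + counit v *\<^sub>R \<beta> u hone) x"
    by metis
  also have "\<dots> = split_sum (\<lambda>u v. \<beta> u (plus_part v)) x + \<beta> x hone"
    by (simp add: split_sum_add [OF 1 2] split_sum_counit_right [OF l])
  finally show ?thesis by simp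
qed

text \<open>
  The defining equation, read as a decomposition: every element without constant term is obtained by
  growing onto primitive elements.
\<close>

lemma growth_prim_part_decomposition:
  "split_sum (\<lambda>u v. natural_growth u (prim_part v)) x = plus_part x"
  using split_sum_plus_left [OF bilinear_growth_prim, of x] prim_part_eq [of x]
  by (simp add: natural_growth_hone_left)

lemma primitivesI:
  assumes "x \<in> hopf_plus" "split_sum tensor x = tensor x hone + tensor hone x"
  shows "x \<in> primitives"
  using assms by (simp add: primitives_def cop_eq_split_sum)

lemma subspace_primitives: "subspace primitives"
proof -
  have "linear (\<lambda>x. cop x - (tensor x hone + tensor hone x))"
    using bilinear_tensor linear_split_sum [OF bilinear_tensor]
    by (auto simp: bilinear_def cop_eq_split_sum intro!: linear_compose_add linear_compose_sub)
  from linear_subspace_kernel [OF this]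
  have "subspace (hopf_plus \<inter> {x. cop x - (tensor x hone + tensor hone x) = 0})"
    by (rule subspace_inter [OF subspace_hopf_plus])
  also have "hopf_plus \<inter> {x. cop x - (tensor x hone + tensor hone x) = 0} = primitives"
    by (auto simp: primitives_def)
  finally show ?thesis .
qed

lemma prim_part_in_hopf_plus: "prim_part x \<in> hopf_plus"
proof -
  have "split_sum (\<lambda>u v. natural_growth (plus_part u) (prim_part v)) x =
    plus_part x - prim_part x" using prim_part_eq [of x] by simp
  have 1: "linear (\<lambda>x. counit (prim_part x))"
    using linear_compose [OF linear_prim_part linear_counit] by (simp add: o_def)
  have 2: "counit (prim_part (gen f)) = 0" for f :: "'a forest"
  proof (induction "weight f" arbitrary: f rule: less_induct)
    case less
    have "counit (natural_growth (plus_part (pruned f A))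
        (prim_part (trunk f A))) = 0" if "A \<in> down_sets f" for A
    proof (cases "A = {}")
      case True
      then show ?thesis
        by (simp add: plus_part_gen linear_0 [OF linear_natural_growth(2)] linear_0 [OF linear_counit])
    next
      case False
      then have "prim_part (trunk f A) \<in> hopf_plus"
        using less [OF weight_restrict_less(1) [OF that]] by (simp add: hopf_plus_iff)
      then show ?thesis by (intro counit_hopf_plus natural_growth_hopf_plus)
    qed
    then show ?case
      by (subst prim_part_eq)
        (simp add: linear_diff [OF linear_counit] linear_sum [OF linear_counit]
          split_sum_gen bilinear_plus_growth linear_prim_part counit_hopf_plus plus_part_in_hopf_plus)
  qed
  show ?thesis
    unfolding hopf_plus_iff by (rule linear_eq_on_gen [OF 1 linear_zero 2])
qed

text \<open>
  Apply \<open>\<Delta>\<close> to \<open>\<pi>(x) = x - x' \<top> \<pi>(x'')\<close>, where \<open>\<pi>(x'')\<close> is primitive by induction. By the cocycle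
  property and coassociativity the right factors combine to \<open>v' \<top> \<pi>(v'')\<close> with \<open>v\<close> the right part
  of a cut of \<open>x\<close>, and the decomposition above turns this back into \<open>v\<close>. Everything then cancels
  except for \<open>\<pi>(x) \<otimes> 1 + 1 \<otimes> \<pi>(x)\<close>.
\<close>

theorem prim_part_primitive: "prim_part x \<in> primitives"
proof -
  define P where "P = (prim_part :: 'a hopf \<Rightarrow> 'a hopf)"
  have lP: "linear P" by (simp add: P_def linear_prim_part)
  have "split_sum tensor (P (gen f)) = tensor (P (gen f)) hone + tensor hone (P (gen f))" for f :: "'a forest"
  proof (induction "weight f" arbitrary: f rule: less_induct)
    case (less f)
    show ?case
    proof (cases "verts f = {}")
      case True
      then show ?thesis
        by (simp add: gen_empty P_def linear_0 [OF linear_split_sum [OF bilinear_tensor]]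
            bilinear_lzero [OF bilinear_tensor] bilinear_rzero [OF bilinear_tensor])
    next
      case False
      define t where "t u v w = tensor u (natural_growth v (P w))" for u v w :: "'a hopf"
      have lt: "linear (\<lambda>u. t u v w)" "linear (\<lambda>v. t u v w)" "linear (t u v)" for u v w
        unfolding t_def using bilinear_tensor
        by (auto simp: bilinear_def intro!: linear_comp_right [OF bilinear_tensor]
            linear_natural_growth linear_comp_right [OF bilinear_natural_growth] lP)
      have tri: "trilinear t"
        using lt by (auto simp: trilinear_def bilinear_def)
      have bt: "bilinear (\<lambda>u v. t u v w)" "bilinear (t u)" for u w
        using tri by (auto simp: trilinear_def)
      have bs: "bilinear (\<lambda>a w. split_sum (\<lambda>u v. t u v w) a)"
        unfolding bilinear_def by (intro conjI allI linear_split_sum_param linear_split_sum bt lt)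
      have lT: "linear (\<lambda>u :: 'a hopf. tensor u (hone :: 'a hopf))"
        by (rule linear_comp_left [OF bilinear_tensor linear_id_fun])
      let ?u = "\<lambda>A. plus_part (pruned f A)" and ?w = "\<lambda>A. trunk f A"
      have step: "split_sum tensor (natural_growth (?u A) (P (?w A))) =
        tensor (natural_growth (?u A) (P (?w A))) hone + split_sum (\<lambda>u v. t u v (?w A)) (?u A)"
        if A: "A \<in> down_sets f" for A
      proof (cases "A = {}")
        case True
        then show ?thesis
          by (simp add: plus_part_gen linear_0 [OF linear_natural_growth(2)] linear_0 [OF lT]
              linear_0 [OF linear_split_sum] bilinear_tensor bt)
      next
        case False
        then have "P (?w A) \<in> primitives"
          using less [OF weight_restrict_less(1) [OF A]]
          by (intro primitivesI) (simp_all add: P_def prim_part_in_hopf_plus)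
        then show ?thesis
          unfolding t_def by (rule split_sum_growth_primitive [OF _ bilinear_tensor])
      qed
      have "split_sum (\<lambda>u w. tensor (natural_growth (plus_part u) (P w)) (hone :: 'a hopf)) (gen f) =
        tensor (plus_part (gen f) - P (gen f)) hone"
      proof -
        have "split_sum (\<lambda>u w. natural_growth (plus_part u) (P w)) (gen f) = plus_part (gen f) - P (gen f)"
          using prim_part_eq [of "gen f"] by (simp add: P_def)
        then show ?thesis
          using linear_split_sum_image [OF lT bilinear_plus_growth [OF lP], of "gen f"] by simp
      qed
      moreover have "split_sum (\<lambda>a w. split_sum (\<lambda>u v. t u v w) (plus_part a)) (gen f) =
        split_sum tensor (gen f) - tensor (gen f) hone - tensor hone (P (gen f))"
      proof -
        have T: "split_sum (t u) x = tensor u (plus_part x)" for u x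
        proof -
          have "linear (tensor u :: 'a hopf \<Rightarrow> _)"
            using linear_comp_right [OF bilinear_tensor linear_id_fun] .
          from linear_split_sum_image [OF this bilinear_growth_prim, of x, symmetric]
          show ?thesis by (simp add: t_def [abs_def] P_def growth_prim_part_decomposition)
        qed
        have "split_sum (\<lambda>a w. split_sum (\<lambda>u v. t u v w) (plus_part a)) (gen f) =
          split_sum (\<lambda>a w. split_sum (\<lambda>u v. t u v w) a) (gen f) - split_sum (\<lambda>u v. t u v (gen f)) hone"
          by (rule split_sum_plus_left [OF bs])
        also have "split_sum (\<lambda>u v. t u v (gen f)) hone = tensor (hone :: 'a hopf) (P (gen f))"
          unfolding split_sum_hone [OF bt(1)] by (simp add: t_def natural_growth_hone_left)
        also have "split_sum (\<lambda>a w. split_sum (\<lambda>u v. t u v w) a) (gen f) =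
          split_sum (\<lambda>u x. split_sum (t u) x) (gen f)"
          by (rule split_sum_coassoc [OF tri])
        also have "\<dots> = split_sum (\<lambda>u x. tensor u (plus_part x)) (gen f)"
          by (simp only: T)
        also have "split_sum (\<lambda>u x. tensor u (plus_part x)) (gen f) =
          split_sum tensor (gen f) - tensor (gen f) hone"
          by (rule split_sum_plus_right [OF bilinear_tensor])
        finally show ?thesis .
      qed
      moreover have "split_sum tensor (P (gen f)) = split_sum tensor (gen f) -
        (split_sum (\<lambda>u w. tensor (natural_growth (plus_part u) (P w)) (hone :: 'a hopf)) (gen f) +
         split_sum (\<lambda>a w. split_sum (\<lambda>u v. t u v w) (plus_part a)) (gen f))"
      proof -
        have b1: "bilinear (\<lambda>u w. tensor (natural_growth (plus_part u) (P w)) (hone :: 'a hopf))"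
          by (rule bilinear_compose_linear [OF lT bilinear_plus_growth [OF lP]])
        have b2: "bilinear (\<lambda>a w. split_sum (\<lambda>u v. t u v w) (plus_part a))"
          by (rule bilinear_comp [OF bs linear_plus_part linear_id_fun])
        have "P (gen f) = gen f - (\<Sum>A\<in>down_sets f. natural_growth (?u A) (P (?w A)))"
          using False unfolding P_def
          by (subst prim_part_eq)
            (simp add: plus_part_gen split_sum_gen [OF bilinear_plus_growth [OF linear_prim_part]])
        then show ?thesis
          by (simp add: linear_diff linear_sum linear_split_sum [OF bilinear_tensor] step
              split_sum_gen [OF b1] split_sum_gen [OF b2] sum.distrib)
      qed
      ultimately show ?thesis
        using False by (simp add: plus_part_gen linear_diff [OF lT])
    qed
  qed
  then have "split_sum tensor (P x) = tensor (P x) hone + tensor hone (P x)"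
    by (rule linear_eq_on_gen [OF linear_compose [OF lP linear_split_sum [OF bilinear_tensor], unfolded o_def]
          linear_compose_add [OF linear_comp_left [OF bilinear_tensor lP]
            linear_comp_right [OF bilinear_tensor lP]]])
  then show ?thesis
    by (intro primitivesI) (simp_all add: P_def prim_part_in_hopf_plus)
qed

lemma primitive_hopf_plus: "p \<in> primitives \<Longrightarrow> p \<in> hopf_plus"
  by (simp add: primitives_def)

lemma prim_part_id: "p \<in> primitives \<Longrightarrow> prim_part p = p"
proof -
  assume p: "p \<in> primitives"
  have "split_sum (\<lambda>u v. natural_growth (plus_part u) (prim_part v)) p = 0"
    using primitiveD [OF p bilinear_plus_growth [OF linear_prim_part]]
    by (simp add: linear_0 [OF linear_natural_growth(1)] linear_0 [OF linear_natural_growth(2)])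
  then show ?thesis
    using plus_part_id [OF primitive_hopf_plus [OF p]] by (subst prim_part_eq) simp
qed

text \<open>
  In the recursion for \<open>y \<top> p\<close> the cuts have right parts \<open>y'' \<top> p\<close>. By induction on the weight
  of \<open>y\<close> only the one with \<open>y'' = 1\<close> contributes, and its contribution cancels the leading term \<open>y \<top> p\<close>.
\<close>

lemma prim_part_growth:
  assumes y: "y \<in> hopf_plus" and p: "p \<in> primitives"
  shows "prim_part (natural_growth y p) = 0"
proof -
  let ?b = "\<lambda>u v. natural_growth (plus_part u) (prim_part v)"
  have b: "bilinear ?b" by (rule bilinear_plus_growth [OF linear_prim_part])
  have pp: "natural_growth z p \<in> hopf_plus" for z
    by (intro natural_growth_hopf_plus primitive_hopf_plus p)
  have "prim_part (natural_growth (gen f) p) = 0" if "verts f \<noteq> {}" for f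
    using that
  proof (induction "weight f" arbitrary: f rule: less_induct)
    case (less f)
    let ?c = "\<lambda>u v. natural_growth (plus_part u) (prim_part (natural_growth v p))"
    have c: "bilinear ?c"
      by (rule bilinear_comp [OF bilinear_natural_growth linear_plus_part
            linear_compose [OF linear_natural_growth(2) linear_prim_part, unfolded o_def]])
    have "?c (pruned f A) (trunk f A) =
      (if A = verts f then natural_growth (gen f) p else 0)" if A: "A \<in> down_sets f" for A
    proof -
      consider "A = {}" | "A = verts f" "A \<noteq> {}" | "A \<noteq> {}" "A \<noteq> verts f" by blast
      then show ?thesis
      proof cases
        case 1
        then show ?thesis using less.prems
          by (simp add: plus_part_gen linear_0 [OF linear_natural_growth(2)])
      next
        case 2
        then have "trunk f A = hone" by (intro gen_empty) simp
        with 2 show ?thesis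
          by (simp add: restrict_verts plus_part_gen natural_growth_hone_left prim_part_id [OF p])
      next
        case 3
        have "verts (restrict_forest f (verts f - A)) \<noteq> {}"
          using 3 down_setD(1) [OF A] by auto
        then have "prim_part (natural_growth (trunk f A) p) = 0"
          using less.hyps weight_restrict_less(1) [OF A 3(1)] by blast
        with 3 show ?thesis by (simp add: linear_0 [OF linear_natural_growth(1)])
      qed
    qed
    then have "split_sum ?c (gen f) = natural_growth (gen f) p"
      by (simp add: split_sum_gen [OF c] sum.delta)
    then have "split_sum ?b (natural_growth (gen f) p) = natural_growth (gen f) p"
      using split_sum_growth_primitive [OF p b, of "gen f"]
      by (simp add: linear_0 [OF linear_natural_growth(1)])
    then show ?case
      by (subst prim_part_eq) (simp add: plus_part_id [OF pp])
  qed
  then show ?thesis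
    by (intro hopf_plus_induct [OF y linear_compose [OF linear_natural_growth(2) linear_prim_part, unfolded o_def]
          linear_zero])
qed

subsection \<open>Growth words\<close>

lemma growth_word_Nil [simp]: "growth_word [] = hone"
  by (simp add: growth_word_def)

lemma growth_word_snoc [simp]: "growth_word (ps @ [p]) = natural_growth (growth_word ps) p"
  by (simp add: growth_word_def)

lemma growth_word_single [simp]: "growth_word [p] = p"
  by (simp add: growth_word_def natural_growth_hone_left)

lemma growth_word_hopf_plus:
  assumes "ps \<noteq> []" "set ps \<subseteq> primitives" shows "growth_word ps \<in> hopf_plus"
  using assms by (cases ps rule: rev_cases) (auto intro: natural_growth_hopf_plus primitive_hopf_plus)

lemma prim_part_growth_word:
  assumes "set ps \<subseteq> primitives"
  shows "prim_part (growth_word ps) = (case ps of [p] \<Rightarrow> p | _ \<Rightarrow> 0)"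
proof (cases ps rule: rev_cases)
  case Nil
  then show ?thesis by simp
next
  case (snoc qs q)
  show ?thesis
  proof (cases "qs = []")
    case True
    then show ?thesis using snoc assms by (simp add: prim_part_id)
  next
    case False
    then have "prim_part (growth_word ps) = 0"
      using snoc assms by (simp add: prim_part_growth growth_word_hopf_plus)
    then show ?thesis using snoc False by (cases qs) (simp_all split: list.split)
  qed
qed

lemma prim_part_deg: "x \<in> hopf_deg n \<Longrightarrow> prim_part x \<in> hopf_deg n"
proof -
  have "prim_part (gen f) \<in> hopf_deg (weight f)" for f :: "'a forest"
  proof (induction "weight f" arbitrary: f rule: less_induct)
    case (less f)
    have sub: "subspace (hopf_deg n :: 'a hopf set)" for n by (simp add: hopf_deg_def)
    have "natural_growth (plus_part (pruned f A))
      (prim_part (trunk f A)) \<in> hopf_deg (weight f)" if A: "A \<in> down_sets f" for A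
    proof (cases "A = {}")
      case True
      then show ?thesis
        by (simp add: plus_part_gen linear_0 [OF linear_natural_growth(2)] subspace_0 [OF sub])
    next
      case False
      then have "natural_growth (pruned f A)
        (prim_part (trunk f A)) \<in> hopf_deg (weight f)"
        using natural_growth_deg [OF gen_in_hopf_deg less [OF weight_restrict_less(1) [OF A False]], of "restrict_forest f A"]
        by (simp add: weight_restrict_complement [OF A])
      then show ?thesis using False restrict_empty_iff [OF down_setD(1) [OF A]] by (simp add: plus_part_gen)
    qed
    moreover have "plus_part (gen f) \<in> hopf_deg (weight f)"
      by (auto simp: plus_part_gen subspace_0 [OF sub] gen_in_hopf_deg)
    ultimately show ?case
      by (subst prim_part_eq)
        (simp add: split_sum_gen bilinear_plus_growth linear_prim_part subspace_diff [OF sub] subspace_sum [OF sub])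
  qed
  then show "x \<in> hopf_deg n \<Longrightarrow> prim_part x \<in> hopf_deg n"
    unfolding hopf_deg_def by (elim linear_preserves_span [OF linear_prim_part]) (auto simp: hopf_deg_def)
qed

text \<open>
  Words of homogeneous primitive elements with their total degree. Homogeneity is what relates the
  truncation of a rough path to the entries of the word.
\<close>

inductive graded_word :: "'u::real_vector hopf list \<Rightarrow> nat \<Rightarrow> bool" where
  Nil: "graded_word [] 0"
| snoc: "graded_word ps m \<Longrightarrow> p \<in> primitives \<Longrightarrow> p \<in> hopf_deg n \<Longrightarrow> graded_word (ps @ [p]) (m + n)"

lemma graded_word_primitives: "graded_word ps n \<Longrightarrow> set ps \<subseteq> primitives"
  by (induction rule: graded_word.induct) auto

lemma hone_deg: "hone \<in> hopf_deg 0"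
  using gen_in_hopf_deg [of "dots []"] by (simp add: hone_def)

text \<open>
  Iterate the decomposition: the left factors of the reduced cuts have smaller weight.
\<close>

theorem gen_in_span_growth_words: "gen f \<in> span {growth_word ps | ps. graded_word ps (weight f)}"
proof (induction "weight f" arbitrary: f rule: less_induct)
  case (less f)
  show ?case
  proof (cases "verts f = {}")
    case True
    then have "gen f = growth_word []" "weight f = 0" by (simp_all add: gen_empty weight_0_iff)
    then show ?thesis using graded_word.Nil by (intro span_base) fastforce
  next
    case False
    have "natural_growth (pruned f A) (prim_part (trunk f A))
      \<in> span {growth_word ps | ps. graded_word ps (weight f)}" if A: "A \<in> down_sets f" for A
    proof (cases "A = verts f")
      case True
      then have "trunk f A = hone" by (intro gen_empty) simp
      then show ?thesis by (simp add: linear_0 [OF linear_natural_growth(1)] span_zero)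
    next
      case False
      let ?p = "prim_part (trunk f A)"
      have "pruned f A \<in> span {growth_word ps | ps. graded_word ps (weight (restrict_forest f A))}"
        by (rule less [OF weight_restrict_less(2) [OF A False]])
      then show ?thesis
      proof (rule linear_preserves_span [OF linear_natural_growth(2)])
        fix y :: "'a hopf"
        assume "y \<in> {growth_word ps | ps. graded_word ps (weight (restrict_forest f A))}"
        then obtain ps where ps: "y = growth_word ps" "graded_word ps (weight (restrict_forest f A))" by blast
        have "graded_word (ps @ [?p]) (weight f)"
          using graded_word.snoc [OF ps(2) prim_part_primitive prim_part_deg [OF gen_in_hopf_deg]]
            weight_restrict_complement [OF A] by metis
        then show "natural_growth y ?p \<in> span {growth_word ps | ps. graded_word ps (weight f)}"
          by (intro span_base CollectI exI [of _ "ps @ [?p]"]) (simp add: ps(1))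
      qed
    qed
    then have "split_sum (\<lambda>u v. natural_growth u (prim_part v)) (gen f)
      \<in> span {growth_word ps | ps. graded_word ps (weight f)}"
      unfolding split_sum_gen [OF bilinear_growth_prim] by (intro span_sum)
    then show ?thesis using False by (simp add: growth_prim_part_decomposition plus_part_gen)
  qed
qed

lemma linear_eq_on_growth_words:
  assumes "linear F" "linear G" "\<And>ps n. graded_word ps n \<Longrightarrow> F (growth_word ps) = G (growth_word ps)"
  shows "F x = G x"
proof (rule linear_eq_on_gen [OF assms(1,2)])
  show "F (gen f) = G (gen f)" for f
    by (rule linear_eq_on_span [OF assms(1,2) _ gen_in_span_growth_words]) (use assms(3) in auto)
qed

theorem prim_proj_eq: "prim_proj = prim_part"
  unfolding prim_proj_def
proof (rule the_equality)
  show "linear prim_part \<and> (\<forall>ps. set ps \<subseteq> primitives \<longrightarrow>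
     prim_part (growth_word ps) = (case ps of [p] \<Rightarrow> p | _ \<Rightarrow> 0))"
    using linear_prim_part prim_part_growth_word by blast
  fix g :: "'a hopf \<Rightarrow> 'a hopf"
  assume g: "linear g \<and> (\<forall>ps. set ps \<subseteq> primitives \<longrightarrow>
     g (growth_word ps) = (case ps of [p] \<Rightarrow> p | _ \<Rightarrow> 0))"
  show "g = prim_part"
  proof
    fix x
    show "g x = prim_part x"
    proof (rule linear_eq_on_growth_words [where F = g, OF _ linear_prim_part])
      show "linear g" using g by blast
      fix ps :: "'a hopf list" and n assume "graded_word ps n"
      then have "set ps \<subseteq> primitives" by (rule graded_word_primitives)
      then show "g (growth_word ps) = prim_part (growth_word ps)"
        using g prim_part_growth_word [of ps] by simp
    qed
  qed
qed

section \<open>Words and quasi-shuffles\<close>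

lemma relations_list_add:
  "Poly_Mapping.single (u @ (a + b) # v) 1 - Poly_Mapping.single (u @ a # v) 1
     - Poly_Mapping.single (u @ b # v) 1 \<in> (relations :: ('w::real_vector list \<Rightarrow>\<^sub>0 real) set)"
  unfolding relations_list_def by (rule UnI1, intro CollectI exI conjI, rule refl, rule TrueI)

lemma relations_list_scale:
  "Poly_Mapping.single (u @ (c *\<^sub>R a) # v) 1 - c *\<^sub>R Poly_Mapping.single (u @ a # v) 1
     \<in> (relations :: ('w::real_vector list \<Rightarrow>\<^sub>0 real) set)"
  unfolding relations_list_def by (rule UnI2, intro CollectI exI conjI, rule refl, rule TrueI)

lemma descends_listI:
  fixes \<phi> :: "'w::real_vector list \<Rightarrow> 'x::real_vector"
  assumes "\<And>u v. linear (\<lambda>a. \<phi> (u @ a # v))"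
  shows "descends \<phi>"
proof -
  have 1: "free_ext \<phi> (Poly_Mapping.single (u @ (a + b) # v) 1 - Poly_Mapping.single (u @ a # v) 1
     - Poly_Mapping.single (u @ b # v) 1) = 0" for u v a b
    unfolding free_ext_diff free_ext_single linear_add [OF assms] by simp
  have 2: "free_ext \<phi> (Poly_Mapping.single (u @ (c *\<^sub>R a) # v) 1
     - c *\<^sub>R Poly_Mapping.single (u @ a # v) 1) = 0" for u v a c
    unfolding free_ext_diff free_ext_scaleR free_ext_single linear_scale [OF assms] by simp
  show ?thesis
    unfolding descends_def relations_list_def
    by (intro ballI, elim UnE CollectE exE conjE) (hypsubst, rule 1 2)+
qed

lemma linear_gen_letter: "linear (\<lambda>a. gen (u @ a # v))"
proof (rule linearI)
  have d: "descends (gen :: 'a list \<Rightarrow> _)" using descends_linear [OF linear_id_fun] .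
  have 1: "free_ext gen r = 0" if "r \<in> relations" for r :: "'a list \<Rightarrow>\<^sub>0 real"
    using d that unfolding descends_def by (rule bspec)
  show "gen (u @ (a + b) # v) = gen (u @ a # v) + gen (u @ b # v)" for a b
    using 1 [OF relations_list_add [of u a b v]]
    unfolding free_ext_diff free_ext_single by (simp add: diff_diff_eq)
  show "gen (u @ (c *\<^sub>R a) # v) = c *\<^sub>R gen (u @ a # v)" for c a
    using 1 [OF relations_list_scale [of u c a v]]
    unfolding free_ext_diff free_ext_scaleR free_ext_single by simp
qed

lemma linear_gen_last: "linear (\<lambda>a. gen (u @ [a]))"
  using linear_gen_letter [of u "[]"] .

lemma descends_snoc: "descends (\<lambda>w. gen (w @ [a]))"
  by (rule descends_listI) (simp add: linear_gen_letter)

lemma snoc_gen: "snoc (gen w) a = gen (w @ [a])"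
  by (simp add: snoc_def linext [OF descends_snoc])

lemma linear_snoc_left: "linear (\<lambda>x. snoc x a)"
  unfolding snoc_def by (rule linext [OF descends_snoc])

lemma bilinear_snoc: "bilinear snoc"
proof -
  have "snoc x (a + b) = snoc x a + snoc x b" for x and a b :: 'a
    by (rule linear_eq_on_gen [where F = "\<lambda>x. snoc x (a + b)", OF linear_snoc_left
          linear_compose_add [OF linear_snoc_left linear_snoc_left]])
      (simp add: snoc_gen linear_add [OF linear_gen_last])
  moreover have "snoc x (c *\<^sub>R a) = c *\<^sub>R snoc x a" for x c and a :: 'a
    by (rule linear_eq_on_gen [where F = "\<lambda>x. snoc x (c *\<^sub>R a)", OF linear_snoc_left
          linear_compose_scale_right [OF linear_snoc_left]])
      (simp add: snoc_gen linear_scale [OF linear_gen_last])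
  ultimately show ?thesis by (auto simp: bilinear_def linear_snoc_left intro!: linearI)
qed

lemma linear_snoc_right: "linear (snoc x)"
  by (rule bilinear_snoc [unfolded bilinear_def, THEN conjunct1, rule_format])

lemma snoc_0 [simp]: "snoc x 0 = 0" "snoc 0 a = 0"
  by (simp_all add: linear_0 [OF linear_snoc_left] linear_0 [OF linear_snoc_right])

text \<open>
  The analogue of \<open>split_sum\<close> for deconcatenation.
\<close>

definition cut_sum :: "('w::real_vector list pvec \<Rightarrow> 'w list pvec \<Rightarrow> 'x::real_vector) \<Rightarrow> 'w list pvec \<Rightarrow> 'x" where
  "cut_sum \<beta> = linext (\<lambda>w. \<Sum>i\<le>length w. \<beta> (gen (take i w)) (gen (drop i w)))"

lemma descends_cut_sum:
  assumes "bilinear \<beta>"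
  shows "descends (\<lambda>w. \<Sum>i\<le>length w. \<beta> (gen (take i w)) (gen (drop i w)))"
proof (rule descends_listI)
  fix u v
  have *: "linear (\<lambda>a. \<beta> (gen (take i (u @ a # v))) (gen (drop i (u @ a # v))))" for i
  proof (cases "i \<le> length u")
    case True
    then show ?thesis by (simp add: linear_comp_right [OF assms linear_gen_letter])
  next
    case False
    then obtain k where "i - length u = Suc k" by (metis Suc_diff_Suc not_le)
    with False show ?thesis by (simp add: linear_comp_left [OF assms linear_gen_letter])
  qed
  show "linear (\<lambda>a. \<Sum>i\<le>length (u @ a # v). \<beta> (gen (take i (u @ a # v))) (gen (drop i (u @ a # v))))"
    unfolding length_append list.size by (intro linear_compose_sum ballI *)
qed

lemma linear_cut_sum: "bilinear \<beta> \<Longrightarrow> linear (cut_sum \<beta>)"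
  and cut_sum_gen: "bilinear \<beta> \<Longrightarrow> cut_sum \<beta> (gen w) = (\<Sum>i\<le>length w. \<beta> (gen (take i w)) (gen (drop i w)))"
  unfolding cut_sum_def by (rule linext [OF descends_cut_sum], assumption)+

lemma linext_deconcat:
  assumes "bilinear \<beta>"
  shows "linext (\<lambda>(a, b). \<beta> (gen a) (gen b)) (deconcat x) = cut_sum \<beta> x"
proof -
  have d: "deconcat = cut_sum tensor" by (simp add: deconcat_def cut_sum_def tensor_gen)
  note l = tensor_universal(1) [OF assms]
  show ?thesis
    unfolding d
  proof (rule linear_eq_on_gen [where F = "\<lambda>x. linext (\<lambda>(a, b). \<beta> (gen a) (gen b)) (cut_sum tensor x)"])
    show "linear (\<lambda>x. linext (\<lambda>(a, b). \<beta> (gen a) (gen b)) (cut_sum tensor x))"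
      using linear_compose [OF linear_cut_sum [OF bilinear_tensor] l] by (simp add: o_def)
  qed (simp_all add: linear_cut_sum assms cut_sum_gen bilinear_tensor linear_sum [OF l] tensor_universal)
qed

lemma cut_sum_nil: "bilinear \<beta> \<Longrightarrow> cut_sum \<beta> (gen []) = \<beta> (gen []) (gen [])"
  by (simp add: cut_sum_gen)

lemma cut_sum_snoc:
  assumes "bilinear \<beta>"
  shows "cut_sum \<beta> (snoc x a) = \<beta> (snoc x a) (gen []) + cut_sum (\<lambda>u v. \<beta> u (snoc v a)) x"
proof (rule linear_eq_on_gen [where F = "\<lambda>x. cut_sum \<beta> (snoc x a)"])
  have b: "bilinear (\<lambda>u v. \<beta> u (snoc v a))"
    by (rule bilinear_comp [OF assms linear_id_fun linear_snoc_left])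
  show "linear (\<lambda>x. cut_sum \<beta> (snoc x a))"
    using linear_compose [OF linear_snoc_left linear_cut_sum [OF assms]] by (simp add: o_def)
  show "linear (\<lambda>x. \<beta> (snoc x a) (gen []) + cut_sum (\<lambda>u v. \<beta> u (snoc v a)) x)"
    by (intro linear_compose_add linear_comp_left [OF assms linear_snoc_left] linear_cut_sum b)
  show "cut_sum \<beta> (snoc (gen w) a) = \<beta> (snoc (gen w) a) (gen []) + cut_sum (\<lambda>u v. \<beta> u (snoc v a)) (gen w)" for w
    by (simp add: snoc_gen cut_sum_gen assms b)
qed

text \<open>
  The quasi-shuffle product for an arbitrary product \<open>m\<close> of letters. With \<open>m = 0\<close> this is the
  shuffle product, so that both arborification maps are instances of one construction.
\<close>

fun quasi_rev :: "('w::real_vector \<Rightarrow> 'w \<Rightarrow> 'w) \<Rightarrow> 'w list \<Rightarrow> 'w list \<Rightarrow> 'w list pvec" where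
  "quasi_rev m [] v = gen (rev v)"
| "quasi_rev m w [] = gen (rev w)"
| "quasi_rev m (a # w) (b # v) =
     snoc (quasi_rev m w (b # v)) a + snoc (quasi_rev m (a # w) v) b + snoc (quasi_rev m w v) (m a b)"

definition quasi :: "('w::real_vector \<Rightarrow> 'w \<Rightarrow> 'w) \<Rightarrow> 'w list pvec \<Rightarrow> 'w list pvec \<Rightarrow> 'w list pvec" where
  "quasi m = bilinext (\<lambda>w v. quasi_rev m (rev w) (rev v))"

lemma shuffle_eq_quasi: "shuffle = quasi (\<lambda>_ _. 0)"
proof -
  have "shuffle_rev w v = quasi_rev (\<lambda>_ _. 0) w v" for w v :: "'a list"
    by (induction w v rule: shuffle_rev.induct) simp_all
  then show ?thesis by (simp add: shuffle_def quasi_def)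
qed

lemma qshuffle_eq_quasi: "qshuffle = quasi sym_mult"
proof -
  have "qshuffle_rev w v = quasi_rev sym_mult w v" for w v :: "'a sym list"
    by (induction w v rule: qshuffle_rev.induct) simp_all
  then show ?thesis by (simp add: qshuffle_def quasi_def)
qed

lemma quasi_rev_Nil2: "quasi_rev m w [] = gen (rev w)"
  by (cases w) simp_all

lemma quasi_rev_swap: "quasi_rev m w v = quasi_rev (\<lambda>a b. m b a) v w"
  by (induction m w v rule: quasi_rev.induct) (simp_all add: quasi_rev_Nil2 add.commute)

lemma linear_gen_rev_letter: "linear (\<lambda>a. gen (rev (u @ a # v)))"
  by (simp add: linear_gen_letter)

lemma linear_quasi_rev:
  assumes m: "bilinear m"
  shows "linear (\<lambda>a. quasi_rev m (u @ a # v) w)"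
proof (induction w arbitrary: u)
  case Nil
  then show ?case unfolding quasi_rev_Nil2 by (rule linear_gen_rev_letter)
next
  case outer: (Cons b w)
  show ?case
  proof (induction u)
    case Nil
    have "linear (\<lambda>a. m a b)" using m by (simp add: bilinear_def)
    then show ?case
      using outer [of "[]"]
      by (auto intro!: linear_compose_add linear_snoc_right linear_comp_left [OF bilinear_snoc]
          linear_comp_right [OF bilinear_snoc])
  next
    case (Cons c u)
    then show ?case
      using outer [of u] outer [of "c # u"]
      by (auto intro!: linear_compose_add linear_comp_left [OF bilinear_snoc])
  qed
qed

lemma bilinear_flip: "bilinear m \<Longrightarrow> bilinear (\<lambda>a b. m b a)"
  by (simp add: bilinear_def)

lemma descends_quasi:
  assumes "bilinear m"
  shows "descends (\<lambda>v. quasi_rev m (rev w) (rev v))" "descends (\<lambda>w. quasi_rev m (rev w) (rev v))"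
proof -
  show "descends (\<lambda>w. quasi_rev m (rev w) (rev v))"
    by (rule descends_listI) (simp add: linear_quasi_rev assms)
  show "descends (\<lambda>v. quasi_rev m (rev w) (rev v))"
    unfolding quasi_rev_swap [of m]
    by (rule descends_listI) (simp add: linear_quasi_rev bilinear_flip assms)
qed

lemma bilinear_quasi: "bilinear m \<Longrightarrow> bilinear (quasi m)"
  and quasi_gen: "bilinear m \<Longrightarrow> quasi m (gen w) (gen v) = quasi_rev m (rev w) (rev v)"
  unfolding quasi_def by (rule bilinext [OF descends_quasi], assumption+)+

lemma linear_quasi: "bilinear m \<Longrightarrow> linear (quasi m x)" "bilinear m \<Longrightarrow> linear (\<lambda>x. quasi m x y)"
  using bilinear_quasi [of m] by (simp_all add: bilinear_def [of "quasi m"])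

lemma quasi_nil_left:
  assumes "bilinear m" shows "quasi m (gen []) y = y"
  by (rule linear_eq_on_gen [where F = "quasi m (gen [])"])
    (simp_all add: linear_quasi linear_id_fun quasi_gen assms)

lemma quasi_nil_right:
  assumes "bilinear m" shows "quasi m x (gen []) = x"
  by (rule linear_eq_on_gen [where F = "\<lambda>x. quasi m x (gen [])"])
    (simp_all add: linear_quasi linear_id_fun quasi_gen assms quasi_rev_Nil2)

text \<open>
  The defining recursion, extended from words to arbitrary elements.
\<close>

lemma quasi_snoc:
  assumes m: "bilinear m"
  shows "quasi m (snoc x a) (snoc y b) =
    snoc (quasi m x (snoc y b)) a + snoc (quasi m (snoc x a) y) b + snoc (quasi m x y) (m a b)"
proof (rule bilinear_eq_on_gen [where \<beta> = "\<lambda>x y. quasi m (snoc x a) (snoc y b)"])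
  note q = bilinear_quasi [OF m]
  show "bilinear (\<lambda>x y. quasi m (snoc x a) (snoc y b))"
    by (intro bilinear_comp [OF q] linear_snoc_left)
  show "bilinear (\<lambda>x y. snoc (quasi m x (snoc y b)) a + snoc (quasi m (snoc x a) y) b + snoc (quasi m x y) (m a b))"
    by (intro bilinear_add bilinear_compose_linear [OF linear_snoc_left]
        bilinear_comp [OF q linear_id_fun linear_snoc_left]
        bilinear_comp [OF q linear_snoc_left linear_id_fun] q)
qed (simp add: snoc_gen quasi_gen m)

section \<open>Generating the algebra by grafting onto a new root\<close>

lemma add_root_relabel: "add_root \<gamma> (relabel f v a) = relabel (add_root \<gamma> f) (Suc v) a"
  by (rule forest_eqI) (auto simp: parent_add_root fun_eq_iff split: nat.split cong: if_cong option.case_cong nat.case_cong)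

lemma iso_via_add_root:
  assumes "iso_via b f g"
  shows "iso_via (case_nat 0 (\<lambda>v. Suc (b v))) (add_root \<gamma> f) (add_root \<gamma> g)" (is "iso_via ?d _ _")
proof (rule iso_viaI)
  have bij: "bij_betw b (verts f) (verts g)" using assms by (rule iso_via_bij)
  then have im: "verts g = b ` verts f" and inj: "inj_on b (verts f)" by (simp_all add: bij_betw_def)
  show "bij_betw ?d (verts (add_root \<gamma> f)) (verts (add_root \<gamma> g))"
    unfolding bij_betw_def
  proof
    show "inj_on ?d (verts (add_root \<gamma> f))" using inj by (auto simp: inj_on_def)
    show "?d ` verts (add_root \<gamma> f) = verts (add_root \<gamma> g)" by (simp add: im image_image)
  qed
  fix v assume "v \<in> verts (add_root \<gamma> f)"
  then consider "v = 0" | w where "v = Suc w" "w \<in> verts f" by auto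
  then have "parent (add_root \<gamma> g) (?d v) = map_option ?d (parent (add_root \<gamma> f) v) \<and>
    label (add_root \<gamma> g) (?d v) = label (add_root \<gamma> f) v"
  proof cases
    case 2
    then have "parent g (b w) = map_option b (parent f w)" "label g (b w) = label f w" "b w \<in> verts g"
      using assms bij by (auto simp: iso_via_def shape_map_def bij_betw_apply)
    then show ?thesis using 2 by (cases "parent f w") (auto simp: parent_add_root)
  qed (simp add: parent_add_root)
  then show "parent (add_root \<gamma> g) (?d v) = map_option ?d (parent (add_root \<gamma> f) v)"
    "label (add_root \<gamma> g) (?d v) = label (add_root \<gamma> f) v" by auto
qed

lemma descends_add_root: "descends (\<lambda>f. gen (add_root \<gamma> f))"
  by (rule descends_forestI, rule gen_iso [OF iso_via_add_root], assumption)
    (simp add: add_root_relabel linear_gen_relabel)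

lemma linear_Bplus: "linear (Bplus \<gamma>)" and Bplus_gen: "Bplus \<gamma> (gen f) = gen (add_root \<gamma> f)"
  unfolding Bplus_def by (rule linext [OF descends_add_root])+

text \<open>
  A set of vertices that is closed under descendants and under ancestors splits off as a factor.
\<close>

lemma gen_eq_hmult:
  assumes A: "A \<in> down_sets f" "verts f - A \<in> down_sets f"
  shows "gen f = hmult (pruned f A) (trunk f A)"
  unfolding hmult_gen
proof (rule gen_iso [where b = "\<lambda>v. if v \<in> A then 2 * v else Suc (2 * v)"], rule iso_viaI)
  let ?b = "\<lambda>v. if v \<in> A then 2 * v else Suc (2 * v)"
  let ?G = "graft (\<lambda>_. None) (restrict_forest f A) (restrict_forest f (verts f - A))"
  have Af: "A \<subseteq> verts f" using A by (auto dest: down_setD)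
  show "bij_betw ?b (verts f) (verts ?G)"
    unfolding bij_betw_def
  proof
    show "inj_on ?b (verts f)" by (auto simp: inj_on_def dest: arg_cong [where f = even])
    have im: "?b ` A = (\<lambda>v. 2 * v) ` A" "?b ` (verts f - A) = (\<lambda>v. 2 * v + 1) ` (verts f - A)"
      by (rule image_cong; simp)+
    have V: "A \<union> (verts f - A) = verts f" "verts f \<inter> A = A" "verts f \<inter> (verts f - A) = verts f - A"
      using Af by auto
    show "?b ` verts f = verts ?G"
      unfolding verts_simps V(2,3) im [symmetric] by (simp only: image_Un [symmetric] V(1))
  qed
  fix v assume v: "v \<in> verts f"
  have stay: "w \<in> A \<longleftrightarrow> v \<in> A" "w \<in> verts f" if p: "parent f v = Some w" for w
  proof -
    show "w \<in> verts f" using p by (rule parent_in_verts)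
    show "w \<in> A \<longleftrightarrow> v \<in> A"
      using down_setD(2) [OF A(1) p] down_setD(2) [OF A(2) p] \<open>w \<in> verts f\<close> by blast
  qed
  show "parent ?G (?b v) = map_option ?b (parent f v)"
    using v stay by (cases "parent f v") (auto simp: parent_graft parent_restrict)
  show "label ?G (?b v) = label f v" by simp
qed

lemma gen_eq_Bplus:
  assumes r: "roots f = {r}"
  shows "gen f = Bplus (label f r) (gen (restrict_forest f (verts f - {r})))"
  unfolding Bplus_gen
proof (rule gen_iso [symmetric, where b = "case_nat r (\<lambda>v. v)"], rule iso_viaI)
  let ?b = "case_nat r (\<lambda>v. v)"
  let ?G = "add_root (label f r) (restrict_forest f (verts f - {r}))"
  have rf: "r \<in> verts f" "parent f r = None" using r by (auto simp: roots_def)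
  show "bij_betw ?b (verts ?G) (verts f)"
    unfolding bij_betw_def
  proof
    show "inj_on ?b (verts ?G)" by (auto simp: inj_on_def)
    show "?b ` verts ?G = verts f" using rf by (auto simp: image_image)
  qed
  fix v assume "v \<in> verts ?G"
  then consider "v = 0" | w where "v = Suc w" "w \<in> verts f" "w \<noteq> r" by auto
  then have "parent f (?b v) = map_option ?b (parent ?G v) \<and> label f (?b v) = label ?G v"
  proof cases
    case 2
    then have "w \<notin> roots f" using r by auto
    then obtain u where u: "parent f w = Some u" using 2 by (auto simp: roots_def)
    then have "u \<in> verts f" by (rule parent_in_verts)
    then show ?thesis using 2 u by (auto simp: parent_add_root parent_restrict)
  qed (simp add: parent_add_root rf)
  then show "parent f (?b v) = map_option ?b (parent ?G v)" "label f (?b v) = label ?G v" by auto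
qed

lemma roots_nonempty: "verts f \<noteq> {} \<Longrightarrow> roots f \<noteq> {}"
  using down_set_containing_roots [OF empty_down_set, of f] by auto

text \<open>
  The tree of the root \<open>r\<close> is such a set, and it does not contain any other root.
\<close>

lemma subtree_down_sets:
  fixes f :: "'u forest"
  assumes r: "r \<in> roots f" and r': "r' \<in> roots f" "r' \<noteq> r"
  obtains A where "A \<in> down_sets f" "verts f - A \<in> down_sets f" "r \<in> A" "r' \<notin> A"
proof
  let ?R = "{(v, w). parent f v = Some w}"
  let ?A = "{v \<in> verts f. (v, r) \<in> ?R\<^sup>*}"
  show "?A \<in> down_sets f"
    by (auto simp: down_sets_def intro: converse_rtrancl_into_rtrancl dest: parent_in_verts)
  have "v \<in> verts f - ?A" if p: "parent f v = Some w" and w: "w \<in> verts f - ?A" for v w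
  proof (rule ccontr)
    assume "v \<notin> verts f - ?A"
    then have "(v, r) \<in> ?R\<^sup>*" using parent_in_verts(1) [OF p] by auto
    moreover have "v \<noteq> r" using p r by (auto simp: roots_def)
    ultimately obtain w' where "(v, w') \<in> ?R" "(w', r) \<in> ?R\<^sup>*" by (auto elim: converse_rtranclE)
    then show False using p w by auto
  qed
  then show "verts f - ?A \<in> down_sets f" unfolding down_sets_def by blast
  show "r \<in> ?A" using r by (auto simp: roots_def)
  show "r' \<notin> ?A"
  proof
    assume "r' \<in> ?A"
    then have "(r', r) \<in> ?R\<^sup>*" by simp
    then show False using r' by (cases rule: converse_rtranclE) (auto simp: roots_def)
  qed
qed

text \<open>
  A forest with several roots is a product of smaller forests, and a tree is a smaller forest joined to
  its root. This gives the uniqueness of the arborification maps.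
\<close>

lemma hopf_induct:
  fixes E :: "'u::real_vector hopf set"
  assumes E: "subspace E" and "hone \<in> E" and mult: "\<And>x y. x \<in> E \<Longrightarrow> y \<in> E \<Longrightarrow> hmult x y \<in> E"
    and B: "\<And>\<gamma> x. x \<in> E \<Longrightarrow> Bplus \<gamma> x \<in> E"
  shows "x \<in> E"
proof -
  have "gen f \<in> E" for f :: "'u forest"
  proof (induction "weight f" arbitrary: f rule: less_induct)
    case (less f)
    show ?case
    proof (cases "verts f = {}")
      case True
      then show ?thesis using assms(2) by (simp add: gen_empty)
    next
      case False
      then obtain r where r: "r \<in> roots f" using roots_nonempty by blast
      then have rf: "r \<in> verts f" by (simp add: roots_def)
      show ?thesis
      proof (cases "roots f = {r}")
        case True
        have "weight (restrict_forest f (verts f - {r})) < weight f"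
          unfolding weight_def by (rule psubset_card_mono) (use rf in auto)
        then show ?thesis
          by (subst gen_eq_Bplus [OF True]) (intro B less)
      next
        case False
        then obtain r' where "r' \<in> roots f" "r' \<noteq> r" using r by blast
        then obtain A where A: "A \<in> down_sets f" "verts f - A \<in> down_sets f" "r \<in> A" "r' \<notin> A"
          using subtree_down_sets [OF r] by metis
        have "A \<noteq> verts f" "A \<noteq> {}" using A \<open>r' \<in> roots f\<close> by (auto simp: roots_def)
        then show ?thesis
          by (subst gen_eq_hmult [OF A(1,2)]) (intro mult less weight_restrict_less A)
      qed
    qed
  qed
  then have "range gen \<subseteq> E" by blast
  from span_minimal [OF this E] show ?thesis by (auto simp: span_gen)
qed

section \<open>Arborification maps\<close>

text \<open>
  The data \<open>lam\<close> is the length-one component of an arborification map. A word of length one must come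
  from removing all vertices at once, which is possible only without edges; then the letter
  is the product, with respect to \<open>m\<close>, of the images \<open>\<iota> \<gamma>\<close> of the labels.
\<close>

locale arborification =
  fixes lam :: "'u::real_vector forest \<Rightarrow> 'w::real_vector" and m :: "'w \<Rightarrow> 'w \<Rightarrow> 'w" and \<iota> :: "'u \<Rightarrow> 'w"
  assumes descends_lam: "descends lam"
    and lam_edge: "has_edge f \<Longrightarrow> lam f = 0"
    and lam_empty: "verts f = {} \<Longrightarrow> lam f = 0"
    and lam_mult: "verts f \<noteq> {} \<Longrightarrow> verts g \<noteq> {} \<Longrightarrow> lam (graft (\<lambda>_. None) f g) = m (lam f) (lam g)"
    and lam_dot: "lam (dots [\<gamma>]) = \<iota> \<gamma>"
    and bilinear_m: "bilinear m"
begin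

definition letter :: "'u hopf \<Rightarrow> 'w" where
  "letter = linext lam"

lemma linear_letter: "linear letter" and letter_gen: "letter (gen f) = lam f"
  unfolding letter_def by (rule linext [OF descends_lam])+

lemma letter_hone [simp]: "letter hone = 0"
  by (simp add: hone_def letter_gen lam_empty)

lemma has_edge_graft:
  assumes "verts f \<noteq> {}" "v \<in> verts g" shows "has_edge (graft (\<lambda>_. Some v) f g)"
proof -
  obtain r where "r \<in> roots f" using roots_nonempty [OF assms(1)] by blast
  then have "2 * r \<in> verts (graft (\<lambda>_. Some v) f g)" "parent (graft (\<lambda>_. Some v) f g) (2 * r) \<noteq> None"
    using assms(2) by (auto simp: roots_def parent_graft)
  then show ?thesis unfolding has_edge_def by blast
qed

text \<open>
  Every term of the growth of \<open>y\<close> onto \<open>z\<close> has an edge.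
\<close>

lemma letter_growth:
  assumes "y \<in> hopf_plus" "z \<in> hopf_plus" shows "letter (natural_growth y z) = 0"
proof -
  have "letter (natural_growth (gen f) (gen g)) = 0" if "verts f \<noteq> {}" "verts g \<noteq> {}" for f g
    using that by (simp add: natural_growth_gen graft_sum_gen linear_scale [OF linear_letter]
        linear_sum [OF linear_letter] letter_gen lam_edge has_edge_graft)
  then have "letter (natural_growth (gen f) z) = 0" if "verts f \<noteq> {}" for f
    using that by (intro hopf_plus_induct [OF assms(2)
          linear_compose [OF linear_natural_growth(1) linear_letter, unfolded o_def] linear_zero])
  then show ?thesis
    by (intro hopf_plus_induct [OF assms(1)
          linear_compose [OF linear_natural_growth(2) linear_letter, unfolded o_def] linear_zero])
qed

lemma bilinear_snoc_letter: "linear F \<Longrightarrow> bilinear (\<lambda>u v. snoc (F u) (letter v))"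
  by (rule bilinear_comp [OF bilinear_snoc _ linear_letter])

lemma arb_exists: "\<exists>F. linear F \<and>
  (\<forall>x. F x = counit x *\<^sub>R gen [] + split_sum (\<lambda>u v. snoc (F u) (letter v)) x)"
proof (rule weight_recursion)
  fix F :: "'u hopf \<Rightarrow> 'w list pvec" assume F: "linear F"
  show "linear (\<lambda>x. counit x *\<^sub>R gen [] + split_sum (\<lambda>u v. snoc (F u) (letter v)) x)"
    by (intro linear_compose_add linear_lscale linear_counit linear_split_sum bilinear_snoc_letter F)
  fix G :: "'u hopf \<Rightarrow> 'w list pvec" and f :: "'u forest"
  assume G: "linear G" and eq: "\<And>g. weight g < weight f \<Longrightarrow> F (gen g) = G (gen g)"
  have "snoc (F (pruned f A)) (letter (trunk f A)) =
    snoc (G (pruned f A)) (letter (trunk f A))"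
    if A: "A \<in> down_sets f" for A
  proof (cases "A = verts f")
    case True
    then show ?thesis by (simp add: letter_gen lam_empty)
  next
    case False
    then show ?thesis using eq weight_restrict_less(2) [OF A False] by simp
  qed
  then show "counit (gen f) *\<^sub>R gen [] + split_sum (\<lambda>u v. snoc (F u) (letter v)) (gen f) =
    counit (gen f) *\<^sub>R gen [] + split_sum (\<lambda>u v. snoc (G u) (letter v)) (gen f)"
    by (simp add: split_sum_gen bilinear_snoc_letter F G)
qed

text \<open>
  The coalgebra morphism with length-one component \<open>letter\<close>: words are produced by splitting off
  the last letter.
\<close>

definition arb :: "'u hopf \<Rightarrow> 'w list pvec" where
  "arb = (SOME F. linear F \<and>
    (\<forall>x. F x = counit x *\<^sub>R gen [] + split_sum (\<lambda>u v. snoc (F u) (letter v)) x))"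

lemma arb_spec: "linear arb \<and>
  (\<forall>x. arb x = counit x *\<^sub>R gen [] + split_sum (\<lambda>u v. snoc (arb u) (letter v)) x)"
  unfolding arb_def by (rule someI_ex [OF arb_exists])

lemmas linear_arb = arb_spec [THEN conjunct1]
  and arb_eq = arb_spec [THEN conjunct2, rule_format]

lemma bilinear_arb_letter: "bilinear (\<lambda>u v. snoc (arb u) (letter v))"
  by (rule bilinear_snoc_letter [OF linear_arb])

lemma arb_hone [simp]: "arb hone = gen []"
  by (subst arb_eq) (simp add: split_sum_hone bilinear_arb_letter)

text \<open>
  By the cocycle property the last letter comes either from \<open>v \<top> p\<close> with \<open>v\<close> non-empty, where it vanishes,
  or from \<open>p\<close> itself.
\<close>

lemma arb_growth:
  assumes p: "p \<in> primitives" shows "arb (natural_growth y p) = snoc (arb y) (letter p)"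
proof -
  have "letter (natural_growth v p) = counit v *\<^sub>R letter p" for v
  proof -
    have "natural_growth v p = natural_growth (plus_part v) p + counit v *\<^sub>R p"
      by (simp add: plus_part_def linear_diff [OF linear_natural_growth(2)]
          linear_scale [OF linear_natural_growth(2)] natural_growth_hone_left)
    then show ?thesis
      by (simp add: linear_add [OF linear_letter] linear_scale [OF linear_letter]
          letter_growth plus_part_in_hopf_plus primitive_hopf_plus p)
  qed
  then have "split_sum (\<lambda>u v. snoc (arb u) (letter (natural_growth v p))) y =
    split_sum (\<lambda>u v. counit v *\<^sub>R snoc (arb u) (letter p)) y"
    by (simp add: linear_scale [OF linear_snoc_right])
  also have "\<dots> = snoc (arb y) (letter p)"
    by (rule split_sum_counit_right [OF linear_comp_left [OF bilinear_snoc linear_arb]])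
  finally have "split_sum (\<lambda>u v. snoc (arb u) (letter (natural_growth v p))) y = snoc (arb y) (letter p)" .
  moreover have "counit (natural_growth y p) = 0"
    by (intro counit_hopf_plus natural_growth_hopf_plus primitive_hopf_plus p)
  ultimately show ?thesis
    by (subst arb_eq) (simp add: split_sum_growth_primitive [OF p bilinear_arb_letter])
qed

lemma arb_growth_word: "set ps \<subseteq> primitives \<Longrightarrow> arb (growth_word ps) = gen (map letter ps)"
  by (induction ps rule: rev_induct) (simp_all add: arb_growth snoc_gen)

text \<open>
  Compatibility with the coproducts. A cut of a word \<open>snoc w a\<close> is either trivial or a cut of \<open>w\<close>, which
  by induction comes from a cut of a smaller forest; coassociativity regroups the nested cuts.
\<close>

theorem cut_sum_arb:
  fixes \<beta> :: "'w list pvec \<Rightarrow> 'w list pvec \<Rightarrow> 'x::real_vector"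
  assumes \<beta>: "bilinear \<beta>"
  shows "cut_sum \<beta> (arb x) = split_sum (\<lambda>u v. \<beta> (arb u) (arb v)) x"
proof -
  have bb: "bilinear (\<lambda>u v. \<beta> (arb u) (arb v))" if "bilinear \<beta>" for \<beta> :: "'w list pvec \<Rightarrow> 'w list pvec \<Rightarrow> 'x"
    by (rule bilinear_comp [OF that linear_arb linear_arb])
  have "cut_sum \<beta> (arb (gen f)) = split_sum (\<lambda>u v. \<beta> (arb u) (arb v)) (gen f)" if \<beta>: "bilinear \<beta>"
    for \<beta> :: "'w list pvec \<Rightarrow> 'w list pvec \<Rightarrow> 'x" and f
    using \<beta>
  proof (induction "weight f" arbitrary: f \<beta> rule: less_induct)
    case (less f)
    note \<beta> = less.prems
    have l: "linear (\<lambda>x. \<beta> x y)" "linear (\<beta> x)" for x y using \<beta> by (auto simp: bilinear_def)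
    have bw: "bilinear (\<lambda>u v. \<beta> u (snoc v a))" for a
      by (rule bilinear_comp [OF \<beta> linear_id_fun linear_snoc_left])
    define t where "t u v w = \<beta> (arb u) (snoc (arb v) (letter w))" for u v w
    have lt: "linear (\<lambda>u. t u v w)" "linear (\<lambda>v. t u v w)" "linear (t u v)" for u v w
      unfolding t_def
      by (intro linear_comp_left [OF \<beta>] linear_comp_right [OF \<beta>] linear_comp_left [OF bilinear_snoc]
          linear_comp_right [OF bilinear_snoc] linear_arb linear_letter)+
    have tri: "trilinear t" using lt by (auto simp: trilinear_def bilinear_def)
    have bt: "bilinear (\<lambda>u v. t u v w)" "bilinear (t u)" for u w
      using tri by (auto simp: trilinear_def)
    have bs: "bilinear (\<lambda>a w. split_sum (\<lambda>u v. t u v w) a)"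
      unfolding bilinear_def by (intro conjI allI linear_split_sum_param linear_split_sum bt lt)
    have b1: "bilinear (\<lambda>u v. \<beta> (snoc (arb u) (letter v)) (gen []))"
      by (rule bilinear_compose_linear [OF l(1) bilinear_arb_letter])
    have step: "cut_sum \<beta> (snoc (arb (pruned f A)) (letter (trunk f A))) =
      \<beta> (snoc (arb (pruned f A)) (letter (trunk f A))) (gen []) +
      split_sum (\<lambda>u v. t u v (trunk f A)) (pruned f A)"
      if A: "A \<in> down_sets f" for A
    proof (cases "A = verts f")
      case True
      then have "letter (trunk f A) = 0" by (simp add: letter_gen lam_empty)
      then show ?thesis
        unfolding split_sum_gen [OF bt(1)]
        by (simp add: t_def linear_0 [OF l(1)] linear_0 [OF l(2)] linear_0 [OF linear_cut_sum [OF \<beta>]])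
    next
      case False
      show ?thesis
        unfolding cut_sum_snoc [OF \<beta>] t_def
        by (subst less.hyps [OF weight_restrict_less(2) [OF A False] bw]) simp
    qed
    have "cut_sum \<beta> (arb (gen f)) = counit (gen f) *\<^sub>R \<beta> (gen []) (gen []) +
      (split_sum (\<lambda>u v. \<beta> (snoc (arb u) (letter v)) (gen [])) (gen f) +
       split_sum (\<lambda>a w. split_sum (\<lambda>u v. t u v w) a) (gen f))"
      unfolding split_sum_gen [OF b1] split_sum_gen [OF bs] sum.distrib [symmetric]
      by (subst arb_eq)
        (simp add: linear_add linear_scale linear_sum linear_cut_sum [OF \<beta>] cut_sum_nil [OF \<beta>]
          split_sum_gen [OF bilinear_arb_letter] step)
    also have "split_sum (\<lambda>a w. split_sum (\<lambda>u v. t u v w) a) (gen f) =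
      split_sum (\<lambda>u x. split_sum (t u) x) (gen f)"
      by (rule split_sum_coassoc [OF tri])
    also have "split_sum (\<lambda>u x. split_sum (t u) x) (gen f) =
      split_sum (\<lambda>u v. \<beta> (arb u) (arb (plus_part v))) (gen f)"
    proof -
      have "split_sum (t u) x = \<beta> (arb u) (arb (plus_part x))" for u x
      proof -
        have "arb (plus_part x) = split_sum (\<lambda>u v. snoc (arb u) (letter v)) x"
          using arb_eq [of x] by (simp add: plus_part_def linear_diff [OF linear_arb] linear_scale [OF linear_arb])
        then show ?thesis
          using linear_split_sum_image [OF l(2) bilinear_arb_letter, of "arb u" x] by (simp add: t_def [abs_def])
      qed
      then show ?thesis by simp
    qed
    also have "\<dots> = split_sum (\<lambda>u v. \<beta> (arb u) (arb v)) (gen f) - \<beta> (arb (gen f)) (gen [])"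
      using split_sum_plus_right [OF bb [OF \<beta>]] by simp
    also have "split_sum (\<lambda>u v. \<beta> (snoc (arb u) (letter v)) (gen [])) (gen f) =
      \<beta> (arb (gen f)) (gen []) - counit (gen f) *\<^sub>R \<beta> (gen []) (gen [])"
    proof -
      have "split_sum (\<lambda>u v. snoc (arb u) (letter v)) (gen f) = arb (gen f) - counit (gen f) *\<^sub>R gen []"
        using arb_eq [of "gen f"] by simp
      then have "\<beta> (split_sum (\<lambda>u v. snoc (arb u) (letter v)) (gen f)) (gen []) =
        \<beta> (arb (gen f)) (gen []) - counit (gen f) *\<^sub>R \<beta> (gen []) (gen [])"
        by (simp add: linear_diff [OF l(1)] linear_scale [OF l(1)])
      then show ?thesis
        by (simp add: linear_split_sum_image [OF l(1) bilinear_arb_letter])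
    qed
    finally show ?case by simp
  qed
  note key = this [OF \<beta>]
  show ?thesis
    by (rule linear_eq_on_gen [OF linear_compose [OF linear_arb linear_cut_sum [OF \<beta>], unfolded o_def]
          linear_split_sum [OF bb [OF \<beta>]] key])
qed

text \<open>
  The last letter of the image of \<open>f g\<close> comes from a set of roots of \<open>f\<close>, from a set of roots of \<open>g\<close>, or from
  both; in the last case \<open>m\<close> multiplies the two letters. These are the three summands of the
  quasi-shuffle recursion.
\<close>

theorem arb_hmult: "arb (hmult x y) = quasi m (arb x) (arb y)"
proof (rule bilinear_eq_on_gen [where \<beta> = "\<lambda>x y. arb (hmult x y)"])
  note q = bilinear_quasi [OF bilinear_m]
  have lm: "linear (m a)" "linear (\<lambda>a. m a b)" for a b using bilinear_m by (auto simp: bilinear_def)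
  show "bilinear (\<lambda>x y. arb (hmult x y))" by (rule bilinear_compose_linear [OF linear_arb bilinear_hmult])
  show "bilinear (\<lambda>x y. quasi m (arb x) (arb y))" by (rule bilinear_comp [OF q linear_arb linear_arb])
  show "arb (hmult (gen f) (gen g)) = quasi m (arb (gen f)) (arb (gen g))" for f g
  proof (induction "weight f + weight g" arbitrary: f g rule: less_induct)
    case (less f g)
    show ?case
    proof (cases "verts f = {} \<or> verts g = {}")
      case True
      then show ?thesis
        by (auto simp: gen_empty hmult_hone_left hmult_hone_right
            quasi_nil_left [OF bilinear_m] quasi_nil_right [OF bilinear_m])
    next
      case False
      let ?f = "\<lambda>A. pruned f A" and ?g = "\<lambda>C. pruned g C"
      let ?a = "\<lambda>A. letter (?f (verts f - A))" and ?c = "\<lambda>C. letter (?g (verts g - C))"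
      have top: "?a (verts f) = 0" "?c (verts g) = 0" by (simp_all add: letter_gen lam_empty)
      have expand: "arb (gen f) = (\<Sum>A\<in>down_sets f. snoc (arb (?f A)) (?a A))"
        "arb (gen g) = (\<Sum>C\<in>down_sets g. snoc (arb (?g C)) (?c C))"
        using False by (subst arb_eq, simp add: counit_gen split_sum_gen [OF bilinear_arb_letter])+
      have IH: "snoc (arb (hmult (?f A) (?g C))) l = snoc (quasi m (arb (?f A)) (arb (?g C))) l"
        if "A \<in> down_sets f" "C \<in> down_sets g" "A \<noteq> verts f \<or> C \<noteq> verts g" for A C l
      proof -
        have "weight (restrict_forest f A) + weight (restrict_forest f (verts f - A)) = weight f"
          "weight (restrict_forest g C) + weight (restrict_forest g (verts g - C)) = weight g"
          using that by (simp_all only: weight_restrict_complement)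
        moreover have "weight (restrict_forest f A) < weight f \<or> weight (restrict_forest g C) < weight g"
          using that weight_restrict_less(2) by blast
        ultimately have "weight (restrict_forest f A) + weight (restrict_forest g C) < weight f + weight g"
          by linarith
        then show ?thesis by (simp only: less)
      qed
      \<comment> \<open>An empty trunk has the letter \<open>0\<close>. So the last summand vanishes unless both trunks are non-empty;
          if one of them is empty, the letter of the other one survives.\<close>
      have split: "snoc (arb (hmult (?f A) (?g C))) (letter (hmult (?f (verts f - A)) (?g (verts g - C)))) =
        (if C = verts g then snoc (quasi m (arb (?f A)) (arb (gen g))) (?a A) else 0) +
        (if A = verts f then snoc (quasi m (arb (gen f)) (arb (?g C))) (?c C) else 0) +
        snoc (quasi m (arb (?f A)) (arb (?g C))) (m (?a A) (?c C))"
        if A: "A \<in> down_sets f" and C: "C \<in> down_sets g" for A C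
      proof -
        have ne: "verts f - A \<noteq> {}" if "A \<noteq> verts f" using that down_setD(1) [OF A] by auto
        have ne': "verts g - C \<noteq> {}" if "C \<noteq> verts g" using that down_setD(1) [OF C] by auto
        consider "A = verts f" "C = verts g" | "A = verts f" "C \<noteq> verts g"
          | "A \<noteq> verts f" "C = verts g" | "A \<noteq> verts f" "C \<noteq> verts g" by blast
        then show ?thesis
        proof cases
          case 1
          then show ?thesis
            by (simp add: gen_empty hmult_hone_left linear_0 [OF lm(1)])
        next
          case 2
          then show ?thesis using IH [OF A C]
            by (simp add: gen_empty hmult_hone_left restrict_verts linear_0 [OF lm(2)])
        next
          case 3
          then show ?thesis using IH [OF A C]
            by (simp add: gen_empty hmult_hone_right restrict_verts linear_0 [OF lm(1)])
        next
          case 4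
          then have "letter (hmult (?f (verts f - A)) (?g (verts g - C))) = m (?a A) (?c C)"
            unfolding hmult_gen letter_gen using ne ne' by (intro lam_mult) auto
          then show ?thesis using IH [OF A C] 4 by simp
        qed
      qed
      have rhs: "quasi m (snoc (arb (?f A)) (?a A)) (snoc (arb (?g C)) (?c C)) =
        snoc (quasi m (arb (?f A)) (snoc (arb (?g C)) (?c C))) (?a A) +
        snoc (quasi m (snoc (arb (?f A)) (?a A)) (arb (?g C))) (?c C) +
        snoc (quasi m (arb (?f A)) (arb (?g C))) (m (?a A) (?c C))" for A C
        by (rule quasi_snoc [OF bilinear_m])
      note lq = linear_quasi [OF bilinear_m]
      have "quasi m (arb (gen f)) (arb (gen g)) =
        (\<Sum>A\<in>down_sets f. \<Sum>C\<in>down_sets g. quasi m (snoc (arb (?f A)) (?a A)) (snoc (arb (?g C)) (?c C)))"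
        unfolding expand(1) linear_sum [OF lq(2)] expand(2) linear_sum [OF lq(1)]
        by (rule sum.swap)
      also have "\<dots> =
        (\<Sum>A\<in>down_sets f. \<Sum>C\<in>down_sets g. snoc (quasi m (arb (?f A)) (snoc (arb (?g C)) (?c C))) (?a A)) +
        (\<Sum>A\<in>down_sets f. \<Sum>C\<in>down_sets g. snoc (quasi m (snoc (arb (?f A)) (?a A)) (arb (?g C))) (?c C)) +
        (\<Sum>A\<in>down_sets f. \<Sum>C\<in>down_sets g. snoc (quasi m (arb (?f A)) (arb (?g C))) (m (?a A) (?c C)))"
        unfolding rhs by (simp only: sum.distrib)
      also have "(\<Sum>A\<in>down_sets f. \<Sum>C\<in>down_sets g. snoc (quasi m (arb (?f A)) (snoc (arb (?g C)) (?c C))) (?a A)) =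
        (\<Sum>A\<in>down_sets f. snoc (quasi m (arb (?f A)) (arb (gen g))) (?a A))"
        unfolding expand(2) by (simp only: linear_sum [OF lq(1)] linear_sum [OF linear_snoc_left])
      also have "(\<Sum>A\<in>down_sets f. \<Sum>C\<in>down_sets g. snoc (quasi m (snoc (arb (?f A)) (?a A)) (arb (?g C))) (?c C)) =
        (\<Sum>C\<in>down_sets g. snoc (quasi m (arb (gen f)) (arb (?g C))) (?c C))"
        unfolding expand(1)
        by (subst sum.swap) (simp only: linear_sum [OF lq(2)] linear_sum [OF linear_snoc_left])
      finally have R: "quasi m (arb (gen f)) (arb (gen g)) =
        (\<Sum>A\<in>down_sets f. snoc (quasi m (arb (?f A)) (arb (gen g))) (?a A)) +
        (\<Sum>C\<in>down_sets g. snoc (quasi m (arb (gen f)) (arb (?g C))) (?c C)) +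
        (\<Sum>A\<in>down_sets f. \<Sum>C\<in>down_sets g. snoc (quasi m (arb (?f A)) (arb (?g C))) (m (?a A) (?c C)))" .
      let ?G = "graft (\<lambda>_. None) f g"
      have cut: "gen (restrict_forest ?G (join A C)) = hmult (?f A) (?g C)"
        if "A \<subseteq> verts f" "C \<subseteq> verts g" for A C
        unfolding hmult_gen using that by (subst restrict_graft) auto
      have "arb (hmult (gen f) (gen g)) = (\<Sum>X\<in>down_sets ?G. snoc (arb (gen (restrict_forest ?G X)))
          (letter (gen (restrict_forest ?G (verts ?G - X)))))"
        unfolding hmult_gen
        by (subst arb_eq) (use False in \<open>simp add: counit_gen split_sum_gen [OF bilinear_arb_letter]\<close>)
      also have "\<dots> = (\<Sum>A\<in>down_sets f. \<Sum>C\<in>down_sets g. snoc (arb (hmult (?f A) (?g C)))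
          (letter (hmult (?f (verts f - A)) (?g (verts g - C)))))"
        unfolding sum_down_sets_graft
      proof (intro sum.cong refl)
        fix A C assume "A \<in> down_sets f" "C \<in> down_sets g"
        then have "A \<subseteq> verts f" "C \<subseteq> verts g" by (auto dest: down_setD(1))
        then show "(if compatible_cut (\<lambda>_. None) f A C then snoc (arb (gen (restrict_forest ?G (join A C))))
          (letter (gen (restrict_forest ?G (verts ?G - join A C)))) else 0) =
          snoc (arb (hmult (?f A) (?g C))) (letter (hmult (?f (verts f - A)) (?g (verts g - C))))"
          unfolding verts_graft join_diff by (simp add: compatible_cut_def cut)
      qed
      also have "\<dots> = (\<Sum>A\<in>down_sets f. \<Sum>C\<in>down_sets g.
        (if C = verts g then snoc (quasi m (arb (?f A)) (arb (gen g))) (?a A) else 0) +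
        (if A = verts f then snoc (quasi m (arb (gen f)) (arb (?g C))) (?c C) else 0) +
        snoc (quasi m (arb (?f A)) (arb (?g C))) (m (?a A) (?c C)))"
        by (intro sum.cong refl split)
      also have "\<dots> = (\<Sum>A\<in>down_sets f. snoc (quasi m (arb (?f A)) (arb (gen g))) (?a A)) +
        (\<Sum>A\<in>down_sets f. \<Sum>C\<in>down_sets g.
          if A = verts f then snoc (quasi m (arb (gen f)) (arb (?g C))) (?c C) else 0) +
        (\<Sum>A\<in>down_sets f. \<Sum>C\<in>down_sets g. snoc (quasi m (arb (?f A)) (arb (?g C))) (m (?a A) (?c C)))"
        by (simp add: sum.distrib sum.delta)
      also have "(\<Sum>A\<in>down_sets f. \<Sum>C\<in>down_sets g.
          if A = verts f then snoc (quasi m (arb (gen f)) (arb (?g C))) (?c C) else 0) =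
        (\<Sum>C\<in>down_sets g. snoc (quasi m (arb (gen f)) (arb (?g C))) (?c C))"
        by (subst sum.swap) (simp add: sum.delta)
      finally show ?thesis using R by simp
    qed
  qed
qed

text \<open>
  In a tree the only non-empty trunk without edges is the root alone.
\<close>

theorem arb_Bplus: "arb (Bplus \<gamma> x) = snoc (arb x) (\<iota> \<gamma>)"
proof (rule linear_eq_on_gen [where F = "\<lambda>x. arb (Bplus \<gamma> x)"])
  show "linear (\<lambda>x. arb (Bplus \<gamma> x))"
    using linear_compose [OF linear_Bplus linear_arb] by (simp add: o_def)
  show "linear (\<lambda>x. snoc (arb x) (\<iota> \<gamma>))" by (rule linear_comp_left [OF bilinear_snoc linear_arb])
  fix f
  let ?G = "add_root \<gamma> f"
  have rootG: "roots ?G = {0}"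
    by (auto simp: roots_def parent_add_root)
  have S: "Suc ` verts f \<in> down_sets ?G"
    by (auto simp: down_sets_def parent_add_root split: nat.splits if_splits)
  have "letter (gen (restrict_forest ?G (verts ?G - A))) = 0"
    if A: "A \<in> down_sets ?G" "A \<noteq> Suc ` verts f" for A
  proof (cases "0 \<in> A")
    case True
    then have "A = verts ?G" using down_set_containing_roots [OF A(1)] rootG by simp
    then show ?thesis by (simp add: letter_gen lam_empty)
  next
    case False
    then have "A \<subseteq> Suc ` verts f" using down_setD(1) [OF A(1)] by auto
    then obtain v where v: "v \<in> verts f" "Suc v \<notin> A" using A(2) by blast
    then obtain w where w: "parent ?G (Suc v) = Some w" by (simp add: parent_add_root)
    then have "w \<notin> A" "w \<in> verts ?G" using down_setD(2) [OF A(1)] v(2) parent_in_verts(2) by blast+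
    then have "parent (restrict_forest ?G (verts ?G - A)) (Suc v) = Some w"
      using v w by (simp add: parent_restrict)
    then have "has_edge (restrict_forest ?G (verts ?G - A))"
      unfolding has_edge_def by (intro bexI [of _ "Suc v"]) (use v in auto)
    then show ?thesis by (simp add: letter_gen lam_edge)
  qed
  then have "(\<Sum>A\<in>down_sets ?G. snoc (arb (gen (restrict_forest ?G A))) (letter (gen (restrict_forest ?G (verts ?G - A))))) =
    (\<Sum>A\<in>down_sets ?G. if A = Suc ` verts f
      then snoc (arb (gen (restrict_forest ?G A))) (letter (gen (restrict_forest ?G (verts ?G - A)))) else 0)"
    by (intro sum.cong) auto
  also have "\<dots> = snoc (arb (gen (restrict_forest ?G (Suc ` verts f))))
    (letter (gen (restrict_forest ?G (verts ?G - Suc ` verts f))))"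
    using S by (simp add: sum.delta)
  also have "gen (restrict_forest ?G (Suc ` verts f)) = gen f"
  proof (rule gen_iso [symmetric, where b = Suc], rule iso_viaI)
    show "bij_betw Suc (verts f) (verts (restrict_forest ?G (Suc ` verts f)))"
      by (auto simp: bij_betw_def)
    fix v assume v: "v \<in> verts f"
    show "parent (restrict_forest ?G (Suc ` verts f)) (Suc v) = map_option Suc (parent f v)"
      using v parent_in_verts(2) [of f v] by (cases "parent f v") (auto simp: parent_restrict parent_add_root)
    show "label (restrict_forest ?G (Suc ` verts f)) (Suc v) = label f v" by simp
  qed
  also have "gen (restrict_forest ?G (verts ?G - Suc ` verts f)) = gen (dots [\<gamma>])"
  proof (rule gen_eq_labels)
    show "verts (restrict_forest ?G (verts ?G - Suc ` verts f)) = verts (dots [\<gamma>])" by auto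
    show "parent (restrict_forest ?G (verts ?G - Suc ` verts f)) = parent (dots [\<gamma>])"
      by (auto simp: fun_eq_iff parent_restrict parent_add_root split: nat.splits)
  qed auto
  finally have "(\<Sum>A\<in>down_sets ?G. snoc (arb (gen (restrict_forest ?G A))) (letter (gen (restrict_forest ?G (verts ?G - A))))) =
    snoc (arb (gen f)) (\<iota> \<gamma>)"
    by (simp add: letter_gen lam_dot)
  then show "arb (Bplus \<gamma> (gen f)) = snoc (arb (gen f)) (\<iota> \<gamma>)"
    unfolding Bplus_gen by (subst arb_eq) (simp add: counit_gen split_sum_gen [OF bilinear_arb_letter])
qed

theorem arb_the: "(THE g. linear g \<and> g hone = gen [] \<and>
     (\<forall>x y. g (hmult x y) = quasi m (g x) (g y)) \<and>
     (\<forall>\<gamma> x. g (Bplus \<gamma> x) = snoc (g x) (\<iota> \<gamma>))) = arb"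
proof (rule the_equality)
  show "linear arb \<and> arb hone = gen [] \<and> (\<forall>x y. arb (hmult x y) = quasi m (arb x) (arb y)) \<and>
     (\<forall>\<gamma> x. arb (Bplus \<gamma> x) = snoc (arb x) (\<iota> \<gamma>))"
    by (simp add: linear_arb arb_hmult arb_Bplus)
  fix g assume g: "linear g \<and> g hone = gen [] \<and>
     (\<forall>x y. g (hmult x y) = quasi m (g x) (g y)) \<and>
     (\<forall>\<gamma> x. g (Bplus \<gamma> x) = snoc (g x) (\<iota> \<gamma>))"
  show "g = arb"
  proof
    fix x
    have "linear (\<lambda>x. g x - arb x)" using g by (intro linear_compose_sub linear_arb) blast
    from linear_subspace_kernel [OF this] have "subspace {x. g x - arb x = 0}" .
    then have "x \<in> {x. g x - arb x = 0}"
      by (rule hopf_induct) (use g in \<open>simp_all add: arb_hmult arb_Bplus\<close>)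
    then show "g x = arb x" by simp
  qed
qed

end

section \<open>The pairing and the Grossman--Larson product\<close>

lemma linear_eval_dual: "linear (eval_dual \<phi>)"
  using eval_dual [of \<phi>] by simp

lemma linear_eval_dual_left: "linear (\<lambda>\<phi>. eval_dual \<phi> x)"
  by (rule linearI) (simp_all add: plus_dual.rep_eq scaleR_dual.rep_eq)

lemma linear_mult_const: "linear F \<Longrightarrow> linear (\<lambda>x. F x * (c :: real))"
  by (simp add: linear_iff algebra_simps)

lemma finite_shape_isos [simp]: "finite (shape_isos f g)"
  by (rule finite_subset [of _ "verts f \<rightarrow>\<^sub>E verts g"]) (auto simp: shape_isos_def intro: finite_PiE)

definition pair_gen :: "'v::real_vector dual forest \<Rightarrow> 'v forest \<Rightarrow> real" where
  "pair_gen f g = (\<Sum>b\<in>shape_isos f g. \<Prod>v\<in>verts f. eval_dual (label f v) (label g (b v)))"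

lemma shape_map_transport:
  assumes b: "shape_map b f g" and a: "shape_map a' f' f" and c: "shape_map c g g'"
  shows "restrict (\<lambda>v. c (b (a' v))) (verts f') \<in> shape_isos f' g'"
  using shape_map_restrict [OF shape_map_comp [OF a shape_map_comp [OF b c]]] by (simp add: o_def)

lemma pair_gen_iso:
  assumes a: "iso_via a f f'" and c: "iso_via c g g'"
  shows "pair_gen f g = pair_gen f' g'"
proof -
  obtain a' where a': "iso_via a' f' f" "\<And>v. v \<in> verts f \<Longrightarrow> a' (a v) = v"
    "\<And>w. w \<in> verts f' \<Longrightarrow> a (a' w) = w" "\<And>v. v \<in> verts f \<Longrightarrow> a v \<in> verts f'"
    "\<And>w. w \<in> verts f' \<Longrightarrow> a' w \<in> verts f"
    using iso_via_inverse_obtain [OF a] by blast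
  obtain c' where c': "iso_via c' g' g" "\<And>v. v \<in> verts g \<Longrightarrow> c' (c v) = v"
    "\<And>w. w \<in> verts g' \<Longrightarrow> c (c' w) = w" "\<And>v. v \<in> verts g \<Longrightarrow> c v \<in> verts g'"
    "\<And>w. w \<in> verts g' \<Longrightarrow> c' w \<in> verts g"
    using iso_via_inverse_obtain [OF c] by blast
  have sm: "shape_map a f f'" "shape_map a' f' f" "shape_map c g g'" "shape_map c' g' g"
    using a a' c c' by (simp_all add: iso_via_def)
  have mem: "b v \<in> verts h" if "b \<in> shape_isos k h" "v \<in> verts k" for b v and k :: "'b forest" and h :: "'c forest"
    using that by (auto simp: shape_isos_def)
  show ?thesis
    unfolding pair_gen_def
  proof (rule sum.reindex_bij_witness [where j = "\<lambda>b. restrict (\<lambda>v. c (b (a' v))) (verts f')"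
        and i = "\<lambda>b. restrict (\<lambda>v. c' (b (a v))) (verts f)"])
    fix b assume b: "b \<in> shape_isos f g"
    then have bs: "shape_map b f g" and be: "b \<in> extensional (verts f)" by (auto simp: shape_isos_iff)
    have bv: "b v \<in> verts g" if "v \<in> verts f" for v using b that by (auto simp: shape_isos_def)
    show "restrict (\<lambda>v. c (b (a' v))) (verts f') \<in> shape_isos f' g'"
      by (rule shape_map_transport [OF bs sm(2,3)])
    show "restrict (\<lambda>v. c' (restrict (\<lambda>v. c (b (a' v))) (verts f') (a v))) (verts f) = b"
      by (rule extensionalityI [OF _ be]) (simp_all add: a' c' bv)
    have "(\<Prod>v\<in>verts f. eval_dual (label f v) (label g (b v))) =
      (\<Prod>v\<in>verts f. eval_dual (label f' (a v)) (label g' (restrict (\<lambda>v. c (b (a' v))) (verts f') (a v))))"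
      using a c by (intro prod.cong refl) (simp add: a' bv iso_via_def)
    also have "\<dots> = (\<Prod>v\<in>verts f'. eval_dual (label f' v) (label g' (restrict (\<lambda>v. c (b (a' v))) (verts f') v)))"
      by (rule prod.reindex_bij_betw [OF iso_via_bij [OF a]])
    finally show "(\<Prod>v\<in>verts f'. eval_dual (label f' v) (label g' (restrict (\<lambda>v. c (b (a' v))) (verts f') v))) =
      (\<Prod>v\<in>verts f. eval_dual (label f v) (label g (b v)))" ..
  next
    fix b assume b: "b \<in> shape_isos f' g'"
    then have bs: "shape_map b f' g'" and be: "b \<in> extensional (verts f')" by (auto simp: shape_isos_iff)
    have bv: "b v \<in> verts g'" if "v \<in> verts f'" for v using b that by (auto simp: shape_isos_def)
    show "restrict (\<lambda>v. c' (b (a v))) (verts f) \<in> shape_isos f g"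
      by (rule shape_map_transport [OF bs sm(1,4)])
    show "restrict (\<lambda>v. c (restrict (\<lambda>v. c' (b (a v))) (verts f) (a' v))) (verts f') = b"
      by (rule extensionalityI [OF _ be]) (simp_all add: a' c' bv)
  qed
qed

lemma shape_isos_relabel [simp]:
  "shape_isos (relabel f v x) g = shape_isos f g" "shape_isos f (relabel g w y) = shape_isos f g"
  by (simp_all add: shape_isos_def)

lemma descends_pair_gen_left: "descends (\<lambda>f. pair_gen f g)"
proof (rule descends_forestI)
  show "pair_gen f g = pair_gen f' g" if "iso_via b f f'" for b f f'
    by (rule pair_gen_iso [OF that iso_via_id])
  fix f :: "'a dual forest" and v assume v: "v \<in> verts f"
  have "(\<Prod>u\<in>verts f. eval_dual (label (relabel f v x) u) (label g (b u))) =
    eval_dual x (label g (b v)) * (\<Prod>u\<in>verts f - {v}. eval_dual (label f u) (label g (b u)))" for x b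
    by (subst prod.remove [OF finite_verts v]) simp
  then show "linear (\<lambda>x. pair_gen (relabel f v x) g)"
    by (simp add: pair_gen_def linear_compose_sum linear_mult_const linear_eval_dual_left del: label_simps)
qed

lemma descends_pair_gen_right: "descends (\<lambda>g. pair_gen f g)"
proof (rule descends_forestI)
  show "pair_gen f g = pair_gen f g'" if "iso_via b g g'" for b g g'
    by (rule pair_gen_iso [OF iso_via_id that])
  fix g :: "'a forest" and v assume v: "v \<in> verts g"
  have "linear (\<lambda>x. \<Prod>u\<in>verts f. eval_dual (label f u) (label (relabel g v x) (b u)))"
    if b: "b \<in> shape_isos f g" for b
  proof -
    have bij: "bij_betw b (verts f) (verts g)" using b by (simp add: shape_isos_def)
    have "v \<in> b ` verts f" using v bij_betw_imp_surj_on [OF bij] by simp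
    then obtain w where w: "w \<in> verts f" "b w = v" by (elim imageE) simp
    have ne: "b u \<noteq> v" if "u \<in> verts f - {w}" for u
      using bij w that by (auto simp: bij_betw_def inj_on_def)
    have "(\<Prod>u\<in>verts f - {w}. eval_dual (label f u) (label (relabel g v x) (b u))) =
      (\<Prod>u\<in>verts f - {w}. eval_dual (label f u) (label g (b u)))" for x
      by (rule prod.cong) (use ne in auto)
    then have "(\<Prod>u\<in>verts f. eval_dual (label f u) (label (relabel g v x) (b u))) =
      eval_dual (label f w) x * (\<Prod>u\<in>verts f - {w}. eval_dual (label f u) (label g (b u)))" for x
      by (subst prod.remove [OF finite_verts w(1)]) (simp add: w(2) del: label_simps, simp)
    then show ?thesis by (simp add: linear_mult_const linear_eval_dual)
  qed
  then show "linear (\<lambda>x. pair_gen f (relabel g v x))"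
    unfolding pair_gen_def shape_isos_relabel by (intro linear_compose_sum ballI)
qed

lemma pairing_eq: "pairing = bilinext pair_gen"
  by (simp add: pairing_def pair_gen_def [abs_def])

lemma bilinear_pairing: "bilinear pairing"
  unfolding pairing_eq by (rule bilinext [OF descends_pair_gen_right descends_pair_gen_left])

lemma pairing_gen: "pairing (gen f) (gen g) = pair_gen f g"
  unfolding pairing_eq by (rule bilinext [OF descends_pair_gen_right descends_pair_gen_left])

lemma linear_pairing: "linear (pairing x)" "linear (\<lambda>x. pairing x y)"
  using bilinear_pairing by (auto simp: bilinear_def [of pairing])

definition gl_gen :: "'v::real_vector forest \<Rightarrow> 'v forest \<Rightarrow> 'v hopf" where
  "gl_gen f g = (\<Sum>\<phi>\<in>roots f \<rightarrow>\<^sub>E insert None (Some ` verts g). gen (graft \<phi> f g))"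

lemma gl_gen_iso:
  assumes a: "iso_via a f f'" and c: "iso_via c g g'"
  shows "gl_gen f g = gl_gen f' g'"
proof -
  obtain a' where a': "iso_via a' f' f" "\<And>v. v \<in> verts f \<Longrightarrow> a' (a v) = v"
    "\<And>w. w \<in> verts f' \<Longrightarrow> a (a' w) = w" "\<And>v. v \<in> verts f \<Longrightarrow> a v \<in> verts f'"
    "\<And>w. w \<in> verts f' \<Longrightarrow> a' w \<in> verts f"
    using iso_via_inverse_obtain [OF a] by blast
  obtain c' where c': "iso_via c' g' g" "\<And>v. v \<in> verts g \<Longrightarrow> c' (c v) = v"
    "\<And>w. w \<in> verts g' \<Longrightarrow> c (c' w) = w" "\<And>v. v \<in> verts g \<Longrightarrow> c v \<in> verts g'"
    "\<And>w. w \<in> verts g' \<Longrightarrow> c' w \<in> verts g"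
    using iso_via_inverse_obtain [OF c] by blast
  have r: "a v \<in> roots f'" "v \<in> verts f" if "v \<in> roots f" for v
    using iso_via_roots [OF a] that by (auto simp: roots_def)
  have r': "a' v \<in> roots f" "v \<in> verts f'" if "v \<in> roots f'" for v
    using iso_via_roots [OF a'(1)] that by (auto simp: roots_def)
  let ?P = "\<lambda>f g. roots f \<rightarrow>\<^sub>E insert None (Some ` verts g)"
  have tr: "restrict (\<lambda>r. map_option c (\<phi> (a r))) (roots f) \<in> roots f \<rightarrow>\<^sub>E insert None (Some ` verts g')"
    if "\<phi> \<in> roots f' \<rightarrow>\<^sub>E insert None (Some ` verts g)" "\<And>v. v \<in> roots f \<Longrightarrow> a v \<in> roots f'"
      "\<And>v. v \<in> verts g \<Longrightarrow> c v \<in> verts g'"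
    for \<phi> a c and f f' g g' :: "'a forest"
    using that by (fastforce simp: PiE_iff)
  have id1: "map_option c' (map_option c o') = o'" if "o' \<in> insert None (Some ` verts g)" for o'
    using that c' by auto
  have id2: "map_option c (map_option c' o') = o'" if "o' \<in> insert None (Some ` verts g')" for o'
    using that c' by auto
  show ?thesis
    unfolding gl_gen_def
  proof (rule sum.reindex_bij_witness [where j = "\<lambda>\<phi>. restrict (\<lambda>r. map_option c (\<phi> (a' r))) (roots f')"
        and i = "\<lambda>\<phi>. restrict (\<lambda>r. map_option c' (\<phi> (a r))) (roots f)"])
    fix \<phi> assume \<phi>: "\<phi> \<in> ?P f g"
    then have \<phi>r: "\<phi> v \<in> insert None (Some ` verts g)" if "v \<in> roots f" for v using that by (auto simp: PiE_iff)
    have \<phi>e: "\<phi> \<in> extensional (roots f)" using \<phi> by (simp add: PiE_iff)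
    show "restrict (\<lambda>r. map_option c (\<phi> (a' r))) (roots f') \<in> ?P f' g'"
      by (rule tr [OF \<phi> r'(1) c'(4)])
    show "restrict (\<lambda>r. map_option c' (restrict (\<lambda>r. map_option c (\<phi> (a' r))) (roots f') (a r))) (roots f) = \<phi>"
      by (rule extensionalityI [OF _ \<phi>e]) (simp_all add: r a' id1 [OF \<phi>r])
    have "gen (graft \<phi> f g) = gen (graft (restrict (\<lambda>r. map_option c (\<phi> (a' r))) (roots f')) f' g')"
    proof (rule gen_graft_iso [OF a c])
      show "restrict (\<lambda>r. map_option c (\<phi> (a' r))) (roots f') (a v) = map_option c (\<phi> v)" if "v \<in> roots f" for v
        using r [OF that] by (simp add: a')
      show "w \<in> verts g" if "v \<in> roots f" "\<phi> v = Some w" for v w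
        using \<phi>r [OF that(1)] that(2) by auto
    qed
    then show "gen (graft (restrict (\<lambda>r. map_option c (\<phi> (a' r))) (roots f')) f' g') = gen (graft \<phi> f g)" ..
  next
    fix \<phi> assume \<phi>: "\<phi> \<in> ?P f' g'"
    then have \<phi>r: "\<phi> v \<in> insert None (Some ` verts g')" if "v \<in> roots f'" for v using that by (auto simp: PiE_iff)
    have \<phi>e: "\<phi> \<in> extensional (roots f')" using \<phi> by (simp add: PiE_iff)
    show "restrict (\<lambda>r. map_option c' (\<phi> (a r))) (roots f) \<in> ?P f g"
      by (rule tr [OF \<phi> r(1) c'(5)])
    show "restrict (\<lambda>r. map_option c (restrict (\<lambda>r. map_option c' (\<phi> (a r))) (roots f) (a' r))) (roots f') = \<phi>"
      by (rule extensionalityI [OF _ \<phi>e]) (simp_all add: r' a' id2 [OF \<phi>r])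
  qed
qed

lemma roots_relabel [simp]: "roots (relabel f v a) = roots f"
  by (simp add: roots_def)

lemma descends_gl_gen_left: "descends (\<lambda>f. gl_gen f g)"
  by (rule descends_forestI, erule gl_gen_iso [OF _ iso_via_id])
    (auto simp: gl_gen_def intro!: linear_compose_sum linear_gen_graft_relabel)

lemma descends_gl_gen_right: "descends (gl_gen f)"
  by (rule descends_forestI, erule gl_gen_iso [OF iso_via_id])
    (auto simp: gl_gen_def intro!: linear_compose_sum linear_gen_graft_relabel)

lemma gl_prod_eq: "gl_prod = bilinext gl_gen"
  by (simp add: gl_prod_def gl_gen_def [abs_def])

lemma bilinear_gl_prod: "bilinear gl_prod"
  unfolding gl_prod_eq by (rule bilinext [OF descends_gl_gen_right descends_gl_gen_left])

lemma gl_prod_gen: "gl_prod (gen f) (gen g) = gl_gen f g"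
  unfolding gl_prod_eq by (rule bilinext [OF descends_gl_gen_right descends_gl_gen_left])

lemma descends_hopf_trunc: "descends (\<lambda>f :: 'u::real_vector forest. if weight f \<le> n then gen f else 0)"
proof (rule descends_cases_weight [where \<phi> = "\<lambda>k f. if k \<le> n then gen f else 0"])
  show "descends (\<lambda>f :: 'u forest. if k \<le> n then gen f else 0)" for k
    by (cases "k \<le> n") (simp_all add: descends_gen descends_linear [OF linear_zero])
qed

lemma linear_hopf_trunc: "linear (hopf_trunc n)"
  unfolding hopf_trunc_def by (rule linext [OF descends_hopf_trunc])

lemma hopf_trunc_gen: "hopf_trunc n (gen f) = (if weight f \<le> n then gen f else 0)"
  unfolding hopf_trunc_def by (rule linext [OF descends_hopf_trunc])

lemma pair_gen_weight: "weight f \<noteq> weight g \<Longrightarrow> pair_gen f g = 0"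
proof -
  assume "weight f \<noteq> weight g"
  then have "shape_isos f g = {}"
    using bij_betw_same_card by (fastforce simp: shape_isos_def weight_def)
  then show ?thesis by (simp add: pair_gen_def)
qed

lemma pairing_above_degree:
  assumes "x \<in> hopf_deg n" "y \<in> hopf_le N" "N < n" shows "pairing x y = 0"
proof -
  have "pairing (gen f) y = 0" if "weight f = n" for f
  proof (rule linear_eq_0_on_span [OF linear_pairing(1)])
    show "y \<in> span {gen g | g. weight g \<le> N}" using assms(2) by (simp add: hopf_le_def)
    show "pairing (gen f) z = 0" if "z \<in> {gen g | g. weight g \<le> N}" for z
      using that \<open>weight f = n\<close> assms(3) by (auto simp: pairing_gen intro!: pair_gen_weight)
  qed
  then have "pairing z y = 0" if "z \<in> {gen f | f. weight f = n}" for z using that by auto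
  then show ?thesis
    using assms(1) unfolding hopf_deg_def
    by (rule linear_eq_0_on_span [OF linear_pairing(2)])
qed

lemma pairing_trunc:
  assumes "x \<in> hopf_deg n" "n \<le> N" shows "pairing x (hopf_trunc N y) = pairing x y"
proof -
  have "pairing (gen f) (hopf_trunc N (gen g)) = pairing (gen f) (gen g)" if "weight f = n" for f g
    using that assms(2) by (simp add: hopf_trunc_gen pairing_gen pair_gen_weight linear_0 [OF linear_pairing(1)])
  then have "pairing (gen f) (hopf_trunc N y) = pairing (gen f) y" if "weight f = n" for f
    by (rule linear_eq_on_gen [OF linear_compose [OF linear_hopf_trunc linear_pairing(1), unfolded o_def] linear_pairing(1)])
      (use that in blast)
  then have "pairing z (hopf_trunc N y) = pairing z y" if "z \<in> {gen f | f. weight f = n}" for z using that by auto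
  then show ?thesis
    using assms(1) unfolding hopf_deg_def
    by (rule linear_eq_on_span [OF linear_pairing(2) linear_pairing(2)])
qed

text \<open>
  The vertices of \<open>graft \<phi> g h\<close> are the even numbers for \<open>g\<close> and the odd numbers for \<open>h\<close>. An isomorphism \<open>b\<close>
  from \<open>f\<close> onto it is therefore a cut of \<open>f\<close> (the vertices sent to even numbers) together with isomorphisms
  of the pruned part onto \<open>g\<close> and of the trunk onto \<open>h\<close>. Conversely these determine \<open>b\<close>, and also \<open>\<phi>\<close>: a root of \<open>g\<close>
  is attached to the image of the parent of its preimage in \<open>f\<close>. The functions below are the
  components of this bijection and of its inverse.
\<close>

definition even_part :: "'u forest \<Rightarrow> (nat \<Rightarrow> nat) \<Rightarrow> nat set" where
  "even_part f b = {v \<in> verts f. even (b v)}"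

definition halve :: "nat set \<Rightarrow> (nat \<Rightarrow> nat) \<Rightarrow> nat \<Rightarrow> nat" where
  "halve A b = restrict (\<lambda>v. b v div 2) A"

definition glue_map :: "'u forest \<Rightarrow> nat set \<Rightarrow> (nat \<Rightarrow> nat) \<Rightarrow> (nat \<Rightarrow> nat) \<Rightarrow> nat \<Rightarrow> nat" where
  "glue_map f A b c = restrict (\<lambda>v. if v \<in> A then 2 * b v else 2 * c v + 1) (verts f)"

definition glue_graft ::
  "'u forest \<Rightarrow> 'w forest \<Rightarrow> nat set \<Rightarrow> (nat \<Rightarrow> nat) \<Rightarrow> (nat \<Rightarrow> nat) \<Rightarrow> nat \<Rightarrow> nat option" where
  "glue_graft f g A b c = restrict (\<lambda>r. map_option c (parent f (inv_into A b r))) (roots g)"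

lemma split_iso:
  fixes f :: "'u forest" and g h :: "'w forest"
  assumes \<phi>: "\<phi> \<in> roots g \<rightarrow>\<^sub>E insert None (Some ` verts h)" and b: "b \<in> shape_isos f (graft \<phi> g h)"
  defines "A \<equiv> even_part f b"
  shows "A \<in> down_sets f"
    and "halve A b \<in> shape_isos (restrict_forest f A) g"
    and "halve (verts f - A) b \<in> shape_isos (restrict_forest f (verts f - A)) h"
    and "glue_map f A (halve A b) (halve (verts f - A) b) = b"
    and "glue_graft f g A (halve A b) (halve (verts f - A) b) = \<phi>"
proof -
  let ?G = "graft \<phi> g h"
  have Af: "A \<subseteq> verts f" by (auto simp: A_def even_part_def)
  have bij: "bij_betw b (verts f) (join (verts g) (verts h))"
    and par: "\<And>v. v \<in> verts f \<Longrightarrow> parent ?G (b v) = map_option b (parent f v)"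
    and ext: "b \<in> extensional (verts f)"
    using b unfolding shape_isos_def verts_graft by (auto simp: PiE_def)
  have \<phi>h: "w \<in> verts h" if "r \<in> roots g" "\<phi> r = Some w" for r w
    using \<phi> that by (auto simp: PiE_iff)
  have A: "b v = 2 * (b v div 2)" "b v div 2 \<in> verts g" if "v \<in> A" for v
    using that bij_betw_apply [OF bij, of v] by (auto simp: A_def even_part_def mem_join)
  have C: "b v = Suc (2 * (b v div 2))" "b v div 2 \<in> verts h" if "v \<in> verts f - A" for v
    using that bij_betw_apply [OF bij, of v] by (auto simp: A_def even_part_def mem_join)
  have inA: "v \<in> A" if "v \<in> verts f" "b v = 2 * u" for u v
    using that by (simp add: A_def even_part_def)
  have inC: "v \<in> verts f - A" if "v \<in> verts f" "b v = Suc (2 * u)" for u v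
    using that by (simp add: A_def even_part_def)
  show D: "A \<in> down_sets f"
    unfolding down_sets_def
  proof (intro CollectI conjI allI impI Af)
    fix v w assume vw: "parent f v = Some w \<and> w \<in> A"
    then have v: "v \<in> verts f" "w \<in> verts f" using parent_in_verts by blast+
    show "v \<in> A"
    proof (rule ccontr)
      assume "v \<notin> A"
      then have "parent ?G (Suc (2 * (b v div 2))) = Some (b w)"
        using C(1) [of v] par [OF v(1)] vw v by simp
      then have "map_option (\<lambda>w. 2 * w + 1) (parent h (b v div 2)) = Some (b w)"
        by (simp add: parent_graft)
      then obtain z where z: "2 * z + 1 = b w" unfolding map_option_eq_Some by blast
      have "odd (b w)" unfolding z [symmetric] by simp
      then show False using A(1) [of w] vw by (metis dvd_triv_left)
    qed
  qed
  have inj: "inj_on b (verts f)" and im: "b ` verts f = join (verts g) (verts h)"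
    using bij by (auto simp: bij_betw_def)
  have surjA: "\<exists>v\<in>A. b v = 2 * u" if u: "u \<in> verts g" for u
  proof -
    have "2 * u \<in> b ` verts f" using u by (simp add: im)
    then obtain v where "v \<in> verts f" "b v = 2 * u" by (elim imageE) simp
    then show ?thesis using inA by blast
  qed
  have surjC: "\<exists>v\<in>verts f - A. b v = Suc (2 * u)" if u: "u \<in> verts h" for u
  proof -
    have "Suc (2 * u) \<in> b ` verts f" using u by (simp add: im)
    then obtain v where "v \<in> verts f" "b v = Suc (2 * u)" by (elim imageE) simp
    then show ?thesis using inC by blast
  qed
  have injA: "inj_on (halve A b) A"
  proof (rule inj_onI)
    fix x y assume xy: "x \<in> A" "y \<in> A" "halve A b x = halve A b y"
    then have "b x = b y" using A(1) [of x] A(1) [of y] by (simp add: halve_def)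
    then show "x = y" using inj xy Af by (auto simp: inj_on_def)
  qed
  have injC: "inj_on (halve (verts f - A) b) (verts f - A)"
  proof (rule inj_onI)
    fix x y assume xy: "x \<in> verts f - A" "y \<in> verts f - A" "halve (verts f - A) b x = halve (verts f - A) b y"
    then have "b x = b y" using C(1) [of x] C(1) [of y] by (simp add: halve_def)
    then show "x = y" using inj xy by (auto simp: inj_on_def)
  qed
  have imA: "halve A b ` A = verts g"
  proof
    show "halve A b ` A \<subseteq> verts g" using A(2) by (auto simp: halve_def)
    show "verts g \<subseteq> halve A b ` A"
    proof
      fix u assume "u \<in> verts g"
      then obtain v where "v \<in> A" "b v = 2 * u" using surjA by blast
      then show "u \<in> halve A b ` A" by (intro image_eqI [of _ _ v]) (simp_all add: halve_def)
    qed
  qed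
  have imC: "halve (verts f - A) b ` (verts f - A) = verts h"
  proof
    show "halve (verts f - A) b ` (verts f - A) \<subseteq> verts h" using C(2) by (auto simp: halve_def)
    show "verts h \<subseteq> halve (verts f - A) b ` (verts f - A)"
    proof
      fix u assume "u \<in> verts h"
      then obtain v where "v \<in> verts f - A" "b v = Suc (2 * u)" using surjC by blast
      then show "u \<in> halve (verts f - A) b ` (verts f - A)" by (intro image_eqI [of _ _ v]) (simp_all add: halve_def)
    qed
  qed
  have parA: "parent g (b v div 2) = map_option (halve A b) (parent (restrict_forest f A) v)" if v: "v \<in> A" for v
  proof -
    define u where "u = b v div 2"
    have u: "b v = 2 * u" "u \<in> verts g" using A [OF v] by (simp_all add: u_def)
    have p: "parent ?G (2 * u) = map_option b (parent f v)" using par [of v] v Af u by auto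
    show ?thesis
    proof (cases "parent g u")
      case None
      have "w \<notin> A" if "parent f v = Some w" for w
      proof
        assume "w \<in> A"
        then have "even (b w)" by (simp add: A_def even_part_def)
        then show False using p that u None
          by (auto simp: parent_graft split: option.splits if_splits) (metis dvd_triv_left even_Suc)
      qed
      then show ?thesis using None v by (cases "parent f v") (simp_all add: parent_restrict u_def [symmetric])
    next
      case (Some w')
      then obtain w where w: "parent f v = Some w" "b w = 2 * w'"
        using p u by (cases "parent f v") (simp_all add: parent_graft)
      then have "w \<in> A" using parent_in_verts(2) inA by blast
      then show ?thesis using Some w v by (simp add: parent_restrict halve_def u_def [symmetric])
    qed
  qed
  have parC: "parent h (b v div 2) = map_option (halve (verts f - A) b) (parent (restrict_forest f (verts f - A)) v)"
    if v: "v \<in> verts f - A" for v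
  proof -
    define u where "u = b v div 2"
    have u: "b v = Suc (2 * u)" "u \<in> verts h" using C [OF v] by (simp_all add: u_def)
    have p: "map_option (\<lambda>w. 2 * w + 1) (parent h u) = map_option b (parent f v)"
      using par [of v] v u by (simp add: parent_graft)
    show ?thesis
    proof (cases "parent h u")
      case None
      then show ?thesis using p v u by (simp add: parent_restrict u_def [symmetric])
    next
      case (Some w')
      then obtain w where w: "parent f v = Some w" "b w = Suc (2 * w')" using p by (cases "parent f v") auto
      then have "w \<in> verts f - A" using parent_in_verts(2) inC by blast
      then show ?thesis using Some w v by (simp add: parent_restrict halve_def u_def [symmetric])
    qed
  qed
  have VA: "verts f \<inter> A = A" "verts f \<inter> (verts f - A) = verts f - A" using Af by auto
  show "halve A b \<in> shape_isos (restrict_forest f A) g"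
    unfolding shape_isos_iff shape_map_def bij_betw_def verts_simps VA
    using injA imA parA by (simp add: halve_def)
  show "halve (verts f - A) b \<in> shape_isos (restrict_forest f (verts f - A)) h"
    unfolding shape_isos_iff shape_map_def bij_betw_def verts_simps VA
    using injC imC parC by (simp add: halve_def)
  show "glue_map f A (halve A b) (halve (verts f - A) b) = b"
  proof (rule extensionalityI [OF _ ext])
    fix v assume v: "v \<in> verts f"
    show "glue_map f A (halve A b) (halve (verts f - A) b) v = b v"
      using v A(1) [of v] C(1) [of v] by (cases "v \<in> A") (simp_all add: glue_map_def halve_def)
  qed (simp add: glue_map_def)
  show "glue_graft f g A (halve A b) (halve (verts f - A) b) = \<phi>"
  proof (rule extensionalityI)
    show "\<phi> \<in> extensional (roots g)" using \<phi> by (simp add: PiE_iff)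
    fix r assume r: "r \<in> roots g"
    then have rg: "r \<in> verts g" "parent g r = None" by (simp_all add: roots_def)
    then obtain v where v: "v \<in> A" "b v = 2 * r" using surjA by blast
    then have "halve A b v = r" by (simp add: halve_def)
    then have inv: "inv_into A (halve A b) r = v" using inv_into_f_f [OF injA v(1)] by simp
    have p: "parent ?G (2 * r) = map_option b (parent f v)" using par [of v] v Af by auto
    have "map_option (halve (verts f - A) b) (parent f v) = \<phi> r"
    proof (cases "\<phi> r")
      case None
      then show ?thesis using p rg by (simp add: parent_graft)
    next
      case (Some w)
      then obtain w' where w': "parent f v = Some w'" "b w' = Suc (2 * w)"
        using p rg \<phi>h [OF r Some] by (cases "parent f v") (simp_all add: parent_graft)
      then have "w' \<in> verts f - A" using parent_in_verts(2) inC by blast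
      then show ?thesis using Some w' by (simp add: halve_def)
    qed
    then show "glue_graft f g A (halve A b) (halve (verts f - A) b) r = \<phi> r"
      using r inv by (simp add: glue_graft_def)
  qed (simp add: glue_graft_def)
qed

lemma glue_iso:
  fixes f :: "'u forest" and g h :: "'w forest"
  assumes D: "A \<in> down_sets f" and b: "b \<in> shape_isos (restrict_forest f A) g"
    and c: "c \<in> shape_isos (restrict_forest f (verts f - A)) h"
  shows "glue_graft f g A b c \<in> roots g \<rightarrow>\<^sub>E insert None (Some ` verts h)"
    and "glue_map f A b c \<in> shape_isos f (graft (glue_graft f g A b c) g h)"
    and "even_part f (glue_map f A b c) = A"
    and "halve A (glue_map f A b c) = b" and "halve (verts f - A) (glue_map f A b c) = c"
proof -
  let ?\<phi> = "glue_graft f g A b c" and ?b = "glue_map f A b c"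
  have Af: "A \<subseteq> verts f" by (rule down_setD [OF D])
  have VA: "verts f \<inter> A = A" "verts f \<inter> (verts f - A) = verts f - A" using Af by auto
  have bA: "bij_betw b A (verts g)" "b \<in> extensional A"
    and bp: "\<And>v. v \<in> A \<Longrightarrow> parent g (b v) = map_option b (parent (restrict_forest f A) v)"
    using b unfolding shape_isos_iff shape_map_def verts_simps VA by auto
  have cA: "bij_betw c (verts f - A) (verts h)" "c \<in> extensional (verts f - A)"
    and cp: "\<And>v. v \<in> verts f - A \<Longrightarrow> parent h (c v) = map_option c (parent (restrict_forest f (verts f - A)) v)"
    using c unfolding shape_isos_iff shape_map_def verts_simps VA by auto
  have b_val: "?b v = 2 * b v" if "v \<in> A" for v using that Af by (auto simp: glue_map_def)
  have c_val: "?b v = Suc (2 * c v)" if "v \<in> verts f - A" for v using that by (auto simp: glue_map_def)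
  have inv: "inv_into A b (b v) = v" if "v \<in> A" for v
    using that bA(1) by (auto simp: bij_betw_def)
  have rootA: "\<exists>v\<in>A. r = b v \<and> (\<forall>w. parent f v = Some w \<longrightarrow> w \<in> verts f - A)" if r: "r \<in> roots g" for r
  proof -
    have "r \<in> b ` A" using r bij_betw_imp_surj_on [OF bA(1)] by (simp add: roots_def)
    then obtain v where v: "v \<in> A" "r = b v" by (elim imageE) simp
    have "w \<in> verts f - A" if "parent f v = Some w" for w
    proof -
      have "map_option b (parent (restrict_forest f A) v) = None"
        using bp [OF v(1)] r v by (simp add: roots_def)
      then show ?thesis
        using v that parent_in_verts(2) [OF that] by (auto simp: parent_restrict split: if_splits)
    qed
    then show ?thesis using v by blast
  qed
  show \<phi>: "?\<phi> \<in> roots g \<rightarrow>\<^sub>E insert None (Some ` verts h)"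
  proof (rule PiE_I)
    fix r assume r: "r \<in> roots g"
    then obtain v where v: "v \<in> A" "r = b v" "\<And>w. parent f v = Some w \<Longrightarrow> w \<in> verts f - A"
      using rootA by blast
    then have "?\<phi> r = map_option c (parent f v)" using r inv by (simp add: glue_graft_def)
    then show "?\<phi> r \<in> insert None (Some ` verts h)"
      using v(3) bij_betw_apply [OF cA(1)] by (cases "parent f v") auto
  qed (simp add: glue_graft_def)
  have \<phi>_val: "?\<phi> (b v) = map_option c (parent f v)" if "v \<in> A" "b v \<in> roots g" for v
    using that inv by (simp add: glue_graft_def)
  have "bij_betw ?b (verts f) (join (verts g) (verts h))"
  proof -
    have "bij_betw ?b A ((\<lambda>v. 2 * v) ` verts g)"
    proof -
      have "bij_betw (\<lambda>v. 2 * b v) A ((\<lambda>v. 2 * v) ` verts g)"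
        using bij_betw_imp_surj_on [OF bA(1), symmetric] bij_betw_imp_inj_on [OF bA(1)]
        by (intro bij_betw_imageI) (simp_all add: inj_on_def image_image)
      then show ?thesis by (simp only: bij_betw_cong [OF b_val])
    qed
    moreover have "bij_betw ?b (verts f - A) ((\<lambda>v. 2 * v + 1) ` verts h)"
    proof -
      have "bij_betw (\<lambda>v. Suc (2 * c v)) (verts f - A) ((\<lambda>v. 2 * v + 1) ` verts h)"
        using bij_betw_imp_surj_on [OF cA(1), symmetric] bij_betw_imp_inj_on [OF cA(1)]
        by (intro bij_betw_imageI) (simp_all add: inj_on_def image_image)
      then show ?thesis by (simp only: bij_betw_cong [OF c_val])
    qed
    ultimately have "bij_betw ?b (A \<union> (verts f - A)) (join (verts g) (verts h))"
      unfolding join_def by (rule bij_betw_combine [OF _ _ even_odd_disjoint])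
    moreover have "A \<union> (verts f - A) = verts f" using Af by auto
    ultimately show ?thesis by simp
  qed
  moreover have "parent (graft ?\<phi> g h) (?b v) = map_option ?b (parent f v)" if v: "v \<in> verts f" for v
  proof (cases "v \<in> A")
    case True
    then have bg: "b v \<in> verts g" using bA(1) by (auto simp: bij_betw_apply)
    show ?thesis
    proof (cases "parent (restrict_forest f A) v")
      case None
      then have "parent g (b v) = None" using bp [OF True] by simp
      then have r: "b v \<in> roots g" using bg by (simp add: roots_def)
      have "\<And>w. parent f v = Some w \<Longrightarrow> w \<in> verts f - A"
        using None True parent_in_verts(2) [of f v] by (auto simp: parent_restrict split: if_splits)
      then show ?thesis
        using True r bg \<open>parent g (b v) = None\<close> c_val bij_betw_apply [OF cA(1)]
        by (cases "parent f v") (auto simp: b_val parent_graft \<phi>_val)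
    next
      case (Some w)
      then have "parent f v = Some w" "w \<in> A" by (auto simp: parent_restrict split: if_splits option.splits)
      moreover have "parent g (b v) = Some (b w)" using bp [OF True] Some by simp
      ultimately show ?thesis using True bg by (simp add: b_val parent_graft)
    qed
  next
    case False
    then have vC: "v \<in> verts f - A" using v by simp
    have "w \<in> verts f - A" if "parent f v = Some w" for w
      using that down_setD(2) [OF D that] False parent_in_verts(2) by blast
    then show ?thesis
      using vC cp [OF vC] by (cases "parent f v") (auto simp: c_val parent_graft parent_restrict)
  qed
  ultimately show "?b \<in> shape_isos f (graft ?\<phi> g h)"
    unfolding shape_isos_iff shape_map_def verts_graft by (simp add: glue_map_def)
  show "even_part f ?b = A"
    using Af by (auto simp: even_part_def glue_map_def)
  show "halve A ?b = b"
    by (rule extensionalityI [OF _ bA(2)]) (simp_all add: halve_def b_val)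
  show "halve (verts f - A) ?b = c"
    by (rule extensionalityI [OF _ cA(2)]) (simp_all add: halve_def c_val)
qed

text \<open>
  The labels of \<open>f\<close> are paired with the same labels on both sides of the bijection.
\<close>

lemma pair_gen_gl_gen:
  "pairing (gen f) (gl_gen g h) =
    (\<Sum>A\<in>down_sets f. pair_gen (restrict_forest f A) g * pair_gen (restrict_forest f (verts f - A)) h)"
proof -
  let ?\<Phi> = "roots g \<rightarrow>\<^sub>E insert None (Some ` verts h)"
  let ?S = "Sigma ?\<Phi> (\<lambda>\<phi>. shape_isos f (graft \<phi> g h))"
  let ?T = "Sigma (down_sets f) (\<lambda>A. shape_isos (restrict_forest f A) g \<times> shape_isos (restrict_forest f (verts f - A)) h)"
  define E where "E g A b = (\<Prod>v\<in>A. eval_dual (label f v) (label g (b v)))" for g :: "'a forest" and A b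
  have fin: "finite ?\<Phi>" by (intro finite_PiE) (auto simp: roots_def)
  have "pairing (gen f) (gl_gen g h) = (\<Sum>\<phi>\<in>?\<Phi>. \<Sum>b\<in>shape_isos f (graft \<phi> g h). E (graft \<phi> g h) (verts f) b)"
    by (simp add: gl_gen_def linear_sum [OF linear_pairing(1)] pairing_gen pair_gen_def E_def)
  also have "\<dots> = (\<Sum>(\<phi>, b)\<in>?S. E (graft \<phi> g h) (verts f) b)"
    by (rule sum.Sigma) (simp_all add: fin)
  also have "\<dots> = (\<Sum>(A, b, c)\<in>?T. E g A b * E h (verts f - A) c)"
  proof (rule sum.reindex_bij_witness
      [where j = "\<lambda>(\<phi>, b). (even_part f b, halve (even_part f b) b, halve (verts f - even_part f b) b)"
        and i = "\<lambda>(A, b, c). (glue_graft f g A b c, glue_map f A b c)"], goal_cases)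
    case (1 a)
    then show ?case using split_iso(4,5) by (auto simp: split_beta)
  next
    case (2 a)
    then show ?case using split_iso(1-3) by (auto simp: split_beta)
  next
    case (3 t)
    then obtain A b c where t: "t = (A, b, c)" "A \<in> down_sets f"
      "b \<in> shape_isos (restrict_forest f A) g" "c \<in> shape_isos (restrict_forest f (verts f - A)) h"
      by auto
    then show ?case using glue_iso(3-5) [OF t(2-4)] by simp
  next
    case (4 t)
    then obtain A b c where t: "t = (A, b, c)" "A \<in> down_sets f"
      "b \<in> shape_isos (restrict_forest f A) g" "c \<in> shape_isos (restrict_forest f (verts f - A)) h"
      by auto
    then show ?case using glue_iso(1,2) [OF t(2-4)] by simp
  next
    case (5 a)
    then obtain \<phi> b where a: "a = (\<phi>, b)" "\<phi> \<in> ?\<Phi>" "b \<in> shape_isos f (graft \<phi> g h)" by auto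
    let ?A = "even_part f b"
    have Af: "?A \<subseteq> verts f" by (auto simp: even_part_def)
    have "E (graft \<phi> g h) (verts f) b = E (graft \<phi> g h) (verts f - ?A) b * E (graft \<phi> g h) ?A b"
      unfolding E_def by (rule prod.subset_diff [OF Af]) simp
    also have "E (graft \<phi> g h) ?A b = E g ?A (halve ?A b)"
      unfolding E_def by (rule prod.cong) (auto simp: halve_def even_part_def)
    also have "E (graft \<phi> g h) (verts f - ?A) b = E h (verts f - ?A) (halve (verts f - ?A) b)"
      unfolding E_def by (rule prod.cong) (auto simp: halve_def even_part_def)
    finally show ?case by (simp add: a mult.commute)
  qed
  also have "\<dots> = (\<Sum>A\<in>down_sets f. \<Sum>(b, c)\<in>shape_isos (restrict_forest f A) g \<times> shape_isos (restrict_forest f (verts f - A)) h.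
      E g A b * E h (verts f - A) c)"
    by (subst sum.Sigma) (auto intro: finite_cartesian_product simp: split_beta)
  also have "\<dots> = (\<Sum>A\<in>down_sets f. pair_gen (restrict_forest f A) g * pair_gen (restrict_forest f (verts f - A)) h)"
  proof (rule sum.cong)
    fix A assume "A \<in> down_sets f"
    then have "A \<subseteq> verts f" by (rule down_setD)
    then have "verts f \<inter> A = A" "verts f \<inter> (verts f - A) = verts f - A" by auto
    then show "(\<Sum>(b, c)\<in>shape_isos (restrict_forest f A) g \<times> shape_isos (restrict_forest f (verts f - A)) h.
        E g A b * E h (verts f - A) c) =
      pair_gen (restrict_forest f A) g * pair_gen (restrict_forest f (verts f - A)) h"
      by (simp add: pair_gen_def E_def sum_product sum.cartesian_product)
  qed simp
  finally show ?thesis .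
qed

text \<open>
  The Grossman--Larson product is dual to the coproduct of Connes and Kreimer.
\<close>

theorem pairing_gl_prod:
  "pairing x (gl_prod X Y) = split_sum (\<lambda>u v. pairing u X * pairing v Y) x"
proof -
  have b: "bilinear (\<lambda>u v. pairing u X * pairing v Y)" for X Y :: "'a hopf"
    by (rule bilinear_mult_functionals [OF linear_pairing(2) linear_pairing(2)])
  have "pairing (gen f) (gl_prod X Y) = split_sum (\<lambda>u v. pairing u X * pairing v Y) (gen f)" for f
  proof (rule bilinear_eq_on_gen [where \<beta> = "\<lambda>X Y. pairing (gen f) (gl_prod X Y)"])
    show "bilinear (\<lambda>X Y. pairing (gen f) (gl_prod X Y))"
      by (rule bilinear_compose_linear [OF linear_pairing(1) bilinear_gl_prod])
    show "bilinear (\<lambda>X Y. split_sum (\<lambda>u v. pairing u X * pairing v Y) (gen f))"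
      unfolding split_sum_gen [OF b] bilinear_def
      by (intro conjI allI linear_compose_sum ballI linear_mult_const linear_pairing
          linear_compose_scale_right [where 'b = real, unfolded real_scaleR_def])
    show "pairing (gen f) (gl_prod (gen g) (gen h)) = split_sum (\<lambda>u v. pairing u (gen g) * pairing v (gen h)) (gen f)" for g h
      by (simp add: gl_prod_gen pair_gen_gl_gen split_sum_gen [OF b] pairing_gen)
  qed
  then show ?thesis
    by (rule linear_eq_on_gen [OF linear_pairing(2) linear_split_sum [OF b]])
qed

section \<open>Rough paths that factor through an arborification map\<close>

lemma split_sum_zero: "split_sum (\<lambda>_ _. 0) x = 0"
proof -
  have b: "bilinear (\<lambda>_ _. 0)" by (simp add: bilinear_def linear_zero)
  show ?thesis
    by (rule linear_eq_on_gen [OF linear_split_sum [OF b] linear_zero]) (simp add: split_sum_gen [OF b])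
qed

lemma linear_growth_word: "linear (\<lambda>p. growth_word (ps @ p # qs))"
proof (induction qs rule: rev_induct)
  case Nil
  then show ?case by (simp add: linear_natural_growth)
next
  case (snoc q qs)
  have "growth_word (ps @ p # qs @ [q]) = natural_growth (growth_word (ps @ p # qs)) q" for p
    using growth_word_snoc [of "ps @ p # qs" q] by simp
  then show ?case by (simp add: linear_comp_left [OF bilinear_natural_growth snoc])
qed

text \<open>
  A curried form, to be used with \<open>list_all2\<close>: a single entry of a word can then be exchanged while the
  list of degrees is kept.
\<close>

definition homogeneous_primitive :: "'u::real_vector hopf \<Rightarrow> nat \<Rightarrow> bool" where
  "homogeneous_primitive p n \<longleftrightarrow> p \<in> primitives \<and> p \<in> hopf_deg n"

lemma graded_word_degrees:
  "graded_word ps n \<Longrightarrow> \<exists>ns. list_all2 homogeneous_primitive ps ns \<and> sum_list ns = n"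
proof (induction rule: graded_word.induct)
  case Nil
  show ?case by (intro exI [of _ "[]"]) simp
next
  case (snoc ps m p n)
  then obtain ns where "list_all2 homogeneous_primitive ps ns" "sum_list ns = m" by blast
  moreover have "homogeneous_primitive p n" using snoc by (simp add: homogeneous_primitive_def)
  ultimately show ?case
    by (intro exI [of _ "ns @ [n]"]) (simp add: list_all2_appendI)
qed

lemma growth_word_degrees:
  "list_all2 homogeneous_primitive ps ns \<Longrightarrow> growth_word ps \<in> hopf_deg (sum_list ns)"
proof (induction ps arbitrary: ns rule: rev_induct)
  case Nil
  then show ?case by (simp add: hone_deg)
next
  case (snoc p ps)
  then obtain ms n where ns: "ns = ms @ [n]" "list_all2 homogeneous_primitive ps ms" "homogeneous_primitive p n"
    by (auto simp: list_all2_append1 list_all2_Cons1)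
  then show ?case using snoc.IH [OF ns(2)] by (simp add: homogeneous_primitive_def natural_growth_deg)
qed

lemma list_all2_primitives: "list_all2 homogeneous_primitive ps ns \<Longrightarrow> set ps \<subseteq> primitives"
  by (auto simp: homogeneous_primitive_def list_all2_conv_all_nth in_set_conv_nth)

lemma hopf_deg_subspace: "subspace (hopf_deg n)"
  by (simp add: hopf_deg_def)

text \<open>
  The map \<open>sig\<close> is a linear section of \<open>letter\<close> by forests without edges, and \<open>Q\<close> singles out the forests
  that generate the kernel of \<open>lam\<close> on the primitive elements.
\<close>

locale graded_arborification = arborification lam m \<iota>
  for lam :: "'u::real_vector forest \<Rightarrow> 'w::real_vector" and m \<iota> +
  fixes sig :: "'w \<Rightarrow> 'u hopf" and Q :: "'u forest \<Rightarrow> bool" and deg :: "nat \<Rightarrow> 'w list pvec set"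
    and words :: "nat \<Rightarrow> 'w list set"
  assumes linear_sig: "linear sig"
    and letter_sig: "letter (sig w) = w"
    and sig_lam: "\<not> Q f \<Longrightarrow> verts f \<noteq> {} \<Longrightarrow> sig (lam f) = gen f"
    and lam_Q: "Q f \<Longrightarrow> lam f = 0"
    and deg_eq: "deg n = span (gen ` words n)"
    and words_deg: "ws \<in> words n \<Longrightarrow> growth_word (map (\<lambda>w. prim_part (sig w)) ws) \<in> hopf_deg n"
begin

definition sec :: "'w \<Rightarrow> 'u hopf" where
  "sec w = prim_part (sig w)"

lemma linear_sec: "linear sec"
  unfolding sec_def [abs_def] using linear_compose [OF linear_sig linear_prim_part] by (simp add: o_def)

lemma sec_primitive: "sec w \<in> primitives"
  by (simp add: sec_def prim_part_primitive)

text \<open>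
  The terms that \<open>\<pi>\<close> subtracts from \<open>x\<close> are growths, on which \<open>letter\<close> vanishes.
\<close>

lemma letter_prim_part: "letter (prim_part x) = letter x"
proof -
  have "letter (split_sum (\<lambda>u v. natural_growth (plus_part u) (prim_part v)) x) = 0"
    by (simp add: linear_split_sum_image [OF linear_letter bilinear_plus_growth [OF linear_prim_part]]
        letter_growth plus_part_in_hopf_plus primitive_hopf_plus prim_part_primitive split_sum_zero)
  then have "letter (prim_part x) = letter (plus_part x)"
    by (subst prim_part_eq) (simp add: linear_diff [OF linear_letter])
  then show ?thesis
    by (simp add: plus_part_def linear_diff [OF linear_letter] linear_scale [OF linear_letter])
qed

lemma letter_sec [simp]: "letter (sec w) = w"
  by (simp add: sec_def letter_prim_part letter_sig)

lemma complement_primitive: "primitives_generated_by Q \<subseteq> primitives"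
  unfolding primitives_generated_by_def prim_proj_eq
  by (rule span_minimal [OF _ subspace_primitives]) (auto simp: prim_part_primitive)

lemma letter_complement:
  assumes "p \<in> primitives_generated_by Q" shows "letter p = 0"
  using assms unfolding primitives_generated_by_def prim_proj_eq
proof (rule linear_eq_0_on_span [OF linear_letter, rotated])
  fix x assume "x \<in> {prim_part (gen f) | f. Q f}"
  then obtain f where "x = prim_part (gen f)" "Q f" by blast
  then show "letter x = 0" by (simp add: letter_prim_part letter_gen lam_Q)
qed

text \<open>
  Checked on forests: \<open>letter\<close> kills those with \<open>Q\<close>, and \<open>sig\<close> recovers the others.
\<close>

lemma prim_part_minus_sec: "prim_part x - sec (letter x) \<in> primitives_generated_by Q"
  unfolding primitives_generated_by_def prim_proj_eq
proof (rule linear_preserves_span [where F = "\<lambda>x. prim_part x - sec (letter x)" and S = "range gen"])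
  show "linear (\<lambda>x. prim_part x - sec (letter x))"
    using linear_compose [OF linear_letter linear_sec]
    by (intro linear_compose_sub linear_prim_part) (simp add: o_def)
  show "x \<in> span (range gen)" by (simp add: span_gen)
  fix y :: "'u hopf" assume "y \<in> range gen"
  then obtain f where y: "y = gen f" by blast
  consider "verts f = {}" | "verts f \<noteq> {}" "\<not> Q f" | "Q f" by blast
  then show "prim_part y - sec (letter y) \<in> span {prim_part (gen f) | f. Q f}"
  proof cases
    case 1
    then show ?thesis by (simp add: y gen_empty linear_0 [OF linear_sec] span_zero)
  next
    case 2
    then show ?thesis by (simp add: y letter_gen sec_def sig_lam span_zero)
  next
    case 3
    then show ?thesis by (auto simp: y letter_gen lam_Q linear_0 [OF linear_sec] intro!: span_base)
  qed
qed

text \<open>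
  Since \<open>letter\<close> vanishes on the second summand and has the section \<open>sec\<close>, the sum is direct; the lemma
  above decomposes \<open>p = \<pi>(p)\<close>.
\<close>

theorem complement: "direct_complement primitives (range sec) (primitives_generated_by Q)"
  unfolding direct_complement_def
proof (intro conjI)
  show "subspace primitives" by (rule subspace_primitives)
  show "subspace (range sec)" by (rule linear_subspace_image [OF linear_sec subspace_UNIV])
  show sD: "subspace (primitives_generated_by Q)" by (simp add: primitives_generated_by_def)
  show "range sec \<inter> primitives_generated_by Q = {0}"
  proof (intro equalityI subsetI)
    fix x assume "x \<in> range sec \<inter> primitives_generated_by Q"
    then obtain w where w: "x = sec w" "x \<in> primitives_generated_by Q" by auto
    then have "w = 0" using letter_complement [of x] by simp
    then show "x \<in> {0}" using w by (simp add: linear_0 [OF linear_sec])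
  next
    fix x :: "'u hopf" assume "x \<in> {0}"
    then have "x = sec 0" "x \<in> primitives_generated_by Q"
      using subspace_0 [OF sD] by (auto simp: linear_0 [OF linear_sec])
    then show "x \<in> range sec \<inter> primitives_generated_by Q" by blast
  qed
  show "primitives = {s + d | s d. s \<in> range sec \<and> d \<in> primitives_generated_by Q}"
  proof (intro equalityI subsetI)
    fix p :: "'u hopf" assume p: "p \<in> primitives"
    then have "p = sec (letter p) + (prim_part p - sec (letter p))" by (simp add: prim_part_id)
    then show "p \<in> {s + d | s d. s \<in> range sec \<and> d \<in> primitives_generated_by Q}"
      using prim_part_minus_sec [of p] by blast
  next
    fix x assume "x \<in> {s + d | s d. s \<in> range sec \<and> d \<in> primitives_generated_by Q}"
    then show "x \<in> primitives"
      using complement_primitive sec_primitive subspace_add [OF subspace_primitives] by auto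
  qed
qed

text \<open>
  A right inverse of the arborification map.
\<close>

definition tau :: "'w list pvec \<Rightarrow> 'u hopf" where
  "tau = linext (\<lambda>ws. growth_word (map sec ws))"

lemma descends_tau: "descends (\<lambda>ws. growth_word (map sec ws))"
proof (rule descends_listI)
  show "linear (\<lambda>a. growth_word (map sec (u @ a # v)))" for u v
    using linear_compose [OF linear_sec linear_growth_word] by (simp add: o_def)
qed

lemma linear_tau: "linear tau"
  unfolding tau_def by (rule linext [OF descends_tau])

lemma tau_gen: "tau (gen ws) = growth_word (map sec ws)"
  unfolding tau_def by (rule linext [OF descends_tau])

lemma arb_tau: "arb (tau x) = x"
proof (rule linear_eq_on_gen [OF linear_compose [OF linear_tau linear_arb, unfolded o_def] linear_id_fun])
  show "arb (tau (gen ws)) = gen ws" for ws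
  proof -
    have "set (map sec ws) \<subseteq> primitives" using sec_primitive by auto
    then show ?thesis by (simp add: tau_gen arb_growth_word o_def)
  qed
qed

lemma tau_deg: "x \<in> deg n \<Longrightarrow> tau x \<in> hopf_deg n"
proof -
  assume "x \<in> deg n"
  then have x: "x \<in> span (gen ` words n)" by (simp add: deg_eq)
  show ?thesis
    unfolding hopf_deg_def
  proof (rule linear_preserves_span [OF linear_tau x])
    fix y :: "'w list pvec" assume "y \<in> gen ` words n"
    then obtain ws where "y = gen ws" "ws \<in> words n" by blast
    then show "tau y \<in> span {gen f | f. weight f = n}"
      using words_deg [of ws n] by (simp add: tau_gen sec_def [abs_def] hopf_deg_def)
  qed
qed

lemma sec_letter_deg:
  assumes "x \<in> hopf_deg n" shows "sec (letter x) \<in> hopf_deg n"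
proof -
  have "sig (letter x) \<in> hopf_deg n"
    unfolding hopf_deg_def
  proof (rule linear_preserves_span [where F = "\<lambda>x. sig (letter x)"])
    show "linear (\<lambda>x. sig (letter x))"
      using linear_compose [OF linear_letter linear_sig] by (simp add: o_def)
    show "x \<in> span {gen f | f. weight f = n}" using assms by (simp add: hopf_deg_def)
    fix y :: "'u hopf" assume "y \<in> {gen f | f. weight f = n}"
    then obtain f where f: "y = gen f" "weight f = n" by blast
    consider "verts f = {} \<or> Q f" | "verts f \<noteq> {}" "\<not> Q f" by blast
    then show "sig (letter y) \<in> span {gen f | f. weight f = n}"
    proof cases
      case 1
      then have "lam f = 0" using lam_empty lam_Q by blast
      then show ?thesis by (simp add: f letter_gen linear_0 [OF linear_sig] span_zero)
    next
      case 2
      then show ?thesis using f by (auto simp: letter_gen sig_lam intro!: span_base)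
    qed
  qed
  then show ?thesis by (simp add: sec_def prim_part_deg)
qed

text \<open>
  Replacing an entry \<open>q\<close> of a growth word by \<open>sec (letter q)\<close> changes the word by one with the entry
  \<open>q - sec (letter q)\<close> in the complement, hence does not change the value of \<open>F\<close>. After all entries are
  replaced, the word is the image of the original one under \<open>tau \<circ> arb\<close>. Both words have the same degree, so that
  \<open>F\<close> vanishes at both when that degree exceeds \<open>N\<close>.
\<close>

theorem functional_factors:
  fixes F :: "'u hopf \<Rightarrow> real"
  assumes F: "linear F"
    and vanish: "\<And>ps. set ps \<subseteq> primitives \<Longrightarrow> growth_word ps \<in> hopf_le N \<Longrightarrow>
      (\<exists>p\<in>set ps. p \<in> primitives_generated_by Q) \<Longrightarrow> F (growth_word ps) = 0"
    and above: "\<And>n x. N < n \<Longrightarrow> x \<in> hopf_deg n \<Longrightarrow> F x = 0"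
  shows "F (tau (arb x)) = F x"
proof -
  let ?r = "\<lambda>p. sec (letter p)"
  have hom_r: "homogeneous_primitive (?r p) n" if "homogeneous_primitive p n" for p n
    using that by (simp add: homogeneous_primitive_def sec_letter_deg sec_primitive)
  have replace: "F (growth_word (ps @ qs)) = F (growth_word (ps @ map ?r qs))"
    if "list_all2 homogeneous_primitive ps ns" "list_all2 homogeneous_primitive qs ms"
      "sum_list ns + sum_list ms \<le> N" for ps qs ns ms
    using that
  proof (induction qs arbitrary: ps ns ms)
    case Nil
    then show ?case by simp
  next
    case (Cons q qs)
    then obtain k ks where ms: "ms = k # ks" "homogeneous_primitive q k" "list_all2 homogeneous_primitive qs ks"
      by (auto simp: list_all2_Cons1)
    \<comment> \<open>The word with \<open>q\<close> replaced by its component in the complement has the same degree.\<close>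
    let ?d = "q - ?r q"
    have "homogeneous_primitive ?d k"
      using ms(2) hom_r [OF ms(2)] subspace_diff [OF subspace_primitives] subspace_diff [OF hopf_deg_subspace]
      by (auto simp: homogeneous_primitive_def)
    then have all: "list_all2 homogeneous_primitive (ps @ ?d # qs) (ns @ k # ks)"
      using Cons.prems(1) ms(3) by (intro list_all2_appendI) auto
    have "growth_word (ps @ ?d # qs) \<in> hopf_le N"
      using growth_word_degrees [OF all] Cons.prems(3) ms(1) by (intro hopf_deg_le) simp_all
    moreover have "?d \<in> primitives_generated_by Q"
      using prim_part_minus_sec [of q] ms(2) by (simp add: prim_part_id homogeneous_primitive_def)
    ultimately have "F (growth_word (ps @ ?d # qs)) = 0"
      using list_all2_primitives [OF all] by (intro vanish) auto
    then have "F (growth_word (ps @ q # qs)) = F (growth_word ((ps @ [?r q]) @ qs))"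
      by (simp add: linear_diff [OF linear_growth_word] linear_diff [OF F])
    also have "\<dots> = F (growth_word ((ps @ [?r q]) @ map ?r qs))"
    proof (rule Cons.IH)
      show "list_all2 homogeneous_primitive (ps @ [?r q]) (ns @ [k])"
        using Cons.prems(1) hom_r [OF ms(2)] by (intro list_all2_appendI) auto
      show "list_all2 homogeneous_primitive qs ks" by (rule ms)
      show "sum_list (ns @ [k]) + sum_list ks \<le> N" using Cons.prems(3) ms(1) by simp
    qed
    finally show ?case by simp
  qed
  show ?thesis
  proof (rule linear_eq_on_growth_words [where F = "\<lambda>x. F (tau (arb x))"])
    show "linear (\<lambda>x. F (tau (arb x)))"
      using linear_compose [OF linear_compose [OF linear_arb linear_tau] F] by (simp add: o_def)
    show "linear F" by (rule F)
    fix ps :: "'u hopf list" and n assume ps: "graded_word ps n"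
    then obtain ns where ns: "list_all2 homogeneous_primitive ps ns" "sum_list ns = n"
      using graded_word_degrees by blast
    have ns': "list_all2 homogeneous_primitive (map ?r ps) ns"
      using ns(1) hom_r by (auto simp: list_all2_conv_all_nth)
    have "tau (arb (growth_word ps)) = growth_word (map ?r ps)"
      using ps by (simp add: arb_growth_word graded_word_primitives tau_gen o_def)
    moreover have "F (growth_word (map ?r ps)) = F (growth_word ps)"
    proof (cases "n \<le> N")
      case True
      then show ?thesis using replace [of "[]" "[]" ps ns] ns by simp
    next
      case False
      then show ?thesis
        using above [of n "growth_word ps"] above [of n "growth_word (map ?r ps)"]
          growth_word_degrees [OF ns(1)] growth_word_degrees [OF ns'] ns(2) by simp
    qed
    ultimately show "F (tau (arb (growth_word ps))) = F (growth_word ps)" by simp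
  qed
qed

end

locale dual_arborification = graded_arborification lam m \<iota> sig Q deg words
  for lam :: "'v::real_vector dual forest \<Rightarrow> 'w::real_vector" and m \<iota> sig Q deg words
begin

text \<open>
  The factor is \<open>Z = X \<circ> tau\<close>. Each property of \<open>Z\<close> is obtained by lifting its arguments along \<open>tau\<close> and
  applying the corresponding property of \<open>X\<close>.
\<close>

theorem factors_iff_vanishes:
  fixes X :: "real \<Rightarrow> real \<Rightarrow> 'v hopf"
  assumes X: "branched_rough_path \<rho> \<omega> T X"
  shows "(\<exists>Z. dual_rough_path deg (quasi m) (gen []) deconcat \<rho> \<omega> T Z \<and>
      (\<forall>s t. 0 \<le> s \<and> s \<le> t \<and> t \<le> T \<longrightarrow> (\<forall>x. pairing x (X s t) = Z s t (arb x)))) \<longleftrightarrow>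
    (\<forall>ps. set ps \<subseteq> primitives \<and> growth_word ps \<in> hopf_le (nat \<lfloor>\<rho>\<rfloor>) \<and>
        (\<exists>p\<in>set ps. p \<in> primitives_generated_by Q) \<longrightarrow>
      (\<forall>s t. 0 \<le> s \<and> s \<le> t \<and> t \<le> T \<longrightarrow> pairing (growth_word ps) (X s t) = 0))"
  (is "(\<exists>Z. ?D Z \<and> ?F Z) \<longleftrightarrow> ?V")
proof
  assume "\<exists>Z. ?D Z \<and> ?F Z"
  then obtain Z where Z: "?D Z" "?F Z" by blast
  show ?V
  proof (intro allI impI)
    fix ps :: "'v dual hopf list" and s t :: real
    assume ps: "set ps \<subseteq> primitives \<and> growth_word ps \<in> hopf_le (nat \<lfloor>\<rho>\<rfloor>) \<and>
        (\<exists>p\<in>set ps. p \<in> primitives_generated_by Q)" and st: "0 \<le> s \<and> s \<le> t \<and> t \<le> T"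
    then obtain p where p: "p \<in> set ps" "letter p = 0" using letter_complement by blast
    then obtain qs rs where "ps = qs @ p # rs" by (meson split_list)
    then have "gen (map letter ps) = 0"
      using p linear_0 [OF linear_gen_letter [of "map letter qs" "map letter rs"]] by simp
    then have "arb (growth_word ps) = 0" using ps by (simp add: arb_growth_word)
    moreover have "linear (Z s t)" using Z(1) st by (simp add: dual_rough_path_def Let_def)
    ultimately show "pairing (growth_word ps) (X s t) = 0"
      using Z(2) st by (simp add: linear_0)
  qed
next
  assume V: ?V
  define N where "N = nat \<lfloor>\<rho>\<rfloor>"
  define Z where "Z s t y = pairing (tau y) (X s t)" for s t y
  have X1: "X s t \<in> hopf_le N" if "0 \<le> s \<and> s \<le> t \<and> t \<le> T" for s t
    using X that by (simp add: branched_rough_path_def Let_def N_def)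
  have X2: "X s t = hopf_trunc N (gl_prod (X s u) (X u t))" if "0 \<le> s \<and> s \<le> u \<and> u \<le> t \<and> t \<le> T" for s u t
    using X that unfolding branched_rough_path_def Let_def N_def by blast
  have X3: "pairing hone (X s t) = 1" if "0 \<le> s \<and> s \<le> t \<and> t \<le> T" for s t
    using X that by (simp add: branched_rough_path_def Let_def)
  have X4: "pairing (hmult (gen f) (gen g)) (X s t) = pairing (gen f) (X s t) * pairing (gen g) (X s t)"
    if "0 \<le> s \<and> s \<le> t \<and> t \<le> T" "weight f + weight g \<le> N" for s t f g
    using X that by (simp add: branched_rough_path_def Let_def N_def)
  have X5: "\<exists>C. \<forall>s t. 0 \<le> s \<and> s \<le> t \<and> t \<le> T \<longrightarrow>
      \<bar>pairing (gen f) (X s t)\<bar> \<le> C * \<omega> s t powr (real (weight f) / \<rho>)"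
    if "1 \<le> weight f" "weight f \<le> N" for f
    using X that by (simp add: branched_rough_path_def Let_def N_def)
  have above: "pairing x (X s t) = 0" if "0 \<le> s \<and> s \<le> t \<and> t \<le> T" "N < n" "x \<in> hopf_deg n" for s t n x
    by (rule pairing_above_degree [OF that(3) X1 [OF that(1)] that(2)])
  have factor: "pairing (tau (arb x)) (X s t) = pairing x (X s t)" if st: "0 \<le> s \<and> s \<le> t \<and> t \<le> T" for s t x
    by (rule functional_factors [where F = "\<lambda>x. pairing x (X s t)" and N = N, OF linear_pairing(2)])
      (use V st above [OF st] in \<open>auto simp: N_def\<close>)
  have lZ: "linear (Z s t)" for s t
    unfolding Z_def [abs_def] using linear_compose [OF linear_tau linear_pairing(2)] by (simp add: o_def)
  have mult: "pairing (hmult x y) (X s t) = pairing x (X s t) * pairing y (X s t)"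
    if st: "0 \<le> s \<and> s \<le> t \<and> t \<le> T" and x: "x \<in> hopf_deg a" and y: "y \<in> hopf_deg b" and ab: "a + b \<le> N"
    for s t x y a b
  proof -
    have l: "linear (\<lambda>x. pairing (hmult x y) (X s t))" "linear (\<lambda>y. pairing (hmult x y) (X s t))" for x y
      using bilinear_compose_linear [OF linear_pairing(2) [of "X s t"] bilinear_hmult] by (auto simp: bilinear_def)
    have l': "linear (\<lambda>x. pairing x (X s t) * pairing y (X s t))" "linear (\<lambda>y. pairing x (X s t) * pairing y (X s t))" for x y
      using bilinear_mult_functionals [OF linear_pairing(2) [of "X s t"] linear_pairing(2) [of "X s t"]]
      by (auto simp: bilinear_def)
    have "pairing (hmult (gen f) y) (X s t) = pairing (gen f) (X s t) * pairing y (X s t)" if "weight f = a" for f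
      using y unfolding hopf_deg_def
      by (rule linear_eq_on_span [OF l(2) l'(2), rotated]) (use X4 [OF st] that ab in auto)
    then have eq: "pairing (hmult z y) (X s t) = pairing z (X s t) * pairing y (X s t)"
      if "z \<in> {gen f | f. weight f = a}" for z using that by auto
    show ?thesis
      using x unfolding hopf_deg_def
      by (rule linear_eq_on_span [OF l(1) l'(1), rotated]) (rule eq)
  qed
  have bound: "\<exists>C. \<forall>s t. 0 \<le> s \<and> s \<le> t \<and> t \<le> T \<longrightarrow> \<bar>pairing x (X s t)\<bar> \<le> C * \<omega> s t powr (real n / \<rho>)"
    if x: "x \<in> hopf_deg n" and n: "1 \<le> n" "n \<le> N" for x n
  proof -
    let ?B = "\<lambda>x C. \<forall>s t. 0 \<le> s \<and> s \<le> t \<and> t \<le> T \<longrightarrow> \<bar>pairing x (X s t)\<bar> \<le> C * \<omega> s t powr (real n / \<rho>)"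
    have "subspace {x. \<exists>C. ?B x C}"
    proof (rule subspaceI)
      have "?B 0 0" by (simp add: linear_0 [OF linear_pairing(2)])
      then show "0 \<in> {x. \<exists>C. ?B x C}" by blast
      fix x y assume "x \<in> {x. \<exists>C. ?B x C}" "y \<in> {x. \<exists>C. ?B x C}"
      then obtain C C' where C: "?B x C" "?B y C'" by blast
      have "?B (x + y) (C + C')"
      proof (intro allI impI)
        fix s t assume st: "0 \<le> s \<and> s \<le> t \<and> t \<le> T"
        have "\<bar>pairing (x + y) (X s t)\<bar> \<le> \<bar>pairing x (X s t)\<bar> + \<bar>pairing y (X s t)\<bar>"
          by (simp add: linear_add [OF linear_pairing(2)])
        also have "\<dots> \<le> C * \<omega> s t powr (real n / \<rho>) + C' * \<omega> s t powr (real n / \<rho>)"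
          using C st by (intro add_mono) auto
        finally show "\<bar>pairing (x + y) (X s t)\<bar> \<le> (C + C') * \<omega> s t powr (real n / \<rho>)"
          by (simp add: algebra_simps)
      qed
      then show "x + y \<in> {x. \<exists>C. ?B x C}" by blast
    next
      fix c and x assume "x \<in> {x. \<exists>C. ?B x C}"
      then obtain C where C: "?B x C" by blast
      have "?B (c *\<^sub>R x) (\<bar>c\<bar> * C)"
      proof (intro allI impI)
        fix s t assume st: "0 \<le> s \<and> s \<le> t \<and> t \<le> T"
        have "\<bar>pairing (c *\<^sub>R x) (X s t)\<bar> = \<bar>c\<bar> * \<bar>pairing x (X s t)\<bar>"
          by (simp add: linear_scale [OF linear_pairing(2)] abs_mult)
        also have "\<dots> \<le> \<bar>c\<bar> * (C * \<omega> s t powr (real n / \<rho>))"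
          using C st by (intro mult_left_mono) auto
        finally show "\<bar>pairing (c *\<^sub>R x) (X s t)\<bar> \<le> (\<bar>c\<bar> * C) * \<omega> s t powr (real n / \<rho>)"
          by (simp add: mult.assoc)
      qed
      then show "c *\<^sub>R x \<in> {x. \<exists>C. ?B x C}" by blast
    qed
    moreover have "{gen f | f. weight f = n} \<subseteq> {x. \<exists>C. ?B x C}"
      using X5 n by auto
    ultimately have "span {gen f | f. weight f = n} \<subseteq> {x. \<exists>C. ?B x C}"
      by (intro span_minimal)
    then show ?thesis using x by (auto simp: hopf_deg_def)
  qed
  have "?D Z"
    unfolding dual_rough_path_def Let_def N_def [symmetric]
  proof (intro conjI allI impI ballI)
    fix s t :: real assume st: "0 \<le> s \<and> s \<le> t \<and> t \<le> T"
    show "linear (Z s t)" by (rule lZ)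
    show "Z s t y = 0" if "n > N" "y \<in> deg n" for n y
      unfolding Z_def by (rule above [OF st that(1) tau_deg [OF that(2)]])
    show "Z s t (gen []) = 1" by (simp add: Z_def tau_gen X3 [OF st])
  next
    fix s u t :: real and n y
    assume sut: "0 \<le> s \<and> s \<le> u \<and> u \<le> t \<and> t \<le> T" and n: "n \<le> N" and y: "y \<in> deg n"
    have st: "0 \<le> s \<and> s \<le> t \<and> t \<le> T" and su: "0 \<le> s \<and> s \<le> u \<and> u \<le> T" and ut: "0 \<le> u \<and> u \<le> t \<and> t \<le> T"
      using sut by auto
    have b: "bilinear (\<lambda>a b. Z s u a * Z u t b)" by (rule bilinear_mult_functionals [OF lZ lZ])
    have "Z s t y = pairing (tau y) (gl_prod (X s u) (X u t))"
      unfolding Z_def by (subst X2 [OF sut]) (rule pairing_trunc [OF tau_deg [OF y] n])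
    also have "\<dots> = split_sum (\<lambda>a b. pairing a (X s u) * pairing b (X u t)) (tau y)"
      by (rule pairing_gl_prod)
    also have "\<dots> = split_sum (\<lambda>a b. Z s u (arb a) * Z u t (arb b)) (tau y)"
      by (simp add: Z_def factor [OF su] factor [OF ut])
    also have "\<dots> = cut_sum (\<lambda>a b. Z s u a * Z u t b) (arb (tau y))"
      by (rule cut_sum_arb [OF b, symmetric])
    also have "\<dots> = linext (\<lambda>(a, b). Z s u (gen a) * Z u t (gen b)) (deconcat y)"
      by (simp add: arb_tau linext_deconcat [OF b])
    finally show "Z s t y = linext (\<lambda>(a, b). Z s u (gen a) * Z u t (gen b)) (deconcat y)" .
  next
    fix a b x y and s t :: real
    assume ab: "a + b \<le> N" and x: "x \<in> deg a" and y: "y \<in> deg b" and st: "0 \<le> s \<and> s \<le> t \<and> t \<le> T"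
    have "Z s t (quasi m x y) = pairing (tau (arb (hmult (tau x) (tau y)))) (X s t)"
      by (simp add: Z_def arb_hmult arb_tau)
    also have "\<dots> = Z s t x * Z s t y"
      by (simp add: factor [OF st] mult [OF st tau_deg [OF x] tau_deg [OF y] ab] Z_def)
    finally show "Z s t (quasi m x y) = Z s t x * Z s t y" .
  next
    fix n y assume "1 \<le> n \<and> n \<le> N" "y \<in> deg n"
    then show "\<exists>C. \<forall>s t. 0 \<le> s \<and> s \<le> t \<and> t \<le> T \<longrightarrow> \<bar>Z s t y\<bar> \<le> C * \<omega> s t powr (real n / \<rho>)"
      unfolding Z_def by (intro bound tau_deg) auto
  qed
  moreover have "?F Z" by (auto simp: Z_def factor)
  ultimately show "\<exists>Z. ?D Z \<and> ?F Z" by blast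
qed

end

section \<open>Shuffle and quasi-shuffle arborification\<close>

lemma no_edge_single_vertex: "weight f = 1 \<Longrightarrow> \<not> has_edge f"
proof
  assume w: "weight f = 1" and "has_edge f"
  then obtain v u where vu: "parent f v = Some u" by (auto simp: has_edge_def)
  obtain h :: "nat \<Rightarrow> nat" where "\<And>v w. parent f v = Some w \<Longrightarrow> h w < h v" using forest_rank by blast
  then have "h u < h v" using vu by blast
  then have "v \<noteq> u" by auto
  have "v \<in> verts f" "u \<in> verts f" using parent_in_verts [OF vu] by auto
  moreover obtain x where "verts f = {x}" using w by (auto simp: weight_def card_1_singleton_iff)
  ultimately show False using \<open>v \<noteq> u\<close> by auto
qed

lemma has_edge_graft_None: "has_edge (graft (\<lambda>_. None) f g) \<longleftrightarrow> has_edge f \<or> has_edge g"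
proof
  assume "has_edge (graft (\<lambda>_. None) f g)"
  then obtain x where x: "x \<in> join (verts f) (verts g)" "parent (graft (\<lambda>_. None) f g) x \<noteq> None"
    unfolding has_edge_def verts_graft by blast
  show "has_edge f \<or> has_edge g"
  proof (cases "even x")
    case True
    then obtain v where "x = 2 * v" by (elim evenE)
    then have "v \<in> verts f \<and> parent f v \<noteq> None"
      using x by (auto simp: parent_graft split: option.splits)
    then show ?thesis unfolding has_edge_def by blast
  next
    case False
    then obtain v where "x = 2 * v + 1" by (elim oddE)
    then have "v \<in> verts g \<and> parent g v \<noteq> None" using x by (auto simp: parent_graft)
    then show ?thesis unfolding has_edge_def by blast
  qed
next
  assume "has_edge f \<or> has_edge g"
  then show "has_edge (graft (\<lambda>_. None) f g)"
  proof
    assume "has_edge f"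
    then obtain v where "v \<in> verts f" "parent f v \<noteq> None" by (auto simp: has_edge_def)
    then have "2 * v \<in> verts (graft (\<lambda>_. None) f g)" "parent (graft (\<lambda>_. None) f g) (2 * v) \<noteq> None"
      by (auto simp: parent_graft)
    then show ?thesis unfolding has_edge_def by blast
  next
    assume "has_edge g"
    then obtain v where "v \<in> verts g" "parent g v \<noteq> None" by (auto simp: has_edge_def)
    then have "2 * v + 1 \<in> verts (graft (\<lambda>_. None) f g)" "parent (graft (\<lambda>_. None) f g) (2 * v + 1) \<noteq> None"
      by (auto simp: parent_graft)
    then show ?thesis unfolding has_edge_def by blast
  qed
qed

lemma no_edge_parent: "\<not> has_edge f \<Longrightarrow> parent f = (\<lambda>_. None)"
  unfolding has_edge_def by (metis not_Some_eq parent_in_verts(1) ext)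

definition label_mset :: "'u forest \<Rightarrow> 'u multiset" where
  "label_mset f = image_mset (label f) (mset_set (verts f))"

lemma label_mset_dots: "label_mset (dots xs) = mset xs"
proof -
  have "label_mset (dots xs) = image_mset ((!) xs) (mset [0..<length xs])"
    by (simp add: label_mset_def lessThan_atLeast0)
  also have "\<dots> = mset (map ((!) xs) [0..<length xs])" by (rule mset_map [symmetric])
  finally show ?thesis by (simp only: map_nth)
qed

lemma label_mset_iso:
  assumes "iso_via b f g" shows "label_mset f = label_mset g"
proof -
  have bij: "bij_betw b (verts f) (verts g)" by (rule iso_via_bij [OF assms])
  have "label_mset g = image_mset (label g) (image_mset b (mset_set (verts f)))"
    using bij_betw_imp_inj_on [OF bij] bij_betw_imp_surj_on [OF bij]
    by (simp add: label_mset_def image_mset_mset_set)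
  also have "\<dots> = label_mset f"
    unfolding label_mset_def image_mset.compositionality
    by (rule image_mset_cong) (use assms in \<open>simp add: iso_via_def\<close>)
  finally show ?thesis ..
qed

lemma label_mset_relabel:
  assumes "v \<in> verts f"
  shows "label_mset (relabel f v a) = add_mset a (image_mset (label f) (mset_set (verts f - {v})))"
proof -
  have "mset_set (verts f) = add_mset v (mset_set (verts f - {v}))"
    using mset_set.remove [OF finite_verts assms] .
  moreover have "image_mset ((label f)(v := a)) (mset_set (verts f - {v})) =
      image_mset (label f) (mset_set (verts f - {v}))"
    by (rule image_mset_cong) auto
  ultimately show ?thesis by (simp add: label_mset_def)
qed

lemma label_mset_graft: "label_mset (graft \<phi> f g) = label_mset f + label_mset g"
proof -
  let ?e = "\<lambda>v :: nat. 2 * v" and ?o = "\<lambda>v :: nat. 2 * v + 1"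
  have "mset_set (?e ` verts f \<union> ?o ` verts g) = mset_set (?e ` verts f) + mset_set (?o ` verts g)"
    by (rule mset_set_Union) (simp_all only: finite_imageI finite_verts even_odd_disjoint)
  also have "\<dots> = image_mset ?e (mset_set (verts f)) + image_mset ?o (mset_set (verts g))"
    by (subst (1 2) image_mset_mset_set) (auto simp: inj_on_def)
  finally show ?thesis
    unfolding label_mset_def verts_simps label_simps
    by (simp add: image_mset.compositionality o_def)
qed

lemma gen_dots_mset:
  assumes "mset xs = mset ys" shows "gen (dots xs) = gen (dots ys)"
proof -
  obtain p where p: "p permutes {..<length ys}" "permute_list p ys = xs"
    using mset_eq_permutation [OF assms] by blast
  have len: "length xs = length ys" using assms by (rule mset_eq_length)
  have nth: "xs ! v = ys ! p v" if "v < length ys" for v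
    using permute_list_nth [OF p(1) that] p(2) by simp
  show ?thesis
  proof (rule gen_iso [where b = p], rule iso_viaI)
    show "bij_betw p (verts (dots xs)) (verts (dots ys))"
      using permutes_imp_bij [OF p(1)] by (simp add: len)
  qed (simp_all add: len nth)
qed

text \<open>
  A forest without edges is determined by the multiset of its labels.
\<close>

lemma gen_no_edge:
  assumes f: "\<not> has_edge f" and xs: "mset xs = label_mset f"
  shows "gen f = gen (dots xs)"
proof -
  let ?l = "sorted_list_of_set (verts f)"
  have "gen (dots (map (label f) ?l)) = gen f"
  proof (rule gen_iso [where b = "\<lambda>i. ?l ! i"], rule iso_viaI)
    show "bij_betw (\<lambda>i. ?l ! i) (verts (dots (map (label f) ?l))) (verts f)"
      using bij_betw_nth [of ?l "{..<length ?l}" "verts f"] by simp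
  qed (simp_all add: no_edge_parent [OF f])
  moreover have "mset (map (label f) ?l) = mset xs"
    by (simp add: xs label_mset_def flip: mset_sorted_list_of_multiset) (metis mset_set_set finite_verts mset_map set_sorted_list_of_set distinct_sorted_list_of_set)
  ultimately show ?thesis using gen_dots_mset by metis
qed

lemma linear_gen_dots_head: "linear (\<lambda>a. gen (dots (a # xs)))"
proof -
  have "gen (dots (a # xs)) = gen (relabel (dots (0 # xs)) 0 a)" for a
    by (rule gen_eq_labels) (auto simp: nth_Cons split: nat.split)
  then show ?thesis by (simp add: linear_gen_relabel)
qed

lemma homogeneous_prim_part: "homogeneous_primitive (prim_part (gen f)) (weight f)"
  by (simp add: homogeneous_primitive_def prim_part_primitive prim_part_deg gen_in_hopf_deg)

subsection \<open>Words in the letters\<close>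

text \<open>
  The length-one component of the arborification map into the shuffle algebra.
\<close>

definition single_label :: "'u::real_vector forest \<Rightarrow> 'u" where
  "single_label f = (if weight f = 1 then label f (the_elem (verts f)) else 0)"

lemma single_labelI: "verts f = {v} \<Longrightarrow> single_label f = label f v"
  by (simp add: single_label_def weight_def)

lemma descends_single_label: "descends single_label"
proof (rule descends_forestI)
  fix b and f g :: "'a forest" assume iso: "iso_via b f g"
  show "single_label f = single_label g"
  proof (cases "weight f = 1")
    case True
    then obtain v where v: "verts f = {v}" by (auto simp: weight_def card_1_singleton_iff)
    then have "verts g = {b v}" using bij_betw_imp_surj_on [OF iso_via_bij [OF iso]] by simp
    then show ?thesis using v iso by (simp add: single_labelI iso_via_def)
  next
    case False
    then show ?thesis using iso_via_weight [OF iso] by (simp add: single_label_def)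
  qed
next
  fix f :: "'a forest" and v assume v: "v \<in> verts f"
  show "linear (\<lambda>a. single_label (relabel f v a))"
  proof (cases "weight f = 1")
    case True
    then have "verts f = {v}" using v by (auto simp: weight_def card_1_singleton_iff)
    then have "single_label (relabel f v a) = a" for a by (simp add: single_labelI)
    then show ?thesis by (simp add: linear_id_fun)
  next
    case False
    then show ?thesis by (simp add: single_label_def linear_zero)
  qed
qed

lemma gen_single_vertex:
  assumes "weight f = 1" shows "gen (dots [single_label f]) = gen f"
proof -
  obtain v where v: "verts f = {v}" using assms by (auto simp: weight_def card_1_singleton_iff)
  then have "mset [single_label f] = label_mset f" by (simp add: label_mset_def single_labelI)
  then show ?thesis by (rule gen_no_edge [OF no_edge_single_vertex [OF assms], symmetric])
qed

lemma arborification_single: "arborification single_label (\<lambda>_ _. 0) (\<lambda>\<gamma>. \<gamma>)"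
proof
  show "descends (single_label :: 'a forest \<Rightarrow> 'a)" by (rule descends_single_label)
  show "single_label f = 0" if "has_edge f" for f :: "'a forest"
    using that no_edge_single_vertex [of f] by (auto simp: single_label_def)
  show "single_label f = 0" if "verts f = {}" for f :: "'a forest"
    using that by (simp add: single_label_def weight_def)
  show "single_label (graft (\<lambda>_. None) f g) = 0" if "verts f \<noteq> {}" "verts g \<noteq> {}" for f g :: "'a forest"
    using that by (simp add: single_label_def flip: weight_0_iff)
  show "single_label (dots [\<gamma>]) = \<gamma>" for \<gamma> :: 'a
    by (subst single_labelI [of _ 0]) auto
  show "bilinear (\<lambda>_ _. 0 :: 'a)" by (simp add: bilinear_def linear_zero)
qed

lemma growth_word_map_deg:
  assumes "\<And>w. w \<in> set ws \<Longrightarrow> homogeneous_primitive (F w) (d w)"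
  shows "growth_word (map F ws) \<in> hopf_deg (\<Sum>w\<leftarrow>ws. d w)"
  by (rule growth_word_degrees) (use assms in \<open>auto simp: list_all2_conv_all_nth\<close>)

lemma dual_arborification_single:
  "dual_arborification (single_label :: 'a::real_vector dual forest \<Rightarrow> 'a dual) (\<lambda>_ _. 0) (\<lambda>\<gamma>. \<gamma>) (\<lambda>\<gamma>. gen (dots [\<gamma>])) (\<lambda>f. weight f > 1)
    sh_deg (\<lambda>n. {ws. length ws = n})"
proof -
  interpret arborification "single_label :: 'a dual forest \<Rightarrow> 'a dual" "\<lambda>_ _. 0" "\<lambda>\<gamma>. \<gamma>"
    by (rule arborification_single)
  show ?thesis
  proof unfold_locales
    show "gen (dots [\<gamma> + \<delta>]) = gen (dots [\<gamma>]) + gen (dots [\<delta>])"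
      "gen (dots [c *\<^sub>R \<gamma>]) = c *\<^sub>R gen (dots [\<gamma>])" for c and \<gamma> \<delta> :: "'a dual"
      by (rule linear_add [OF linear_gen_dots_head] linear_scale [OF linear_gen_dots_head])+
    show "letter (gen (dots [w])) = w" for w by (simp add: letter_gen lam_dot)
    show "gen (dots [single_label f]) = gen f" if "\<not> weight f > 1" "verts f \<noteq> {}" for f :: "'a dual forest"
      using that by (intro gen_single_vertex) (simp flip: weight_0_iff)
    show "single_label f = 0" if "weight f > 1" for f :: "'a dual forest"
      using that by (simp add: single_label_def)
    show "sh_deg n = span (gen ` {ws :: 'a dual list. length ws = n})" for n
      unfolding sh_deg_def by (rule arg_cong [where f = span]) auto
    show "growth_word (map (\<lambda>w. prim_part (gen (dots [w]))) ws) \<in> hopf_deg n"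
      if "ws \<in> {ws. length ws = n}" for ws :: "'a dual list" and n
    proof -
      have "homogeneous_primitive (prim_part (gen (dots [w]))) 1" for w :: "'a dual"
        using homogeneous_prim_part [of "dots [w]"] by simp
      then have "growth_word (map (\<lambda>w. prim_part (gen (dots [w]))) ws) \<in> hopf_deg (\<Sum>w\<leftarrow>ws. 1)"
        by (rule growth_word_map_deg)
      then show ?thesis using that by (simp add: sum_list_triv)
    qed
  qed
qed

lemma prim_part_single_vertex: "prim_part (gen (dots [\<gamma>])) = gen (dots [\<gamma>])"
proof -
  have "plus_part (gen (restrict_forest (dots [\<gamma>]) A)) = 0 \<or> gen (restrict_forest (dots [\<gamma>]) (verts (dots [\<gamma>]) - A)) = hone"
    for A
  proof (cases "0 \<in> A")
    case True
    then show ?thesis by (intro disjI2 gen_empty) auto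
  next
    case False
    then have "verts (restrict_forest (dots [\<gamma>]) A) = {}" by auto
    then show ?thesis by (simp add: plus_part_gen)
  qed
  then have "natural_growth (plus_part (gen (restrict_forest (dots [\<gamma>]) A)))
    (prim_part (gen (restrict_forest (dots [\<gamma>]) (verts (dots [\<gamma>]) - A)))) = 0" for A
    using linear_0 [OF linear_natural_growth(1)] linear_0 [OF linear_natural_growth(2)]
    by (metis prim_part_hone)
  then have "split_sum (\<lambda>u v. natural_growth (plus_part u) (prim_part v)) (gen (dots [\<gamma>])) = 0"
    unfolding split_sum_gen [OF bilinear_plus_growth [OF linear_prim_part]] by (intro sum.neutral ballI)
  moreover have "plus_part (gen (dots [\<gamma>])) = gen (dots [\<gamma>])"
    by (simp add: plus_part_gen lessThan_Suc)
  ultimately show ?thesis by (subst prim_part_eq) simp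
qed

subsection \<open>Words in symmetric tensors\<close>

lemma descends_monomialI:
  fixes \<phi> :: "'u::real_vector monomial \<Rightarrow> 'x::real_vector"
  assumes "\<And>M. linear (\<lambda>a. \<phi> (insert_factor a M))"
  shows "descends \<phi>"
proof -
  have 1: "free_ext \<phi> (Poly_Mapping.single (insert_factor (a + b) M) 1 - Poly_Mapping.single (insert_factor a M) 1
     - Poly_Mapping.single (insert_factor b M) 1) = 0" for a b M
    unfolding free_ext_diff free_ext_single linear_add [OF assms] by simp
  have 2: "free_ext \<phi> (Poly_Mapping.single (insert_factor (c *\<^sub>R a) M) 1
     - c *\<^sub>R Poly_Mapping.single (insert_factor a M) 1) = 0" for a c M
    unfolding free_ext_diff free_ext_scaleR free_ext_single linear_scale [OF assms] by simp
  show ?thesis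
    unfolding descends_def relations_monomial_def
    by (intro ballI, elim UnE CollectE exE conjE) (hypsubst, rule 1 2)+
qed

lemma linear_gen_insert_factor: "linear (\<lambda>a. gen (insert_factor a M))"
proof (rule linearI)
  have d: "descends (gen :: 'a monomial \<Rightarrow> _)" using descends_linear [OF linear_id_fun] .
  have 1: "free_ext gen r = 0" if "r \<in> relations" for r :: "'a monomial \<Rightarrow>\<^sub>0 real"
    using d that unfolding descends_def by (rule bspec)
  show "gen (insert_factor (a + b) M) = gen (insert_factor a M) + gen (insert_factor b M)" for a b
  proof -
    have "Poly_Mapping.single (insert_factor (a + b) M) 1 - Poly_Mapping.single (insert_factor a M) 1
        - Poly_Mapping.single (insert_factor b M) 1 \<in> (relations :: ('a monomial \<Rightarrow>\<^sub>0 real) set)"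
      unfolding relations_monomial_def by (rule UnI1, intro CollectI exI conjI, rule refl, rule TrueI)
    from 1 [OF this] show ?thesis
      unfolding free_ext_diff free_ext_single by (simp add: diff_diff_eq)
  qed
  show "gen (insert_factor (c *\<^sub>R a) M) = c *\<^sub>R gen (insert_factor a M)" for c a
  proof -
    have "Poly_Mapping.single (insert_factor (c *\<^sub>R a) M) 1 - c *\<^sub>R Poly_Mapping.single (insert_factor a M) 1
        \<in> (relations :: ('a monomial \<Rightarrow>\<^sub>0 real) set)"
      unfolding relations_monomial_def by (rule UnI2, intro CollectI exI conjI, rule refl, rule TrueI)
    from 1 [OF this] show ?thesis
      unfolding free_ext_diff free_ext_scaleR free_ext_single by simp
  qed
qed

lemma Abs_monomial_add_mset: "Abs_monomial (add_mset a M) = insert_factor a M"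
  by (metis factors_inverse insert_factor.rep_eq)

lemma times_insert_factor: "times_monomial (insert_factor a M) M' = insert_factor a (M + factors M')"
  by (simp add: factors_inject [symmetric] times_monomial.rep_eq insert_factor.rep_eq)

lemma times_monomial_commute: "times_monomial M M' = times_monomial M' M"
  by (simp add: factors_inject [symmetric] times_monomial.rep_eq add.commute)

lemma descends_times_monomial_left: "descends (\<lambda>M. gen (times_monomial M M'))"
  by (rule descends_monomialI) (simp add: times_insert_factor linear_gen_insert_factor)

lemma descends_times_monomial_right: "descends (\<lambda>M'. gen (times_monomial M M'))"
  unfolding times_monomial_commute [of M] by (rule descends_times_monomial_left)

lemma bilinear_sym_mult: "bilinear sym_mult"
  unfolding sym_mult_def by (rule bilinext [OF descends_times_monomial_right descends_times_monomial_left])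

lemma sym_mult_gen: "sym_mult (gen M) (gen M') = gen (times_monomial M M')"
  unfolding sym_mult_def by (rule bilinext [OF descends_times_monomial_right descends_times_monomial_left])

text \<open>
  The length-one component of the arborification map into the quasi-shuffle algebra.
\<close>

definition sym_label :: "'u::real_vector forest \<Rightarrow> 'u sym" where
  "sym_label f = (if weight f = 0 \<or> has_edge f then 0 else gen (Abs_monomial (label_mset f)))"

lemma label_mset_nonempty: "verts f \<noteq> {} \<Longrightarrow> label_mset f \<noteq> {#}"
  by (simp add: label_mset_def mset_set_empty_iff)

lemma factors_label_mset: "verts f \<noteq> {} \<Longrightarrow> factors (Abs_monomial (label_mset f)) = label_mset f"
  by (simp add: Abs_monomial_inverse label_mset_nonempty)

lemma has_edge_iso: "iso_via b f g \<Longrightarrow> has_edge f \<longleftrightarrow> has_edge g"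
proof -
  assume iso: "iso_via b f g"
  have e: "has_edge h \<longleftrightarrow> roots h \<noteq> verts h" for h :: "'a forest"
    by (auto simp: has_edge_def roots_def) (metis (mono_tags, lifting) mem_Collect_eq option.distinct(1))
  have "inj_on b (verts f)" "verts g = b ` verts f"
    using iso_via_bij [OF iso] by (auto simp: bij_betw_def)
  moreover have "roots f \<subseteq> verts f" by (auto simp: roots_def)
  ultimately show ?thesis
    unfolding e iso_via_roots [OF iso] by (simp add: inj_on_image_eq_iff)
qed

lemma descends_sym_label: "descends sym_label"
proof (rule descends_forestI)
  fix b and f g :: "'a forest" assume iso: "iso_via b f g"
  show "sym_label f = sym_label g"
    unfolding sym_label_def iso_via_weight [OF iso] has_edge_iso [OF iso] label_mset_iso [OF iso] ..
next
  fix f :: "'a forest" and v assume v: "v \<in> verts f"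
  have "has_edge (relabel f v a) = has_edge f" for a by (simp add: has_edge_def)
  then show "linear (\<lambda>a. sym_label (relabel f v a))"
    by (cases "weight f = 0 \<or> has_edge f")
      (simp_all add: sym_label_def label_mset_relabel [OF v] Abs_monomial_add_mset
        linear_gen_insert_factor linear_zero)
qed

lemma arborification_sym: "arborification sym_label sym_mult sym_of"
proof
  show "descends (sym_label :: 'a forest \<Rightarrow> 'a sym)" by (rule descends_sym_label)
  show "sym_label f = 0" if "has_edge f" for f :: "'a forest"
    using that by (simp add: sym_label_def)
  show "sym_label f = 0" if "verts f = {}" for f :: "'a forest"
    using that by (simp add: sym_label_def weight_def)
  show "sym_label (graft (\<lambda>_. None) f g) = sym_mult (sym_label f) (sym_label g)"
    if ne: "verts f \<noteq> {}" "verts g \<noteq> {}" for f g :: "'a forest"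
  proof (cases "has_edge f \<or> has_edge g")
    case True
    then show ?thesis
      by (auto simp: sym_label_def has_edge_graft_None bilinear_lzero [OF bilinear_sym_mult]
          bilinear_rzero [OF bilinear_sym_mult])
  next
    case False
    have "times_monomial (Abs_monomial (label_mset f)) (Abs_monomial (label_mset g)) =
      Abs_monomial (label_mset f + label_mset g)"
      using ne by (simp add: factors_inject [symmetric] times_monomial.rep_eq factors_label_mset
          Abs_monomial_inverse label_mset_nonempty)
    then show ?thesis
      using False ne by (simp add: sym_label_def has_edge_graft_None label_mset_graft sym_mult_gen weight_0_iff)
  qed
  show "sym_label (dots [\<gamma>]) = sym_of \<gamma>" for \<gamma> :: 'a
    by (simp add: sym_label_def has_edge_def label_mset_dots Abs_monomial_add_mset sym_of_def)
  show "bilinear (sym_mult :: 'a sym \<Rightarrow> _)" by (rule bilinear_sym_mult)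
qed

text \<open>
  Well defined on multisets of labels, because the order of the single vertices does not matter.
\<close>

definition dots_of :: "'u::real_vector sym \<Rightarrow> 'u hopf" where
  "dots_of = linext (\<lambda>M. gen (dots (SOME xs. mset xs = factors M)))"

lemma gen_dots_some: "mset xs = M \<Longrightarrow> gen (dots (SOME xs. mset xs = M)) = gen (dots xs)"
  by (rule gen_dots_mset) (rule someI2, assumption, simp)

lemma descends_dots_of: "descends (\<lambda>M. gen (dots (SOME xs. mset xs = factors M)))"
proof (rule descends_monomialI)
  fix M :: "'a multiset"
  obtain ys where ys: "mset ys = M" using ex_mset by blast
  have "gen (dots (SOME xs. mset xs = factors (insert_factor a M))) = gen (dots (a # ys))" for a
    by (rule gen_dots_some) (simp add: insert_factor.rep_eq ys)
  then show "linear (\<lambda>a. gen (dots (SOME xs. mset xs = factors (insert_factor a M))))"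
    by (simp add: linear_gen_dots_head)
qed

lemma linear_dots_of: "linear dots_of"
  unfolding dots_of_def by (rule linext [OF descends_dots_of])

lemma dots_of_gen: "mset xs = factors M \<Longrightarrow> dots_of (gen M) = gen (dots xs)"
  unfolding dots_of_def linext(2) [OF descends_dots_of] by (rule gen_dots_some)

lemma factors_nonempty: "factors M \<noteq> {#}"
  using factors [of M] by simp

lemma dual_arborification_sym:
  "dual_arborification (sym_label :: 'a::real_vector dual forest \<Rightarrow> 'a dual sym) sym_mult sym_of dots_of has_edge
    qsh_deg (\<lambda>n. {map gen Ms | Ms. (\<Sum>M\<leftarrow>Ms. size (factors M)) = n})"
proof -
  interpret arborification "sym_label :: 'a dual forest \<Rightarrow> 'a dual sym" sym_mult sym_of
    by (rule arborification_sym)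
  show ?thesis
  proof unfold_locales
    show "dots_of (w + w') = dots_of w + dots_of w'" "dots_of (c *\<^sub>R w) = c *\<^sub>R dots_of w"
      for c and w w' :: "'a dual sym"
      by (rule linear_add [OF linear_dots_of] linear_scale [OF linear_dots_of])+
    show "letter (dots_of w) = w" for w
    proof (rule linear_eq_on_gen [OF linear_compose [OF linear_dots_of linear_letter, unfolded o_def] linear_id_fun])
      fix M :: "'a dual monomial"
      obtain xs where xs: "mset xs = factors M" using ex_mset by blast
      then have "xs \<noteq> []" using factors_nonempty [of M] by auto
      then show "letter (dots_of (gen M)) = gen M"
        by (simp add: dots_of_gen [OF xs] letter_gen sym_label_def has_edge_def label_mset_dots xs factors_inverse)
    qed
    show "dots_of (sym_label f) = gen f" if f: "\<not> has_edge f" "verts f \<noteq> {}" for f :: "'a dual forest"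
    proof -
      obtain xs where xs: "mset xs = label_mset f" using ex_mset by blast
      have "dots_of (gen (Abs_monomial (label_mset f))) = gen (dots xs)"
        using f(2) by (intro dots_of_gen) (simp add: xs factors_label_mset)
      then show ?thesis
        using f gen_no_edge [OF f(1) xs] by (simp add: sym_label_def weight_0_iff)
    qed
    show "sym_label f = 0" if "has_edge f" for f :: "'a dual forest"
      using that by (simp add: sym_label_def)
    show "qsh_deg n = span (gen ` {map gen Ms | Ms :: 'a dual monomial list. (\<Sum>M\<leftarrow>Ms. size (factors M)) = n})" for n
      unfolding qsh_deg_def by (rule arg_cong [where f = span]) auto
    show "growth_word (map (\<lambda>w. prim_part (dots_of w)) ws) \<in> hopf_deg n"
      if ws: "ws \<in> {map gen Ms | Ms. (\<Sum>M\<leftarrow>Ms. size (factors M)) = n}" for ws :: "'a dual sym list" and n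
    proof -
      obtain Ms where Ms: "ws = map gen Ms" "(\<Sum>M\<leftarrow>Ms. size (factors M)) = n" using ws by blast
      have "homogeneous_primitive (prim_part (dots_of (gen M))) (size (factors M))" for M :: "'a dual monomial"
      proof -
        obtain xs where xs: "mset xs = factors M" using ex_mset by blast
        then have "length xs = size (factors M)" by (metis size_mset)
        then show ?thesis using homogeneous_prim_part [of "dots xs"] by (simp add: dots_of_gen [OF xs])
      qed
      then show ?thesis
        using growth_word_map_deg [of Ms "\<lambda>M. prim_part (dots_of (gen M))" "\<lambda>M. size (factors M)"] Ms
        by (simp add: o_def)
    qed
  qed
qed

lemma primitives_r_eq: "primitives_r = range (\<lambda>w. prim_part (dots_of w))"
proof -
  have l: "linear (\<lambda>w :: 'a sym. prim_part (dots_of w))"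
    using linear_compose [OF linear_dots_of linear_prim_part] by (simp add: o_def)
  have "range (\<lambda>w :: 'a sym. prim_part (dots_of w)) = (\<lambda>w. prim_part (dots_of w)) ` span (range gen)"
    by (simp add: span_gen)
  also have "\<dots> = span ((\<lambda>w. prim_part (dots_of w)) ` range gen)"
    by (rule linear_span_image [OF l, symmetric])
  also have "(\<lambda>w :: 'a sym. prim_part (dots_of w)) ` range gen = {prim_part (gen (dots \<gamma>s)) | \<gamma>s. \<gamma>s \<noteq> []}"
  proof (intro equalityI subsetI)
    fix x assume "x \<in> (\<lambda>w :: 'a sym. prim_part (dots_of w)) ` range gen"
    then obtain M :: "'a monomial" where x: "x = prim_part (dots_of (gen M))" by blast
    obtain xs where xs: "mset xs = factors M" using ex_mset by blast
    then have "xs \<noteq> []" using factors_nonempty [of M] by auto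
    then show "x \<in> {prim_part (gen (dots \<gamma>s)) | \<gamma>s. \<gamma>s \<noteq> []}" using x dots_of_gen [OF xs] by auto
  next
    fix x :: "'a hopf" assume "x \<in> {prim_part (gen (dots \<gamma>s)) | \<gamma>s. \<gamma>s \<noteq> []}"
    then obtain xs where x: "x = prim_part (gen (dots xs))" "xs \<noteq> []" by blast
    then have "mset xs = factors (Abs_monomial (mset xs))" by (simp add: Abs_monomial_inverse)
    then have "x = prim_part (dots_of (gen (Abs_monomial (mset xs))))" using x dots_of_gen by metis
    then show "x \<in> (\<lambda>w :: 'a sym. prim_part (dots_of w)) ` range gen" by blast
  qed
  finally show ?thesis by (simp add: primitives_r_def prim_proj_eq)
qed

lemma single_vertex_trees_eq: "single_vertex_trees = range (\<lambda>\<gamma>. prim_part (gen (dots [\<gamma>])))"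
proof -
  have "subspace (range (\<lambda>\<gamma> :: 'a. gen (dots [\<gamma>])))"
    by (rule linear_subspace_image [OF linear_gen_dots_head subspace_UNIV])
  then show ?thesis
    unfolding single_vertex_trees_def prim_part_single_vertex by (rule span_eq_iff [THEN iffD2])
qed

theorem corollary2p22:
  fixes X :: "real \<Rightarrow> real \<Rightarrow> 'v::real_vector hopf"
    and \<rho> T :: real and \<omega> :: "real \<Rightarrow> real \<Rightarrow> real"
    and D\<^sub>1 D\<^sub>2 :: "'v dual hopf set"
  assumes fin_dim: "\<exists>B :: 'v set. finite B \<and> span B = UNIV"
    and rho: "1 \<le> \<rho>" and T: "0 \<le> T" and control: "control T \<omega>"
    and X: "branched_rough_path \<rho> \<omega> T X"
    and D1: "D\<^sub>1 = primitives_generated_by (\<lambda>f. weight f > 1)"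
    and D2: "D\<^sub>2 = primitives_generated_by has_edge"
  shows
    "(direct_complement primitives single_vertex_trees D\<^sub>1 \<and>
      (geometric \<rho> \<omega> T X \<longleftrightarrow>
        (\<forall>ps. set ps \<subseteq> primitives \<and> growth_word ps \<in> hopf_le (nat \<lfloor>\<rho>\<rfloor>) \<and> (\<exists>p\<in>set ps. p \<in> D\<^sub>1) \<longrightarrow>
          (\<forall>s t. 0 \<le> s \<and> s \<le> t \<and> t \<le> T \<longrightarrow> pairing (growth_word ps) (X s t) = 0)))) \<and>
     (direct_complement primitives primitives_r D\<^sub>2 \<and>
      (quasi_geometric \<rho> \<omega> T X \<longleftrightarrow>
        (\<forall>ps. set ps \<subseteq> primitives \<and> growth_word ps \<in> hopf_le (nat \<lfloor>\<rho>\<rfloor>) \<and> (\<exists>p\<in>set ps. p \<in> D\<^sub>2) \<longrightarrow>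
          (\<forall>s t. 0 \<le> s \<and> s \<le> t \<and> t \<le> T \<longrightarrow> pairing (growth_word ps) (X s t) = 0))))"
proof -
  interpret G: dual_arborification "single_label :: 'v dual forest \<Rightarrow> _" "\<lambda>_ _. 0" "\<lambda>\<gamma>. \<gamma>"
    "\<lambda>\<gamma>. gen (dots [\<gamma>])" "\<lambda>f. weight f > 1" sh_deg "\<lambda>n. {ws. length ws = n}"
    by (rule dual_arborification_single)
  interpret S: dual_arborification "sym_label :: 'v dual forest \<Rightarrow> _" sym_mult sym_of dots_of has_edge
    qsh_deg "\<lambda>n. {map gen Ms | Ms. (\<Sum>M\<leftarrow>Ms. size (factors M)) = n}"
    by (rule dual_arborification_sym)
  have arbor: "arbor = G.arb"
    unfolding arbor_def shuffle_eq_quasi by (rule G.arb_the)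
  have geo: "geometric \<rho> \<omega> T X \<longleftrightarrow>
      (\<forall>ps. set ps \<subseteq> primitives \<and> growth_word ps \<in> hopf_le (nat \<lfloor>\<rho>\<rfloor>) \<and> (\<exists>p\<in>set ps. p \<in> D\<^sub>1) \<longrightarrow>
        (\<forall>s t. 0 \<le> s \<and> s \<le> t \<and> t \<le> T \<longrightarrow> pairing (growth_word ps) (X s t) = 0))"
    unfolding geometric_def shuffle_eq_quasi D1 arbor by (rule G.factors_iff_vanishes [OF X])
  have qarbor: "qarbor = S.arb"
    unfolding qarbor_def qshuffle_eq_quasi by (rule S.arb_the)
  have qgeo: "quasi_geometric \<rho> \<omega> T X \<longleftrightarrow>
      (\<forall>ps. set ps \<subseteq> primitives \<and> growth_word ps \<in> hopf_le (nat \<lfloor>\<rho>\<rfloor>) \<and> (\<exists>p\<in>set ps. p \<in> D\<^sub>2) \<longrightarrow>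
        (\<forall>s t. 0 \<le> s \<and> s \<le> t \<and> t \<le> T \<longrightarrow> pairing (growth_word ps) (X s t) = 0))"
    unfolding quasi_geometric_def qshuffle_eq_quasi D2 qarbor by (rule S.factors_iff_vanishes [OF X])
  have "direct_complement primitives single_vertex_trees D\<^sub>1"
    using G.complement unfolding D1 single_vertex_trees_eq G.sec_def [abs_def] .
  moreover have "direct_complement primitives primitives_r D\<^sub>2"
    using S.complement unfolding D2 primitives_r_eq S.sec_def [abs_def] .
  ultimately show ?thesis using geo qgeo by blast
qed

end
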